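(* Let $\mu_1,\mu_2$ be an Angelesco system on $[a_1,b_1]$, $[a_2,b_2]$ with $\mu_j'>0$ almost everywhere on $[a_j,b_j]$ for $j=1,2$. Suppose both intervals $[a_1,b_1]$ and $[a_2,b_2]$ are of the same size, $b_1-a_1=b_2-a_2$ (so that $\mathrm{supp}(\nu_1)=[a_1,b_1]$ and $\mathrm{supp}(\nu_2)=[a_2,b_2]$), and let $a_2-b_1>0$. If $f$ is continuous on $[a_1,b_1]$ and on $[a_2,b_2]$, then both quadrature rules converge: $$\lim_{n\to\infty}\sum_{j=1}^{2n}\lambda_{j,2n}^{(1)}f(x_{j,2n})=\int_{a_1}^{b_1}f(x)\,d\mu_1(x),\qquad \lim_{n\to\infty}\sum_{j=1}^{2n}\lambda_{j,2n}^{(2)}f(x_{j,2n})=\int_{a_2}^{b_2}f(x)\,d\mu_2(x).$$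
   Context: Setting: $-\infty<a_1<b_1\le a_2<b_2<\infty$, and $\mu_1,\mu_2$ are finite positive Borel measures with $\mathrm{supp}(\mu_j)\subset[a_j,b_j]$ (an Angelesco system); $\mu_j'$ denotes the density of the absolutely continuous part of $\mu_j$ with respect to Lebesgue measure. For $n\ge1$, $P_{n,n}$ is the (unique) monic polynomial of degree $2n$ with $\int P_{n,n}(x)x^k\,d\mu_j(x)=0$ for $0\le k\le n-1$ and $j=1,2$. It is known that $P_{n,n}$ has $n$ simple zeros in $(a_1,b_1)$ and $n$ simple zeros in $(a_2,b_2)$; they are denoted in increasing order $x_{1,2n}<\dots<x_{n,2n}$ (in $(a_1,b_1)$) and $x_{n+1,2n}<\dots<x_{2n,2n}$ (in $(a_2,b_2)$). The quadrature weights are $\lambda_{k,2n}^{(j)}=\int \ell_{k,2n}(x)\,d\mu_j(x)$, $1\le k\le 2n$, $j=1,2$, where $\ell_{k,2n}$ is the polynomial of degree at most $2n-1$ with $\ell_{k,2n}(x_{i,2n})=\delta_{i,k}$. Consequently $\sum_{k=1}^{2n}\lambda_{k,2n}^{(j)}P(x_{k,2n})=\int P\,d\mu_j$ for every polynomial $P$ of degree at most $3n-1$. Vector equilibrium problem: $(\nu_1,\nu_2)$ is the unique minimizer of $I(\nu_1,\nu_1)+I(\nu_2,\nu_2)+I(\nu_1,\nu_2)$ over all probability measures $\nu_1$ on $[a_1,b_1]$ and $\nu_2$ on $[a_2,b_2]$, where $I(\nu_i,\nu_j)=\iint\log\frac1{|x-y|}\,d\nu_j(x)\,d\nu_i(y)$.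 *)

theory Defs
  imports "HOL-Analysis.Analysis" "HOL-Computational_Algebra.Polynomial"
begin

definition measure_support :: "real measure \<Rightarrow> real set" where
  "measure_support \<mu> = {x. \<forall>U. open U \<longrightarrow> x \<in> U \<longrightarrow> 0 < emeasure \<mu> U}"

definition angelesco_system ::
    "real \<Rightarrow> real \<Rightarrow> real \<Rightarrow> real \<Rightarrow> real measure \<Rightarrow> real measure \<Rightarrow> bool" where
  "angelesco_system a1 b1 a2 b2 \<mu>1 \<mu>2 \<longleftrightarrow>
     a1 < b1 \<and> b1 \<le> a2 \<and> a2 < b2 \<and>
     sets \<mu>1 = sets borel \<and> finite_measure \<mu>1 \<and> measure_support \<mu>1 \<subseteq> {a1..b1} \<and>
     sets \<mu>2 = sets borel \<and> finite_measure \<mu>2 \<and> measure_support \<mu>2 \<subseteq> {a2..b2}"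

text \<open>
  \<open>w\<close> is (a version of) the density \<open>\<mu>'\<close> of the absolutely continuous part of \<open>\<mu>\<close>: the
  Lebesgue decomposition of \<open>\<mu>\<close> is \<open>w dx + \<sigma>\<close> with \<open>\<sigma>\<close> concentrated on a Lebesgue null set.
  Such a \<open>w\<close> is unique up to Lebesgue almost everywhere equality. The library's \<open>RN_deriv\<close>
  does not serve here, since it is meaningful only when \<open>\<mu>\<close> itself is absolutely continuous.
\<close>
definition is_ac_density :: "real measure \<Rightarrow> (real \<Rightarrow> ennreal) \<Rightarrow> bool" where
  "is_ac_density \<mu> w \<longleftrightarrow>
     w \<in> borel_measurable borel \<and>
     (\<exists>\<sigma>. sets \<sigma> = sets borel \<and>
          (\<exists>N \<in> null_sets lborel. emeasure \<sigma> (- N) = 0) \<and>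
          (\<forall>A \<in> sets borel. emeasure \<mu> A = emeasure (density lborel w) A + emeasure \<sigma> A))"

text \<open>The polynomial \<open>P\<^bsub>n,n\<^esub>\<close>.\<close>
definition diag_mop :: "real measure \<Rightarrow> real measure \<Rightarrow> nat \<Rightarrow> real poly" where
  "diag_mop \<mu>1 \<mu>2 n =
     (THE P. lead_coeff P = 1 \<and> degree P = 2 * n \<and>
        (\<forall>k<n. (\<integral>x. poly P x * x ^ k \<partial>\<mu>1) = 0 \<and> (\<integral>x. poly P x * x ^ k \<partial>\<mu>2) = 0))"

text \<open>
  \<open>node \<mu>1 \<mu>2 n k\<close> is \<open>x\<^bsub>k,2n\<^esub>\<close> for \<open>1 \<le> k \<le> 2n\<close>. Because \<open>b1 \<le> a2\<close>, the zeros in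
  \<open>(a1,b1)\<close> followed by those in \<open>(a2,b2)\<close> are just all zeros in increasing order.
\<close>
definition node :: "real measure \<Rightarrow> real measure \<Rightarrow> nat \<Rightarrow> nat \<Rightarrow> real" where
  "node \<mu>1 \<mu>2 n k = sorted_list_of_set {x. poly (diag_mop \<mu>1 \<mu>2 n) x = 0} ! (k - 1)"

definition fundamental_poly :: "real measure \<Rightarrow> real measure \<Rightarrow> nat \<Rightarrow> nat \<Rightarrow> real poly" where
  "fundamental_poly \<mu>1 \<mu>2 n k =
     (THE l. degree l \<le> 2 * n - 1 \<and>
        (\<forall>i\<in>{1..2 * n}. poly l (node \<mu>1 \<mu>2 n i) = (if i = k then 1 else 0)))"

text \<open>
  \<open>quad_weight \<mu>1 \<mu>2 \<mu> n k\<close> with \<open>\<mu> = \<mu>1\<close> (resp. \<open>\<mu> = \<mu>2\<close>) is the weight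
  \<open>\<lambda>\<^bsub>k,2n\<^esub>\<close> of the first (resp. second) quadrature rule.
\<close>
definition quad_weight ::
    "real measure \<Rightarrow> real measure \<Rightarrow> real measure \<Rightarrow> nat \<Rightarrow> nat \<Rightarrow> real" where
  "quad_weight \<mu>1 \<mu>2 \<mu> n k = (\<integral>x. poly (fundamental_poly \<mu>1 \<mu>2 n k) x \<partial>\<mu>)"

end

theory Submission
  imports Defs "HOL-Complex_Analysis.Complex_Analysis" "HOL-Real_Asymp.Real_Asymp"
begin

text \<open>
  Write \<open>P\<^sub>n\<^sub>,\<^sub>n = p q\<close> with the zeros of \<open>p\<close> in \<open>[a\<^sub>1, b\<^sub>1]\<close> and those of \<open>q\<close> in \<open>[a\<^sub>2, b\<^sub>2]\<close>, and let
  \<open>N\<^sub>1\<close>, \<open>N\<^sub>2\<close> be the integrals of \<open>p\<^sup>2 \<bar>q\<bar>\<close> against \<open>\<mu>\<^sub>1\<close> and of \<open>q\<^sup>2 \<bar>p\<bar>\<close> against \<open>\<mu>\<^sub>2\<close>. The weights of the first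
  rule are positive at the zeros of \<open>p\<close>, and at a zero \<open>z\<close> of \<open>q\<close> they are at most a constant times
  \<open>N\<^sub>1 / (p(z)\<^sup>2 \<bar>q'(z)\<bar>)\<close>. As the rule is exact for polynomials, it suffices that this quotient decays
  exponentially.

  Up to factors \<open>exp (\<epsilon> n)\<close> the following holds. By a Remez inequality, \<open>N\<^sub>1\<close> is the maximum of
  \<open>p\<^sup>2 \<bar>q\<bar>\<close> on \<open>[a\<^sub>1, b\<^sub>1]\<close>. Orthogonality to \<open>p / ((x - \<alpha>) (x - \<beta>))\<close> forces \<open>p\<^sup>2 \<bar>q\<bar>\<close>, stripped of its zeros
  at \<open>\<alpha>\<close> and \<open>\<beta>\<close>, to reach the size of \<open>N\<^sub>1\<close> between consecutive zeros \<open>\<alpha>, \<beta>\<close> of \<open>p\<close>; with log-concavity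
  this gives \<open>p'(\<alpha>)\<^sup>2 \<bar>q(\<alpha>)\<bar> \<ge> N\<^sub>1\<close> at every zero \<open>\<alpha>\<close> of \<open>p\<close>. Summed over all zeros, these upper and lower
  bounds say that \<open>(p, q)\<close> and its mirror image under \<open>x \<mapsto> a\<^sub>1 + b\<^sub>2 - x\<close> almost solve the same vector
  equilibrium problem. Positive definiteness of the logarithmic energy then makes \<open>\<bar>p\<bar>\<close> and the mirror
  image of \<open>\<bar>q\<bar>\<close> agree on \<open>[a\<^sub>2, b\<^sub>2]\<close>, and \<open>N\<^sub>1\<close> agree with \<open>N\<^sub>2\<close>, without any limit measure. The remaining
  strict inequality \<open>N\<^sub>1 < \<bar>p(a\<^sub>2)\<bar>\<^sup>3\<close>, with an exponentially large margin, comes from concavity of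
  \<open>ln \<bar>p\<bar>\<close> to the right of its zeros.
\<close>

section \<open>Measures with almost everywhere positive density\<close>

text \<open>The exponent 3 in the last inequality comes from the weights. The lower bound at zeros,
  applied to the second measure at a zero z of q, reads q'(z)^2 |p(z)| >= N_2, and N_2 agrees with
  N_1 up to exp (\<epsilon> n). Hence N_1 / (p(z)^2 |q'(z)|) is at most of the order of the square
  root of N_1 / |p(z)|^3, and |p(z)| >= |p(a_2)|. A finite set has infinite logarithmic energy, so
  the energies are taken with ln (s^2 + \<eta>^2) for a fixed \<eta>. The diagonal then costs a
  multiple of n |ln (\<eta>^2)|, of lower order than n^2, and lifting the upper bounds to height
  \<eta> above the interval costs a multiple of n^2 that tends to 0 with \<eta>. Equal length makes
  the reflection exchange the two intervals: the mirror images of the zeros of one factor are points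
  where the upper bound of the other measure holds. Every fact about one measure allows the other
  interval on either side, and the second rule is the first one for the interchanged pair.\<close>

lemma emeasure_compl_measure_support:
  assumes sets: "sets \<mu> = sets borel"
  shows "emeasure \<mu> (- measure_support \<mu>) = 0" "- measure_support \<mu> \<in> sets \<mu>"
proof -
  define F where "F = {U. open U \<and> emeasure \<mu> U = 0}"
  have U: "- measure_support \<mu> = \<Union>F"
    unfolding F_def measure_support_def by (auto simp: not_gr_zero)
  obtain F' where F': "F' \<subseteq> F" "countable F'" "\<Union>F' = \<Union>F"
    using Lindelof[of F] unfolding F_def by blast
  have "(\<Union>U\<in>F'. U) \<in> null_sets \<mu>"
    by (rule null_sets_UN') (use F' sets in \<open>auto simp: F_def null_sets_def\<close>)
  then show "emeasure \<mu> (- measure_support \<mu>) = 0" using U F' by (simp add: null_sets_def)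
  have "open (\<Union>F)" unfolding F_def by auto
  then show "- measure_support \<mu> \<in> sets \<mu>" unfolding U sets by auto
qed

text \<open>The only consequence of \<open>\<mu>' > 0\<close> that matters: Lebesgue measure on \<open>{a..b}\<close> is absolutely
  continuous with respect to \<open>\<mu>\<close>, in uniform form.\<close>

locale reg_measure = finite_measure \<mu> for \<mu> :: "real measure" +
  fixes a b :: real
  assumes ab: "a < b"
    and sets_mu [measurable_cong, simp]: "sets \<mu> = sets borel"
    and AE_ab: "AE x in \<mu>. x \<in> {a..b}"
    and dominates: "s > 0 \<Longrightarrow> \<exists>\<kappa>>0. \<forall>A\<in>sets borel. A \<subseteq> {a..b} \<longrightarrow> s \<le> measure lborel A \<longrightarrow> \<kappa> \<le> measure \<mu> A"

text \<open>The singular part only adds mass, so it suffices to bound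
  \<open>density lborel w\<close> from below. The sets \<open>S k\<close> where \<open>w\<close> is
  below 1/(k+1) decrease to a null set, so some \<open>S k\<close> has length less than s/2. A set
  of length at least s keeps s/2 outside it, and there \<open>w\<close> is at least \<delta> =
  1/(k+1).\<close>

lemma reg_measureI:
  assumes sets: "sets \<mu> = sets borel" and fin: "finite_measure \<mu>" and ab: "a < b"
    and supp: "measure_support \<mu> \<subseteq> {a..b}" and ac: "is_ac_density \<mu> w"
    and pos: "AE x in lborel. x \<in> {a..b} \<longrightarrow> 0 < w x"
  shows "reg_measure \<mu> a b"
proof -
  interpret finite_measure \<mu> by fact
  have AE: "AE x in \<mu>. x \<in> {a..b}"
  proof (rule AE_I[of _ _ "- measure_support \<mu>"])
    show "{x \<in> space \<mu>. x \<notin> {a..b}} \<subseteq> - measure_support \<mu>" using supp by auto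
  qed (use emeasure_compl_measure_support[OF sets] in auto)
  obtain \<sigma> where w[measurable]: "w \<in> borel_measurable borel"
    and dec: "\<And>A. A \<in> sets borel \<Longrightarrow> emeasure \<mu> A = emeasure (density lborel w) A + emeasure \<sigma> A"
    using ac unfolding is_ac_density_def by auto
  have dom: "\<exists>\<kappa>>0. \<forall>A\<in>sets borel. A \<subseteq> {a..b} \<longrightarrow> s \<le> measure lborel A \<longrightarrow> \<kappa> \<le> measure \<mu> A"
    if s: "s > 0" for s :: real
  proof -
    define S where "S k = {x\<in>{a..b}. w x < ennreal (1 / (real k + 1))}" for k :: nat
    have Sm[measurable]: "S k \<in> sets borel" for k unfolding S_def by measurable
    have Sfin: "emeasure lborel (S k) < \<infinity>" for k
    proof -
      have "emeasure lborel (S k) \<le> emeasure lborel {a..b}"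
        by (rule emeasure_mono) (auto simp: S_def)
      then show ?thesis using ab by (simp add: order_le_less_trans)
    qed
    have dS: "decseq S"
      unfolding decseq_def
    proof (intro allI impI subsetI)
      fix m n :: nat and x assume mn: "m \<le> n" and x: "x \<in> S n"
      have "ennreal (1 / (real n + 1)) \<le> ennreal (1 / (real m + 1))"
        using mn by (intro ennreal_leI frac_le) auto
      from order.strict_trans2[OF _ this, of "w x"] x show "x \<in> S m" unfolding S_def by blast
    qed
    have "(\<lambda>k. measure lborel (S k)) \<longlonglongrightarrow> measure lborel (\<Inter>k. S k)"
      by (rule Lim_measure_decseq) (use dS Sfin in \<open>auto simp: less_top\<close>)
    moreover have "measure lborel (\<Inter>k. S k) = 0"
    proof -
      have "AE x in lborel. x \<notin> (\<Inter>k. S k)"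
        using pos
      proof eventually_elim
        case (elim x)
        show ?case
        proof
          assume x: "x \<in> (\<Inter>k. S k)"
          then have "x \<in> {a..b}" and lt: "\<And>k. w x < ennreal (1 / (real k + 1))"
            by (auto simp: S_def)
          then have "0 < w x" using elim by simp
          moreover have "w x < top" using lt[of 0] by (rule order_less_trans) simp
          ultimately obtain r where r: "w x = ennreal r" "r > 0"
            by (cases "w x") (auto simp: ennreal_less_zero_iff)
          obtain k :: nat where "1 / r < real k" using reals_Archimedean2 by blast
          then have "1 / (real k + 1) < r" using r(2) by (simp add: field_simps) 
          moreover have "r < 1 / (real k + 1)" using lt[of k] r by (simp add: ennreal_less_iff)
          ultimately show False by simp
        qed
      qed
      then have "emeasure lborel (\<Inter>k. S k) = 0"
        by (subst (asm) AE_iff_null_sets[symmetric]) auto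
      then show ?thesis by (simp add: measure_def)
    qed
    ultimately have "(\<lambda>k. measure lborel (S k)) \<longlonglongrightarrow> 0" by simp
    then have "eventually (\<lambda>k. measure lborel (S k) < s / 2) sequentially"
      using s by (intro order_tendstoD) auto
    then obtain k where k: "measure lborel (S k) < s / 2"
      by (auto simp: eventually_sequentially)
    define \<delta> where "\<delta> = 1 / (real k + 1)"
    have \<delta>: "\<delta> > 0" unfolding \<delta>_def by simp
    have "\<delta> * (s / 2) \<le> measure \<mu> A"
      if A[measurable]: "A \<in> sets borel" and sub: "A \<subseteq> {a..b}" and sA: "s \<le> measure lborel A" for A
    proof -
      have Afin: "emeasure lborel A < \<infinity>"
      proof -
        have "emeasure lborel A \<le> emeasure lborel {a..b}" using sub by (intro emeasure_mono) auto
        then show ?thesis using ab by (simp add: order_le_less_trans)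
      qed
      have un: "(A - S k) \<union> S k \<in> fmeasurable lborel"
        by (intro fmeasurable.Un fmeasurable.Diff fmeasurableI) (use Afin Sfin in auto)
      have "measure lborel A \<le> measure lborel (A - S k) + measure lborel (S k)"
      proof -
        have "measure lborel A \<le> measure lborel ((A - S k) \<union> S k)"
          by (rule measure_mono_fmeasurable) (use un in auto)
        also have "\<dots> \<le> measure lborel (A - S k) + measure lborel (S k)"
          by (rule measure_Un_le) auto
        finally show ?thesis .
      qed
      then have d: "s / 2 \<le> measure lborel (A - S k)" using k sA by simp
      have "emeasure lborel (A - S k) \<le> emeasure lborel A" by (rule emeasure_mono) auto
      then have fin': "emeasure lborel (A - S k) < \<infinity>" using Afin by (simp add: order_le_less_trans)
      have "ennreal (\<delta> * (s / 2)) \<le> ennreal \<delta> * ennreal (measure lborel (A - S k))"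
        using d \<delta> s by (simp add: ennreal_mult[symmetric] ennreal_leI mult_left_mono)
      also have "\<dots> = ennreal \<delta> * emeasure lborel (A - S k)"
        using fin' by (simp add: emeasure_eq_ennreal_measure)
      also have "\<dots> = (\<integral>\<^sup>+x. ennreal \<delta> * indicator (A - S k) x \<partial>lborel)"
        by (subst nn_integral_cmult_indicator) auto
      also have "\<dots> \<le> (\<integral>\<^sup>+x. w x * indicator A x \<partial>lborel)"
        by (rule nn_integral_mono)
           (use sub in \<open>auto simp: S_def \<delta>_def indicator_def not_less\<close>)
      also have "\<dots> = emeasure (density lborel w) A" by (subst emeasure_density) auto
      also have "\<dots> \<le> emeasure \<mu> A" using dec[OF A] by simp
      also have "\<dots> = ennreal (measure \<mu> A)" by (simp add: emeasure_eq_measure)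
      finally show ?thesis by (simp add: measure_nonneg)
    qed
    then show ?thesis using \<delta> s by (intro exI[of _ "\<delta> * (s/2)"]) auto
  qed
  show ?thesis
    by unfold_locales (use sets ab AE dom in auto)
qed

context reg_measure
begin

abbreviation mass where "mass \<equiv> measure \<mu> (space \<mu>)"

lemma space_mu [simp]: "space \<mu> = UNIV"
  using sets_eq_imp_space_eq[OF sets_mu] by simp

lemma mass_pos: "mass > 0"
proof -
  obtain \<kappa> where "\<kappa> > 0" and k: "\<And>A. A\<in>sets borel \<Longrightarrow> A \<subseteq> {a..b} \<Longrightarrow> b - a \<le> measure lborel A \<Longrightarrow> \<kappa> \<le> measure \<mu> A"
    using dominates[of "b - a"] ab by auto
  have "\<kappa> \<le> measure \<mu> {a..b}" by (rule k) (use ab in auto)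
  also have "\<dots> \<le> mass" by (rule finite_measure_mono) auto
  finally show ?thesis using \<open>\<kappa> > 0\<close> by simp
qed

lemma integrable_continuous:
  assumes "continuous_on {a..b} f" "f \<in> borel_measurable borel"
  shows "integrable \<mu> (f :: real \<Rightarrow> real)"
proof -
  have "compact (f ` {a..b})" using assms by (intro compact_continuous_image) auto
  then obtain B where B: "\<And>x. x \<in> {a..b} \<Longrightarrow> norm (f x) \<le> B"
    by (meson bounded_iff compact_imp_bounded imageI)
  show ?thesis
    by (rule integrable_const_bound[of _ B])
       (use B AE_ab assms(2) in \<open>auto simp: measurable_cong_sets[OF sets_mu refl]\<close>)
qed

lemma integrable_cont:
  assumes "continuous_on UNIV f" shows "integrable \<mu> (f :: real \<Rightarrow> real)"
  by (rule integrable_continuous)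
     (use assms in \<open>auto intro: continuous_on_subset borel_measurable_continuous_onI\<close>)

lemma integrable_poly [simp]: "integrable \<mu> (poly p)"
  by (intro integrable_cont continuous_intros)

lemma integral_mono_ab:
  assumes "integrable \<mu> f" "integrable \<mu> g" "\<And>x. x \<in> {a..b} \<Longrightarrow> f x \<le> (g x :: real)"
  shows "integral\<^sup>L \<mu> f \<le> integral\<^sup>L \<mu> g"
  using assms AE_ab by (intro integral_mono_AE) auto

lemma integral_nonneg_ab:
  assumes "\<And>x. x \<in> {a..b} \<Longrightarrow> 0 \<le> (f x :: real)"
  shows "0 \<le> integral\<^sup>L \<mu> f"
  using assms AE_ab by (intro integral_nonneg_AE) auto

text \<open>A nonzero polynomial has finitely many roots, so the part of \<open>{a..b}\<close> where
  it does not vanish has full length and therefore positive \<mu>-mass.\<close>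

lemma integral_poly_eq_0D:
  assumes "\<And>x. x \<in> {a..b} \<Longrightarrow> 0 \<le> poly p x" and "(\<integral>x. poly p x \<partial>\<mu>) = 0"
  shows "p = 0"
proof (rule ccontr)
  assume p: "p \<noteq> 0"
  have "AE x in \<mu>. 0 \<le> poly p x" using AE_ab by eventually_elim (use assms in auto)
  then have "AE x in \<mu>. poly p x = 0"
    using integral_nonneg_eq_0_iff_AE[of \<mu> "poly p"] assms by auto
  with AE_ab have "AE x in \<mu>. x \<notin> {a..b} - {x. poly p x = 0}" by auto
  moreover have fin: "finite {x. poly p x = 0}" using p poly_roots_finite by blast
  ultimately have 0: "measure \<mu> ({a..b} - {x. poly p x = 0}) = 0"
    by (subst (asm) AE_iff_null_sets[symmetric])
       (use finite_imp_closed[OF fin] in \<open>auto simp: null_sets_def measure_def\<close>)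
  have "measure lborel ({a..b} - {x. poly p x = 0}) = measure lborel {a..b}"
    by (rule measure_Diff_null_set) (use fin in \<open>auto intro: finite_imp_null_set_lborel\<close>)
  then have m: "measure lborel ({a..b} - {x. poly p x = 0}) = b - a" using ab by simp
  obtain \<kappa> where "\<kappa> > 0" and k: "\<And>A. A\<in>sets borel \<Longrightarrow> A \<subseteq> {a..b} \<Longrightarrow> b - a \<le> measure lborel A \<Longrightarrow> \<kappa> \<le> measure \<mu> A"
    using dominates[of "b - a"] ab by auto
  have "\<kappa> \<le> measure \<mu> ({a..b} - {x. poly p x = 0})"
    by (rule k) (use m finite_imp_closed[OF fin] in auto)
  then show False using 0 \<open>\<kappa> > 0\<close> by simp
qed

end

section \<open>Orthogonal polynomials and interpolation\<close>

definition root_poly :: "real set \<Rightarrow> real poly" where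
  "root_poly X = (\<Prod>z\<in>X. [:- z, 1:])"

abbreviation nodal :: "real set \<Rightarrow> real \<Rightarrow> real" where
  "nodal X \<equiv> poly (root_poly X)"

lemma poly_root_poly: "nodal X x = (\<Prod>z\<in>X. x - z)"
  unfolding root_poly_def by (simp add: poly_prod)

lemma root_poly_nonzero [simp]: "root_poly X \<noteq> 0"
  unfolding root_poly_def by (cases "finite X") auto

lemma degree_root_poly [simp]: "degree (root_poly X) = card X"
  unfolding root_poly_def by (cases "finite X") (auto simp: degree_prod_eq_sum_degree)

lemma lead_coeff_root_poly: "lead_coeff (root_poly X) = 1"
  unfolding root_poly_def by (simp add: lead_coeff_prod)

lemma root_poly_insert: "finite X \<Longrightarrow> z \<notin> X \<Longrightarrow> root_poly (insert z X) = [:- z, 1:] * root_poly X"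
  unfolding root_poly_def by simp

lemma root_poly_remove: "finite X \<Longrightarrow> z \<in> X \<Longrightarrow> root_poly X = [:- z, 1:] * root_poly (X - {z})"
  unfolding root_poly_def by (simp add: prod.remove)

lemma poly_root_poly_eq_0: "finite X \<Longrightarrow> nodal X x = 0 \<longleftrightarrow> x \<in> X"
  by (auto simp: poly_root_poly)

lemma root_poly_dvd:
  assumes "finite X" "\<And>x. x \<in> X \<Longrightarrow> poly p x = 0"
  shows "root_poly X dvd p"
  using assms
proof (induction X arbitrary: p rule: finite_induct)
  case empty
  then show ?case by (simp add: root_poly_def)
next
  case (insert z X)
  from insert.prems[of z] obtain q where q: "p = [:- z, 1:] * q"
    by (auto simp: poly_eq_0_iff_dvd)
  have "root_poly X dvd q"
  proof (rule insert.IH)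
    fix x assume x: "x \<in> X"
    then have "poly p x = 0" "x \<noteq> z" using insert by auto
    then show "poly q x = 0" by (simp add: q)
  qed
  then show ?case unfolding q root_poly_insert[OF insert(1,2)] by (rule mult_dvd_mono[OF dvd_refl])
qed

lemma poly_sign_const:
  assumes "\<And>x. a < x \<Longrightarrow> x < b \<Longrightarrow> poly Q x \<noteq> 0"
  shows "(\<forall>x\<in>{a..b}. 0 \<le> poly Q x) \<or> (\<forall>x\<in>{a..b}. poly Q x \<le> (0::real))"
proof (rule ccontr)
  assume "\<not> ?thesis"
  then obtain x y where x: "x \<in> {a..b}" "poly Q x < 0" and y: "y \<in> {a..b}" "poly Q y > 0"
    by (auto simp: not_le)
  have "x < y \<Longrightarrow> False" using poly_IVT_pos[of x y Q] x y assms by force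
  moreover have "y < x \<Longrightarrow> False" using poly_IVT_neg[of y x Q] x y assms by force
  ultimately show False using x y by (cases x y rule: linorder_cases) auto
qed

text \<open>\<open>Z\<close> is the set of zeros of odd order, obtained without counting
  multiplicities: each linear factor split off toggles the membership of its root in
  \<open>Z\<close>, so that \<open>Q * root_poly Z\<close> changes only by a factor (x - z)^2 or not
  at all.\<close>

lemma sign_change_set:
  assumes "Q \<noteq> 0"
  shows "\<exists>Z. finite Z \<and> Z \<subseteq> {x. a < x \<and> x < b \<and> poly Q x = 0} \<and>
      ((\<forall>x\<in>{a..b}. 0 \<le> poly (Q * root_poly Z) x) \<or> (\<forall>x\<in>{a..b}. poly (Q * root_poly Z) x \<le> (0::real)))"
  using assms
proof (induction "degree Q" arbitrary: Q)
  case 0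
  then obtain c where "Q = [:c:]" by (metis degree_eq_zeroE)
  then show ?case by (intro exI[of _ "{}"]) (auto simp: root_poly_def)
next
  case (Suc d)
  show ?case
  proof (cases "\<exists>z. a < z \<and> z < b \<and> poly Q z = 0")
    case False
    then show ?thesis using poly_sign_const[of a b Q]
      by (intro exI[of _ "{}"]) (auto simp: root_poly_def)
  next
    case True
    then obtain z where z: "a < z" "z < b" "poly Q z = 0" by auto
    then obtain q where q: "Q = [:- z, 1:] * q" by (auto simp: poly_eq_0_iff_dvd)
    have q0: "q \<noteq> 0" using Suc.prems q by auto
    then have "degree Q = Suc (degree q)" unfolding q by (subst degree_mult_eq) auto
    then have "d = degree q" using Suc by simp
    from Suc.hyps(1)[OF this q0] obtain Z where Z: "finite Z"
      "Z \<subseteq> {x. a < x \<and> x < b \<and> poly q x = 0}"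
      "(\<forall>x\<in>{a..b}. 0 \<le> poly (q * root_poly Z) x) \<or> (\<forall>x\<in>{a..b}. poly (q * root_poly Z) x \<le> 0)"
      by blast
    show ?thesis
    proof (cases "z \<in> Z")
      case True
      have "Q * root_poly (Z - {z}) = q * root_poly Z"
        unfolding q root_poly_remove[OF Z(1) True] by (simp only: mult_ac)
      then show ?thesis using Z by (intro exI[of _ "Z - {z}"]) (auto simp: q)
    next
      case False
      have "poly (Q * root_poly (insert z Z)) x = (x - z)\<^sup>2 * poly (q * root_poly Z) x" for x
        unfolding q root_poly_insert[OF Z(1) False] by (simp add: algebra_simps power2_eq_square)
      then show ?thesis using Z z
        by (intro exI[of _ "insert z Z"])
           (auto simp: q mult_nonneg_nonpos simp del: poly_mult)
    qed
  qed
qed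

lemma homogeneous_system_nontrivial:
  fixes M :: "nat \<Rightarrow> 'a \<Rightarrow> real"
  assumes "finite J" "card J > N"
  shows "\<exists>c. (\<exists>j\<in>J. c j \<noteq> 0) \<and> (\<forall>i<N. (\<Sum>j\<in>J. M i j * c j) = 0)"
  using assms
proof (induction N arbitrary: J M)
  case 0
  then obtain j where "j \<in> J" by fastforce
  then show ?case by (intro exI[of _ "\<lambda>_. 1"]) auto
next
  case (Suc N)
  show ?case
  proof (cases "\<forall>j\<in>J. M N j = 0")
    case True
    with Suc.IH[of J M] Suc.prems show ?thesis by (auto simp: less_Suc_eq)
  next
    case False
    then obtain p where p: "p \<in> J" "M N p \<noteq> 0" by auto
    \<comment> \<open>Gaussian elimination: \<open>M'\<close> is what remains after solving equation
      \<open>N\<close> for the unknown with index \<open>p\<close>; its value is restored in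
      \<open>d\<close>.\<close>
    define M' where "M' i j = M i j - M i p * M N j / M N p" for i j
    have "card (J - {p}) > N" using Suc.prems p by simp
    with Suc.IH[of "J - {p}" M'] Suc.prems(1)
    obtain c where c: "\<exists>j\<in>J - {p}. c j \<noteq> 0" and
      c0: "\<And>i. i < N \<Longrightarrow> (\<Sum>j\<in>J - {p}. M' i j * c j) = 0" by auto
    define s where "s = (\<Sum>j\<in>J - {p}. M N j * c j)"
    define d where "d = c(p := - s / M N p)"
    have sum_d: "(\<Sum>j\<in>J. M i j * d j) = M i p * (- s / M N p) + (\<Sum>j\<in>J - {p}. M i j * c j)" for i
      using Suc.prems(1) p(1) by (subst sum.remove[of _ p]) (auto simp: d_def)
    have "(\<Sum>j\<in>J - {p}. M' i j * c j) = (\<Sum>j\<in>J - {p}. M i j * c j) - M i p / M N p * s" for i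
      unfolding M'_def s_def by (simp add: algebra_simps sum_subtractf sum_distrib_left)
    then have "(\<Sum>j\<in>J. M i j * d j) = 0" if "i < N" for i
      using c0[OF that] sum_d[of i] by simp
    moreover have "(\<Sum>j\<in>J. M N j * d j) = 0" using sum_d[of N] p by (simp add: s_def)
    moreover have "\<exists>j\<in>J. d j \<noteq> 0" using c by (auto simp: d_def)
    ultimately show ?thesis by (intro exI[of _ d]) (auto simp: less_Suc_eq)
  qed
qed

definition orthogonal_upto :: "real measure \<Rightarrow> real poly \<Rightarrow> nat \<Rightarrow> bool" where
  "orthogonal_upto \<mu> Q n \<longleftrightarrow> (\<forall>k<n. (\<integral>x. poly Q x * x ^ k \<partial>\<mu>) = 0)"

context reg_measure
begin

lemma orthogonal_uptoD:
  assumes "orthogonal_upto \<mu> Q n" "degree h < n"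
  shows "(\<integral>x. poly (Q * h) x \<partial>\<mu>) = 0"
proof -
  have "(\<integral>x. poly (Q * h) x \<partial>\<mu>) = (\<integral>x. (\<Sum>k\<le>degree h. coeff h k * (poly Q x * x ^ k)) \<partial>\<mu>)"
    by (simp add: poly_altdef[of h] sum_distrib_left mult_ac)
  also have "\<dots> = (\<Sum>k\<le>degree h. coeff h k * (\<integral>x. poly Q x * x ^ k \<partial>\<mu>))"
    by (subst Bochner_Integration.integral_sum)
       (auto intro!: integrable_cont continuous_intros)
  also have "\<dots> = 0"
    using assms by (intro sum.neutral) (auto simp: orthogonal_upto_def)
  finally show ?thesis .
qed

lemma orthogonal_upto_diff:
  assumes "orthogonal_upto \<mu> P n" "orthogonal_upto \<mu> Q n"
  shows "orthogonal_upto \<mu> (P - Q) n"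
  unfolding orthogonal_upto_def
proof (intro allI impI)
  fix k assume "k < n"
  have "(\<integral>x. poly (P - Q) x * x ^ k \<partial>\<mu>) = (\<integral>x. poly P x * x ^ k - poly Q x * x ^ k \<partial>\<mu>)"
    by (simp add: algebra_simps)
  also have "\<dots> = (\<integral>x. poly P x * x ^ k \<partial>\<mu>) - (\<integral>x. poly Q x * x ^ k \<partial>\<mu>)"
    by (intro Bochner_Integration.integral_diff integrable_cont continuous_intros)
  finally show "(\<integral>x. poly (P - Q) x * x ^ k \<partial>\<mu>) = 0"
    using assms \<open>k < n\<close> by (simp add: orthogonal_upto_def)
qed

text \<open>With fewer than \<open>n\<close> sign changes, \<open>root_poly Z\<close> would be an
  admissible test polynomial, although its product with \<open>Q\<close> has constant sign.\<close>

lemma orthogonal_upto_roots: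
  assumes "orthogonal_upto \<mu> Q n" "Q \<noteq> 0"
  shows "\<exists>Z. Z \<subseteq> {x. a < x \<and> x < b \<and> poly Q x = 0} \<and> card Z = n \<and> finite Z"
proof -
  obtain Z where Z: "finite Z" "Z \<subseteq> {x. a < x \<and> x < b \<and> poly Q x = 0}" and
    sgn: "(\<forall>x\<in>{a..b}. 0 \<le> poly (Q * root_poly Z) x) \<or> (\<forall>x\<in>{a..b}. poly (Q * root_poly Z) x \<le> 0)"
    using sign_change_set[OF assms(2), of a b] by blast
  have "n \<le> card Z"
  proof (rule ccontr)
    assume "\<not> n \<le> card Z"
    then have 0: "(\<integral>x. poly (Q * root_poly Z) x \<partial>\<mu>) = 0"
      using assms(1) by (intro orthogonal_uptoD) auto
    from sgn show False
    proof
      assume "\<forall>x\<in>{a..b}. 0 \<le> poly (Q * root_poly Z) x"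
      then have "Q * root_poly Z = 0" using 0 by (intro integral_poly_eq_0D) auto
      then show False using assms by simp
    next
      assume "\<forall>x\<in>{a..b}. poly (Q * root_poly Z) x \<le> 0"
      then have "- (Q * root_poly Z) = 0" using 0 by (intro integral_poly_eq_0D) (auto simp del: poly_mult)
      then show False using assms by simp
    qed
  qed
  then obtain Z' where "Z' \<subseteq> Z" "card Z' = n" "finite Z'" using Z
    by (metis obtain_subset_with_card_n)
  then show ?thesis using Z by blast
qed

end

lemma poly_lowdegree_unique:
  fixes p :: "real poly"
  assumes "finite Z" "Z \<subseteq> {x. poly p x = 0}" "degree p < card Z"
  shows "p = 0"
proof (rule ccontr)
  assume p: "p \<noteq> 0"
  have "card Z \<le> card {x. poly p x = 0}" using assms p by (intro card_mono poly_roots_finite) auto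
  also have "\<dots> \<le> degree p" using p by (rule card_poly_roots_bound)
  finally show False using assms by simp
qed

text \<open>Everything follows from counting zeros: a nonzero \<open>Q\<close> orthogonal to both
  measures has n zeros in each interval, hence degree at least 2n. A nonzero solution of the 2n
  homogeneous equations in 2n+1 coefficients is thus a multiple of \<open>P\<close>, and two monic
  solutions have a difference of too small degree.\<close>

lemma diag_mop_properties:
  assumes r1: "reg_measure \<mu>1 a1 b1" and r2: "reg_measure \<mu>2 a2 b2" and "b1 \<le> a2"
  shows "\<exists>X Y. finite X \<and> finite Y \<and> card X = n \<and> card Y = n \<and> X \<subseteq> {a1<..<b1} \<and> Y \<subseteq> {a2<..<b2} \<and>
     diag_mop \<mu>1 \<mu>2 n = root_poly X * root_poly Y \<and>
     orthogonal_upto \<mu>1 (root_poly X * root_poly Y) n \<and> orthogonal_upto \<mu>2 (root_poly X * root_poly Y) n"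
proof -
  interpret m1: reg_measure \<mu>1 a1 b1 by fact
  interpret m2: reg_measure \<mu>2 a2 b2 by fact
  let ?good = "\<lambda>Q. orthogonal_upto \<mu>1 Q n \<and> orthogonal_upto \<mu>2 Q n"
  have zeros: "\<exists>X Y. finite X \<and> finite Y \<and> card X = n \<and> card Y = n \<and> X \<subseteq> {a1<..<b1} \<and> Y \<subseteq> {a2<..<b2}
      \<and> X \<inter> Y = {} \<and> X \<union> Y \<subseteq> {x. poly Q x = 0}" if "?good Q" "Q \<noteq> 0" for Q
  proof -
    from m1.orthogonal_upto_roots[of Q n] that obtain X where
      X: "X \<subseteq> {x. a1 < x \<and> x < b1 \<and> poly Q x = 0}" "card X = n" "finite X" by auto
    from m2.orthogonal_upto_roots[of Q n] that obtain Y where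
      Y: "Y \<subseteq> {x. a2 < x \<and> x < b2 \<and> poly Q x = 0}" "card Y = n" "finite Y" by auto
    have "X \<inter> Y = {}"
    proof (rule equals0I)
      fix x assume "x \<in> X \<inter> Y"
      then have "x < b1" "a2 < x" using X Y by auto
      then show False using \<open>b1 \<le> a2\<close> by linarith
    qed
    then show ?thesis using X Y by (intro exI[of _ X] exI[of _ Y]) auto
  qed
  have low: "Q = 0" if Q: "?good Q" "degree Q < 2 * n" for Q
  proof (rule ccontr)
    assume "Q \<noteq> 0"
    from zeros[OF Q(1) this] obtain X Y where XY: "finite X" "finite Y" "card X = n" "card Y = n"
      "X \<inter> Y = {}" "X \<union> Y \<subseteq> {x. poly Q x = 0}" by auto
    then have "card (X \<union> Y) = 2 * n" by (simp add: card_Un_disjoint)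
    then have "Q = 0" using XY Q by (intro poly_lowdegree_unique[of "X \<union> Y"]) auto
    then show False using \<open>Q \<noteq> 0\<close> by simp
  qed
  \<comment> \<open>Rows below \<open>n\<close> are the conditions for \<open>\<mu>1\<close>; rows n
    to 2n-1 are those for \<open>\<mu>2\<close>.\<close>
  define M where "M i j = (if i < n then \<integral>x. x ^ j * x ^ i \<partial>\<mu>1 else \<integral>x. x ^ j * x ^ (i - n) \<partial>\<mu>2)" for i j
  obtain c where c: "\<exists>j\<in>{..2 * n}. c j \<noteq> 0" and c0: "\<And>i. i < 2 * n \<Longrightarrow> (\<Sum>j\<le>2 * n. M i j * c j) = 0"
    using homogeneous_system_nontrivial[of "{..2 * n}" "2 * n" M] by auto
  define R where "R = (\<Sum>j\<le>2 * n. monom (c j) j)"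
  have coeffR: "coeff R j = (if j \<le> 2 * n then c j else 0)" for j
    unfolding R_def by (simp add: coeff_sum)
  have R0: "R \<noteq> 0" using c coeffR by (metis atMost_iff coeff_0)
  have degR: "degree R \<le> 2 * n" by (rule degree_le) (simp add: coeffR)
  have polyR: "poly R x = (\<Sum>j\<le>2 * n. c j * x ^ j)" for x
    unfolding R_def by (simp add: poly_sum poly_monom)
  have int1: "(\<integral>x. poly R x * x ^ k \<partial>\<mu>1) = (\<Sum>j\<le>2 * n. (\<integral>x. x ^ j * x ^ k \<partial>\<mu>1) * c j)" for k
    unfolding polyR sum_distrib_right
    by (subst Bochner_Integration.integral_sum)
       (auto intro!: m1.integrable_cont continuous_intros sum.cong simp: mult_ac)
  have int2: "(\<integral>x. poly R x * x ^ k \<partial>\<mu>2) = (\<Sum>j\<le>2 * n. (\<integral>x. x ^ j * x ^ k \<partial>\<mu>2) * c j)" for k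
    unfolding polyR sum_distrib_right
    by (subst Bochner_Integration.integral_sum)
       (auto intro!: m2.integrable_cont continuous_intros sum.cong simp: mult_ac)
  have goodR: "?good R"
    unfolding orthogonal_upto_def
  proof (intro conjI allI impI)
    fix k assume "k < n"
    then show "(\<integral>x. poly R x * x ^ k \<partial>\<mu>1) = 0" using c0[of k] by (simp add: int1 M_def)
  next
    fix k assume "k < n"
    then show "(\<integral>x. poly R x * x ^ k \<partial>\<mu>2) = 0" using c0[of "n + k"] by (simp add: int2 M_def)
  qed
  from zeros[OF goodR R0] obtain X Y where XY: "finite X" "finite Y" "card X = n" "card Y = n"
    "X \<subseteq> {a1<..<b1}" "Y \<subseteq> {a2<..<b2}" "X \<inter> Y = {}" "X \<union> Y \<subseteq> {x. poly R x = 0}" by blast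
  define P where "P = root_poly X * root_poly Y"
  have PU: "P = root_poly (X \<union> Y)"
    unfolding P_def root_poly_def using XY by (simp add: prod.union_disjoint)
  have dP: "degree P = 2 * n" unfolding PU using XY by (simp add: card_Un_disjoint)
  have lP: "lead_coeff P = 1" unfolding PU by (rule lead_coeff_root_poly)
  have "P dvd R" unfolding PU using XY by (intro root_poly_dvd) auto
  then obtain q where q: "R = P * q" by auto
  have "q \<noteq> 0" "P \<noteq> 0" using R0 q by auto
  then have "degree R = degree P + degree q" unfolding q by (simp add: degree_mult_eq)
  then have "degree q = 0" using degR dP by simp
  then obtain e where "q = [:e:]" by (metis degree_eq_zeroE)
  then have e: "R = smult e P" "e \<noteq> 0" using q \<open>q \<noteq> 0\<close> by auto
  have goodP: "?good P" using goodR e by (auto simp: orthogonal_upto_def mult.assoc)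
  have "diag_mop \<mu>1 \<mu>2 n = P"
    unfolding diag_mop_def
  proof (rule the_equality)
    show "lead_coeff P = 1 \<and> degree P = 2 * n \<and>
      (\<forall>k<n. (\<integral>x. poly P x * x ^ k \<partial>\<mu>1) = 0 \<and> (\<integral>x. poly P x * x ^ k \<partial>\<mu>2) = 0)"
      using lP dP goodP by (auto simp: orthogonal_upto_def)
  next
    fix Q assume Q: "lead_coeff Q = 1 \<and> degree Q = 2 * n \<and>
      (\<forall>k<n. (\<integral>x. poly Q x * x ^ k \<partial>\<mu>1) = 0 \<and> (\<integral>x. poly Q x * x ^ k \<partial>\<mu>2) = 0)"
    show "Q = P"
    \<comment> \<open>\<open>low\<close> requires degree below 2n, which no polynomial has when n =
      0.\<close>
    proof (cases "n = 0")
      case True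
      with Q lP dP show ?thesis by (metis degree_eq_zeroE lead_coeff_pCons(2) mult_zero_right)
    next
      case False
      have g: "?good (Q - P)"
      proof -
        have "?good Q" using Q by (simp add: orthogonal_upto_def)
        then show ?thesis using goodP m1.orthogonal_upto_diff m2.orthogonal_upto_diff by blast
      qed
      have "degree (Q - P) < 2 * n"
      proof (cases "Q - P = 0")
        case True
        then show ?thesis using False by simp
      next
        case ne: False
        have "degree (Q - P) \<le> 2 * n" using Q dP by (intro degree_diff_le) auto
        moreover have "coeff (Q - P) (2 * n) = 0" using Q dP lP by (metis coeff_diff diff_self)
        ultimately show ?thesis using ne by (metis le_neq_implies_less leading_coeff_0_iff)
      qed
      then show ?thesis using low[OF g] by simp
    qed
  qed
  then show ?thesis using XY goodP by (intro exI[of _ X] exI[of _ Y]) (auto simp: P_def)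
qed

section \<open>Lagrange interpolation on a finite set of nodes\<close>

definition lagrange_poly :: "real set \<Rightarrow> real \<Rightarrow> real poly" where
  "lagrange_poly X z = smult (1 / nodal (X - {z}) z) (root_poly (X - {z}))"

lemma poly_lagrange_poly: "poly (lagrange_poly X z) x = (\<Prod>y\<in>X - {z}. (x - y) / (z - y))"
  unfolding lagrange_poly_def by (simp add: poly_root_poly prod_dividef)

lemma degree_lagrange_poly: "finite X \<Longrightarrow> z \<in> X \<Longrightarrow> degree (lagrange_poly X z) = card X - 1"
  unfolding lagrange_poly_def by (simp add: poly_root_poly_eq_0)

lemma poly_lagrange_poly_node:
  assumes "finite X" "x \<in> X"
  shows "poly (lagrange_poly X z) x = (if x = z then 1 else 0)"
  unfolding lagrange_poly_def using assms
  by (auto simp: poly_root_poly_eq_0)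

lemma lagrange_interpolation:
  assumes "finite X" "degree q < card X"
  shows "q = (\<Sum>z\<in>X. smult (poly q z) (lagrange_poly X z))"
proof (rule poly_eqI_degree[of X])
  fix x assume "x \<in> X"
  have "poly (\<Sum>z\<in>X. smult (poly q z) (lagrange_poly X z)) x = (\<Sum>z\<in>X. poly q z * (if x = z then 1 else 0))"
    using \<open>x \<in> X\<close> assms by (simp add: poly_sum poly_lagrange_poly_node)
  also have "\<dots> = poly q x"
    using \<open>x \<in> X\<close> assms by (simp add: if_distrib cong: if_cong)
  finally show "poly q x = poly (\<Sum>z\<in>X. smult (poly q z) (lagrange_poly X z)) x" by simp
next
  show "degree q < card X" by fact
  have "degree (\<Sum>z\<in>X. smult (poly q z) (lagrange_poly X z)) \<le> card X - 1"
    using assms by (intro degree_sum_le) (auto simp: degree_lagrange_poly intro: order.trans[OF degree_smult_le])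
  then show "degree (\<Sum>z\<in>X. smult (poly q z) (lagrange_poly X z)) < card X"
    using assms by linarith
qed

section \<open>Remez inequality and regularity\<close>

lemma Icc_fmeasurable [simp]: "{a..b :: real} \<in> fmeasurable lborel"
  by (cases "a \<le> b") (auto simp: fmeasurable_def)

section \<open>Chebyshev polynomials and comparison of Lagrange sums\<close>

fun chebyshev :: "nat \<Rightarrow> real poly" where
  "chebyshev 0 = 1"
| "chebyshev (Suc 0) = [:0, 1:]"
| "chebyshev (Suc (Suc n)) = [:0, 2:] * chebyshev (Suc n) - chebyshev n"

lemma degree_chebyshev: "degree (chebyshev n) \<le> n"
proof (induction n rule: chebyshev.induct)
  case (3 n)
  have "degree ([:0, 2:] * chebyshev (Suc n)) \<le> Suc (Suc n)"
    by (rule order.trans[OF degree_mult_le]) (use 3 in simp)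
  then show ?case using 3 unfolding chebyshev.simps by (intro degree_diff_le) auto
qed auto

lemma chebyshev_cos: "poly (chebyshev n) (cos t) = cos (real n * t)"
proof (induction n rule: chebyshev.induct)
  case (3 n)
  have "cos (real (Suc (Suc n)) * t) + cos (real n * t) = 2 * cos t * cos (real (Suc n) * t)"
    using cos_add[of "real (Suc n) * t" t] cos_diff[of "real (Suc n) * t" t]
    by (simp add: algebra_simps)
  then show ?case using 3 by simp
qed auto

lemma chebyshev_joukowski:
  "w \<noteq> 0 \<Longrightarrow> poly (chebyshev n) ((w + 1 / w) / 2) = (w ^ n + 1 / w ^ n) / 2"
proof (induction n rule: chebyshev.induct)
  case (3 n)
  have "poly (chebyshev (Suc (Suc n))) ((w + 1 / w) / 2) =
      (w + 1 / w) * ((w ^ Suc n + 1 / w ^ Suc n) / 2) - (w ^ n + 1 / w ^ n) / 2"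
    by (simp only: chebyshev.simps poly_diff poly_mult 3(1)[OF \<open>w \<noteq> 0\<close>] 3(2)[OF \<open>w \<noteq> 0\<close>]) simp
  also have "\<dots> = (w ^ Suc (Suc n) + 1 / w ^ Suc (Suc n)) / 2"
    using \<open>w \<noteq> 0\<close> by (simp add: field_simps)
  finally show ?case .
qed auto

lemma lagrange_indexed:
  fixes y :: "nat \<Rightarrow> real"
  assumes "inj_on y {..m}" "degree q \<le> m"
  shows "poly q x = (\<Sum>i\<le>m. poly q (y i) * (\<Prod>j\<in>{..m} - {i}. (x - y j) / (y i - y j)))"
proof -
  have c: "card (y ` {..m}) = Suc m" using assms by (simp add: card_image)
  have "poly q x = (\<Sum>z\<in>y ` {..m}. poly q z * poly (lagrange_poly (y ` {..m}) z) x)"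
    by (subst lagrange_interpolation[of "y ` {..m}" q])
       (use c assms in \<open>auto simp: poly_sum less_Suc_eq_le\<close>)
  also have "\<dots> = (\<Sum>i\<le>m. poly q (y i) * poly (lagrange_poly (y ` {..m}) (y i)) x)"
    using assms by (subst sum.reindex) auto
  also have "\<dots> = (\<Sum>i\<le>m. poly q (y i) * (\<Prod>j\<in>{..m} - {i}. (x - y j) / (y i - y j)))"
  proof (rule sum.cong[OF refl])
    fix i assume i: "i \<in> {..m}"
    have "y ` {..m} - {y i} = y ` ({..m} - {i})" using assms i by (auto simp: inj_on_def)
    moreover have "inj_on y ({..m} - {i})" using assms by (auto simp: inj_on_def)
    ultimately show "poly q (y i) * poly (lagrange_poly (y ` {..m}) (y i)) x =
        poly q (y i) * (\<Prod>j\<in>{..m} - {i}. (x - y j) / (y i - y j))"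
      by (simp add: poly_lagrange_poly prod.reindex)
  qed
  finally show ?thesis .
qed

lemma prod_sign:
  "i \<le> m \<Longrightarrow> (\<Prod>j\<in>{..m} - {i}. if j < i then - 1 else 1 :: real) = (- 1) ^ i" for i m :: nat
proof -
  assume "i \<le> m"
  then have "({..m} - {i}) \<inter> {j. j < i} = {..<i}" by auto
  then show ?thesis by (subst prod.If_cases) auto
qed

text \<open>Spreading the nodes out and moving them closer to the evaluation point decreases all
  Lagrange basis values; for alternating data these values add up without cancellation.\<close>

lemma lagrange_comparison:
  fixes t y :: "nat \<Rightarrow> real"
  assumes mono: "\<And>i j. i < j \<Longrightarrow> j \<le> m \<Longrightarrow> t i < t j" and T: "degree T \<le> m"
    and alt: "\<And>i. i \<le> m \<Longrightarrow> poly T (t i) = (- 1) ^ i"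
    and x0: "\<And>i. i \<le> m \<Longrightarrow> x0 < t i"
    and sep: "\<And>i j. i \<le> m \<Longrightarrow> j \<le> m \<Longrightarrow> \<bar>t i - t j\<bar> \<le> \<bar>y i - y j\<bar>"
    and near: "\<And>i. i \<le> m \<Longrightarrow> \<bar>\<xi> - y i\<bar> \<le> t i - x0"
    and q: "degree q \<le> m" "\<And>i. i \<le> m \<Longrightarrow> \<bar>poly q (y i)\<bar> \<le> 1"
  shows "\<bar>poly q \<xi>\<bar> \<le> poly T x0"
proof -
  have tne: "t i \<noteq> t j" if "i \<le> m" "j \<le> m" "i \<noteq> j" for i j
    using mono[of i j] mono[of j i] that by (cases i j rule: linorder_cases) auto
  have "inj_on t {..m}" using tne by (auto simp: inj_on_def)
  have "inj_on y {..m}"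
  proof (rule inj_onI, rule ccontr)
    fix i j assume "i \<in> {..m}" "j \<in> {..m}" "y i = y j" "i \<noteq> j"
    then show False using sep[of i j] tne[of i j] by auto
  qed
  define p where "p i = (\<Prod>j\<in>{..m} - {i}. (t j - x0) / \<bar>t i - t j\<bar>)" for i
  have "\<bar>poly q \<xi>\<bar> \<le> (\<Sum>i\<le>m. \<bar>poly q (y i) * (\<Prod>j\<in>{..m} - {i}. (\<xi> - y j) / (y i - y j))\<bar>)"
    by (subst lagrange_indexed[OF \<open>inj_on y {..m}\<close> q(1)]) (rule sum_abs)
  also have "\<dots> \<le> (\<Sum>i\<le>m. p i)"
  proof (rule sum_mono)
    fix i assume i: "i \<in> {..m}"
    have "\<bar>poly q (y i) * (\<Prod>j\<in>{..m} - {i}. (\<xi> - y j) / (y i - y j))\<bar>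
        = \<bar>poly q (y i)\<bar> * (\<Prod>j\<in>{..m} - {i}. \<bar>\<xi> - y j\<bar> / \<bar>y i - y j\<bar>)"
      by (simp add: abs_mult abs_prod abs_divide)
    also have "\<dots> \<le> 1 * p i"
      unfolding p_def
    proof (intro mult_mono prod_mono conjI)
      fix j assume j: "j \<in> {..m} - {i}"
      then show "\<bar>\<xi> - y j\<bar> / \<bar>y i - y j\<bar> \<le> (t j - x0) / \<bar>t i - t j\<bar>"
        using i near[of j] sep[of i j] tne[of i j] by (intro frac_le) auto
    qed (use i q(2)[of i] in \<open>auto intro!: prod_nonneg\<close>)
    finally show "\<bar>poly q (y i) * (\<Prod>j\<in>{..m} - {i}. (\<xi> - y j) / (y i - y j))\<bar> \<le> p i" by simp
  qed
  also have "\<dots> = poly T x0"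
  proof -
    have "(\<Prod>j\<in>{..m} - {i}. (x0 - t j) / (t i - t j)) = (- 1) ^ i * p i" if i: "i \<le> m" for i
    proof -
      have "(\<Prod>j\<in>{..m} - {i}. (x0 - t j) / (t i - t j)) =
          (\<Prod>j\<in>{..m} - {i}. (if j < i then - 1 else 1) * ((t j - x0) / \<bar>t i - t j\<bar>))"
      proof (rule prod.cong[OF refl])
        fix j assume j: "j \<in> {..m} - {i}"
        show "(x0 - t j) / (t i - t j) = (if j < i then - 1 else 1) * ((t j - x0) / \<bar>t i - t j\<bar>)"
        proof (cases "j < i")
          case True
          then have "t j < t i" using mono i by auto
          then show ?thesis using True by (simp add: field_simps)
        next
          case False
          then have "t i < t j" using mono j by auto
          then show ?thesis using False by (simp add: field_simps)
        qed
      qed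
      also have "\<dots> = (- 1) ^ i * p i" by (simp only: prod.distrib prod_sign[OF i] p_def)
      finally show ?thesis .
    qed
    then have "poly T x0 = (\<Sum>i\<le>m. (- 1) ^ i * ((- 1) ^ i * p i))"
      unfolding lagrange_indexed[OF \<open>inj_on t {..m}\<close> T, of x0]
      by (intro sum.cong refl) (simp add: alt)
    also have "\<dots> = (\<Sum>i\<le>m. p i)"
      by (intro sum.cong refl) (simp flip: mult.assoc power_mult_distrib)
    finally show ?thesis by simp
  qed
  finally show ?thesis .
qed

lemma measure_below_lipschitz:
  fixes E :: "real set"
  assumes cl: "closed E" and sub: "E \<subseteq> {\<xi>..\<beta>}" and "x \<le> x'"
  shows "measure lborel (E \<inter> {..x'}) - measure lborel (E \<inter> {..x}) \<le> x' - x"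
    and "measure lborel (E \<inter> {..x}) \<le> measure lborel (E \<inter> {..x'})"
proof -
  have fm: "E \<inter> A \<in> fmeasurable lborel" if "A \<in> sets borel" for A
  proof (rule fmeasurableI2[of "{\<xi>..\<beta>}"])
    show "E \<inter> A \<in> sets lborel" using that cl by auto
  qed (use sub in auto)
  show "measure lborel (E \<inter> {..x}) \<le> measure lborel (E \<inter> {..x'})"
    using assms(3) fm[of "{..x'}"] cl by (intro measure_mono_fmeasurable) auto
  have "measure lborel (E \<inter> {..x'}) \<le> measure lborel ((E \<inter> {..x}) \<union> {x..x'})"
    using assms(3) fm[of "{..x}"] cl
    by (intro measure_mono_fmeasurable fmeasurable.Un) auto
  also have "\<dots> \<le> measure lborel (E \<inter> {..x}) + measure lborel {x..x'}"
    by (rule measure_Un_le) (use cl in auto)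
  finally show "measure lborel (E \<inter> {..x'}) - measure lborel (E \<inter> {..x}) \<le> x' - x"
    using assms(3) by simp
qed

text \<open>\<open>F\<close> is 1-Lipschitz and so attains \<open>t\<close>. The least point where
  it does so lies in \<open>E\<close>, because \<open>F\<close> is constant on intervals that miss
  \<open>E\<close>.\<close>

lemma measure_quantile_point:
  fixes E :: "real set"
  defines "F \<equiv> \<lambda>x. measure lborel (E \<inter> {..x})"
  assumes cl: "closed E" and sub: "E \<subseteq> {\<xi>..\<beta>}" and t: "0 < t" "t \<le> measure lborel E"
  shows "\<exists>y\<in>E. F y = t"
proof -
  have lip: "F x' - F x \<le> x' - x" and mono: "F x \<le> F x'" if "x \<le> x'" for x x'
    unfolding F_def by (rule measure_below_lipschitz[OF cl sub that])+
  have "E \<noteq> {}" using t by auto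
  then have \<xi>\<beta>: "\<xi> \<le> \<beta>" using sub by auto
  have F\<beta>: "F \<beta> = measure lborel E" unfolding F_def
    by (rule arg_cong[where f="measure lborel"]) (use sub in auto)
  have F\<xi>: "F \<xi> = 0"
  proof -
    have "F \<xi> \<le> measure lborel {\<xi>}" unfolding F_def
      by (rule measure_mono_fmeasurable) (use sub cl in \<open>auto simp: fmeasurable_def simp del: Icc_fmeasurable\<close>)
    then show ?thesis by (simp add: F_def measure_le_0_iff)
  qed
  have "continuous_on UNIV F"
  proof (rule continuous_onI)
    fix x e :: real assume "e > 0"
    have "dist (F x') (F x) \<le> e" if "dist x' x < e" for x'
      using that lip[of x x'] lip[of x' x] mono[of x x'] mono[of x' x]
      by (cases "x \<le> x'") (auto simp: dist_real_def)
    then show "\<exists>d>0. \<forall>x'\<in>UNIV. dist x' x < d \<longrightarrow> dist (F x') (F x) \<le> e"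
      using \<open>e > 0\<close> by blast
  qed
  define S where "S = {x\<in>{\<xi>..\<beta>}. t \<le> F x}"
  have "closed S"
  proof -
    have "S = {\<xi>..\<beta>} \<inter> {x. t \<le> F x}" unfolding S_def by auto
    then show ?thesis using \<open>continuous_on UNIV F\<close>
      by (auto intro!: closed_Int closed_Collect_le continuous_intros)
  qed
  have "S \<noteq> {}" using F\<beta> t \<xi>\<beta> by (auto simp: S_def intro!: exI[of _ \<beta>])
  have bdd: "bdd_below S" unfolding S_def by (auto intro!: bdd_belowI[of _ \<xi>])
  define y where "y = Inf S"
  have yS: "y \<in> S" unfolding y_def by (rule closed_contains_Inf) fact+
  have least: "F x < t" if "x < y" "\<xi> \<le> x" for x
    using cInf_lower[OF _ bdd, of x] that yS by (force simp: S_def y_def)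
  have "y > \<xi>" using yS F\<xi> t by (cases "y = \<xi>") (auto simp: S_def)
  have "F y = t"
  proof (rule ccontr)
    assume "F y \<noteq> t"
    then have "F y > t" using yS by (auto simp: S_def)
    define x where "x = max \<xi> (y - (F y - t))"
    have "x < y" "\<xi> \<le> x" using \<open>F y > t\<close> \<open>y > \<xi>\<close> by (auto simp: x_def)
    then show False using least[of x] lip[of x y] by (auto simp: x_def)
  qed
  moreover have "y \<in> E"
  proof (rule ccontr)
    assume "y \<notin> E"
    then obtain e where e: "e > 0" "ball y e \<subseteq> - E"
      using cl by (metis ComplI closed_def open_contains_ball)
    define x where "x = max \<xi> (y - e / 2)"
    have x: "x < y" "\<xi> \<le> x" using e \<open>y > \<xi>\<close> by (auto simp: x_def)
    have "E \<inter> {..x} = E \<inter> {..y}"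
    proof -
      have "z \<le> x" if "z \<in> E" "z \<le> y" for z
      proof (rule ccontr)
        assume "\<not> z \<le> x"
        then have "z \<in> ball y e" using that e by (auto simp: x_def dist_real_def)
        then show False using e that by auto
      qed
      then show ?thesis using x by auto
    qed
    then have "F x = F y" by (simp add: F_def)
    then show False using least[OF x] \<open>F y = t\<close> by simp
  qed
  ultimately show ?thesis by auto
qed

text \<open>The larger solution of (w + 1/w)/2 = 1 + \<delta>, that is, the exterior conformal map
  of [-1,1] at the point 1 + \<delta>.\<close>

definition joukowski_growth :: "real \<Rightarrow> real" where
  "joukowski_growth \<delta> = 1 + \<delta> + sqrt (2 * \<delta> + \<delta>\<^sup>2)"

lemma joukowski_growth_ge_1: "\<delta> \<ge> 0 \<Longrightarrow> joukowski_growth \<delta> \<ge> 1"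
  unfolding joukowski_growth_def by (simp add: add_nonneg_nonneg)

lemma joukowski_growth_eq:
  assumes "\<delta> \<ge> 0"
  shows "(joukowski_growth \<delta> + 1 / joukowski_growth \<delta>) / 2 = 1 + \<delta>"
proof -
  let ?w = "joukowski_growth \<delta>"
  have w: "?w \<noteq> 0" using joukowski_growth_ge_1[OF assms] by simp
  have "(?w - (1 + \<delta>))\<^sup>2 = 2 * \<delta> + \<delta>\<^sup>2"
    unfolding joukowski_growth_def using assms by simp
  then have "?w * ?w + 1 = 2 * (1 + \<delta>) * ?w" by (simp add: power2_eq_square algebra_simps)
  then show ?thesis using w by (simp add: field_simps)
qed

lemma chebyshev_growth:
  assumes "\<delta> \<ge> 0"
  shows "poly (chebyshev m) (1 + \<delta>) \<le> joukowski_growth \<delta> ^ m"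
proof -
  let ?w = "joukowski_growth \<delta>"
  have w: "?w \<ge> 1" using joukowski_growth_ge_1[OF assms] .
  then have "poly (chebyshev m) (1 + \<delta>) = (?w ^ m + 1 / ?w ^ m) / 2"
    using chebyshev_joukowski[of ?w m] joukowski_growth_eq[OF assms] by simp
  also have "\<dots> \<le> ?w ^ m"
  proof -
    have "?w ^ m \<ge> 1" using w by (rule one_le_power)
    moreover have "(W + 1 / W) / 2 \<le> W" if "W \<ge> 1" for W :: real
    proof -
      have "1 / W \<le> 1" using that by simp
      then have "1 / W \<le> W" using that by linarith
      then show ?thesis by simp
    qed
    ultimately show ?thesis by blast
  qed
  finally show ?thesis .
qed

text \<open>The nodes \<open>y i\<close> are the points of \<open>E\<close> below which
  \<open>E\<close> has measure \<open>t i\<close>. The Lipschitz property keeps them at least as far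
  apart as the \<open>t i\<close>, and since \<open>E\<close> misses at most length s,
  \<open>y i\<close> is within t i + s of \<xi>. So \<xi> behaves no worse than the point -s does
  relative to the nodes \<open>t i\<close>.\<close>

lemma remez_right:
  fixes E :: "real set"
  assumes cl: "closed E" and sub: "E \<subseteq> {\<xi>..\<xi> + h}" and s: "0 < s" "4 * s < h"
    and meas: "h - s \<le> measure lborel E" and m: "m \<ge> 1"
    and q: "degree q \<le> m" "\<And>x. x \<in> E \<Longrightarrow> \<bar>poly q x\<bar> \<le> 1"
  shows "\<bar>poly q \<xi>\<bar> \<le> joukowski_growth (4 * s / (h - 2 * s)) ^ m"
proof -
  define l where "l = h - 2 * s"
  have l: "l > 0" using s by (simp add: l_def)
  \<comment> \<open>The extremal points of the Chebyshev polynomial, transplanted to [s, h - s]: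
    they are positive and at most the measure of \<open>E\<close>, as quantile levels must be. The
    point -s then corresponds to 1 + 4s/l.\<close>
  define t where "t i = s + l * (1 - cos (real i * pi / real m)) / 2" for i :: nat
  define T where "T = pcompose (chebyshev m) [:1 + 2 * s / l, - 2 / l:]"
  have polyT: "poly T x = poly (chebyshev m) (1 - 2 * (x - s) / l)" for x
    unfolding T_def by (simp add: poly_pcompose algebra_simps diff_divide_distrib)
  have t_rng: "s \<le> t i" "t i \<le> h - s" for i
  proof -
    have "0 \<le> l * (1 - cos (real i * pi / real m))" "l * (1 - cos (real i * pi / real m)) \<le> l * 2"
      using l cos_ge_minus_one[of "real i * pi / real m"]
      by (auto intro!: mult_nonneg_nonneg mult_left_mono)
    then show "s \<le> t i" "t i \<le> h - s" unfolding t_def l_def by auto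
  qed
  define F where "F x = measure lborel (E \<inter> {..x})" for x
  have "\<exists>y\<in>E. F y = t i" for i
    unfolding F_def by (rule measure_quantile_point[OF cl sub]) (use t_rng[of i] s meas in auto)
  then obtain y where y: "\<And>i. y i \<in> E" "\<And>i. F (y i) = t i" by metis
  have lip: "F x' - F x \<le> x' - x" and mono: "F x \<le> F x'" if "x \<le> x'" for x x'
    unfolding F_def by (rule measure_below_lipschitz[OF cl sub that])+
  have F_top: "F (\<xi> + h) = measure lborel E" unfolding F_def
    by (rule arg_cong[where f="measure lborel"]) (use sub in auto)
  have "\<bar>poly q \<xi>\<bar> \<le> poly T (- s)"
  proof (rule lagrange_comparison[where t=t and y=y])
    fix i j :: nat assume ij: "i < j" "j \<le> m"
    have "cos (real j * pi / real m) < cos (real i * pi / real m)"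
      using ij m by (intro cos_monotone_0_pi) (auto simp: field_simps)
    then show "t i < t j" unfolding t_def using l by simp
  next
    show "degree T \<le> m" unfolding T_def using l degree_chebyshev[of m] by (simp add: degree_pcompose)
  next
    fix i assume "i \<le> m"
    have "1 - 2 * (t i - s) / l = cos (real i * pi / real m)" unfolding t_def using l by simp
    then show "poly T (t i) = (- 1) ^ i"
      unfolding polyT using m by (simp add: chebyshev_cos)
  next
    fix i show "- s < t i" using t_rng[of i] s by simp
  next
    fix i j
    show "\<bar>t i - t j\<bar> \<le> \<bar>y i - y j\<bar>"
      using lip[of "y i" "y j"] lip[of "y j" "y i"] mono[of "y i" "y j"] mono[of "y j" "y i"] y(2)
      by (cases "y i \<le> y j") auto
  next
    fix i
    have "y i \<in> {\<xi>..\<xi> + h}" using y(1)[of i] sub by blast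
    then show "\<bar>\<xi> - y i\<bar> \<le> t i - - s"
      using lip[of "y i" "\<xi> + h"] F_top meas y(2)[of i] by auto
  qed (use q y in auto)
  also have "\<dots> = poly (chebyshev m) (1 + 4 * s / (h - 2 * s))"
    unfolding polyT l_def by simp
  also have "\<dots> \<le> joukowski_growth (4 * s / (h - 2 * s)) ^ m"
    by (rule chebyshev_growth) (use s in auto)
  finally show ?thesis .
qed

lemma remez_left:
  fixes E :: "real set"
  assumes cl: "closed E" and sub: "E \<subseteq> {\<xi> - h..\<xi>}" and s: "0 < s" "4 * s < h"
    and meas: "h - s \<le> measure lborel E" and m: "m \<ge> 1"
    and q: "degree q \<le> m" "\<And>x. x \<in> E \<Longrightarrow> \<bar>poly q x\<bar> \<le> 1"
  shows "\<bar>poly q \<xi>\<bar> \<le> joukowski_growth (4 * s / (h - 2 * s)) ^ m"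
proof -
  have E': "uminus ` E = uminus -` E" by force
  have "\<bar>poly (pcompose q [:0, - 1:]) (- \<xi>)\<bar> \<le> joukowski_growth (4 * s / (h - 2 * s)) ^ m"
  proof (rule remez_right[of "uminus ` E"])
    show "closed (uminus ` E)" using cl by (rule closed_negations)
    have "measure lborel (uminus ` E) = measure lborel E"
    proof -
      have "measure (distr lborel borel uminus) E = measure lborel (uminus -` E \<inter> space lborel)"
        by (rule measure_distr) (use cl in auto)
      then show ?thesis unfolding E' by (simp add: lborel_distr_uminus)
    qed
    then show "h - s \<le> measure lborel (uminus ` E)" using meas by simp
  qed (use sub s m q in \<open>auto simp: degree_pcompose poly_pcompose\<close>)
  then show ?thesis by (simp add: poly_pcompose)
qed

lemma remez:
  fixes a b \<epsilon> :: real
  assumes "a < b" "\<epsilon> > 0"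
  shows "\<exists>s>0. \<forall>m\<ge>1. \<forall>q E. degree q \<le> m \<longrightarrow> closed E \<longrightarrow> E \<subseteq> {a..b} \<longrightarrow> b - a - s \<le> measure lborel E
     \<longrightarrow> (\<forall>x\<in>E. \<bar>poly q x\<bar> \<le> 1) \<longrightarrow> (\<forall>x\<in>{a..b}. \<bar>poly q x\<bar> \<le> exp (\<epsilon> * real m))"
proof -
  \<comment> \<open>Each point of \<open>{a..b}\<close> is an endpoint of an interval of half the
    length inside \<open>{a..b}\<close>, so one of the two one-sided versions applies.\<close>
  define h where "h = (b - a) / 2"
  have h: "h > 0" using assms by (simp add: h_def)
  have "((\<lambda>s. joukowski_growth (4 * s / (h - 2 * s))) \<longlongrightarrow> joukowski_growth (4 * 0 / (h - 2 * 0))) (at_right 0)"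
    unfolding joukowski_growth_def using h by (intro tendsto_intros) auto
  then have "((\<lambda>s. joukowski_growth (4 * s / (h - 2 * s))) \<longlongrightarrow> 1) (at_right 0)"
    by (simp add: joukowski_growth_def)
  then have "eventually (\<lambda>s. joukowski_growth (4 * s / (h - 2 * s)) < exp \<epsilon>) (at_right 0)"
    using assms by (intro order_tendstoD) auto
  moreover have "eventually (\<lambda>s. s < h / 4) (at_right 0)"
    using h by (intro order_tendstoD[OF tendsto_ident_at]) auto
  ultimately have "eventually (\<lambda>s. joukowski_growth (4 * s / (h - 2 * s)) < exp \<epsilon> \<and> s < h / 4 \<and> 0 < s) (at_right 0)"
    using eventually_at_right_less by eventually_elim auto
  then obtain s where s: "joukowski_growth (4 * s / (h - 2 * s)) < exp \<epsilon>" "s < h / 4" "0 < s"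
    using eventually_happens'[OF trivial_limit_at_right_real] by blast
  let ?w = "joukowski_growth (4 * s / (h - 2 * s))"
  have "\<bar>poly q x\<bar> \<le> exp (\<epsilon> * real m)"
    if m: "m \<ge> 1" and q: "degree q \<le> m" and E: "closed E" "E \<subseteq> {a..b}" "b - a - s \<le> measure lborel E"
      and bd: "\<forall>x\<in>E. \<bar>poly q x\<bar> \<le> 1" and x: "x \<in> {a..b}" for m q E x
  proof -
    have loc: "h - s \<le> measure lborel (E \<inter> {c..c + h})" if c: "a \<le> c" "c + h \<le> b" for c
    proof -
      have "measure lborel E \<le> measure lborel ((E \<inter> {c..c + h}) \<union> ({a..c} \<union> {c + h..b}))"
      proof (rule measure_mono_fmeasurable)
        have "E \<inter> {c..c + h} \<in> fmeasurable lborel"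
          by (rule fmeasurableI2[of "{c..c + h}"]) (use E in auto)
        then show "(E \<inter> {c..c + h}) \<union> ({a..c} \<union> {c + h..b}) \<in> fmeasurable lborel"
          using c h by (intro fmeasurable.Un) auto
      qed (use E in auto)
      also have "\<dots> \<le> measure lborel (E \<inter> {c..c + h}) + measure lborel ({a..c} \<union> {c + h..b})"
        by (rule measure_Un_le) (use E in auto)
      also have "measure lborel ({a..c} \<union> {c + h..b}) \<le> measure lborel {a..c} + measure lborel {c + h..b}"
        by (rule measure_Un_le) auto
      also have "\<dots> = b - a - h" using c by simp
      finally show ?thesis using E by simp
    qed
    have "\<bar>poly q x\<bar> \<le> ?w ^ m"
    proof (cases "x + h \<le> b")
      case True
      then show ?thesis
        by (intro remez_right[of "E \<inter> {x..x + h}"]) (use E s m q bd x loc[of x] in auto)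
    next
      case False
      then have "a \<le> x - h" using x by (simp add: h_def field_simps)
      then show ?thesis
        by (intro remez_left[of "E \<inter> {x - h..x}"]) (use E s m q bd x loc[of "x - h"] in auto)
    qed
    also have "\<dots> \<le> exp \<epsilon> ^ m"
      using s joukowski_growth_ge_1[of "4 * s / (h - 2 * s)"] by (intro power_mono) auto
    also have "\<dots> = exp (\<epsilon> * real m)" by (simp add: exp_of_nat2_mult)
    finally show ?thesis .
  qed
  then show ?thesis using s(3) by blast
qed

section \<open>From integrals to pointwise bounds\<close>

context reg_measure
begin

text \<open>If |q| were at most \<open>c\<close> outside a set of length s, the Remez inequality
  would bound M = |q(\<xi>)| by M/2. So |q| exceeds \<open>c\<close> on a set of length more than s.
  Removing \<eta>-neighbourhoods of \<alpha> and \<beta> costs at most s/2, and the rest carries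
  \<mu>-mass at least \<kappa>. The two quadratic factors allow \<open>q\<close> to be a weight from
  which the zeros \<alpha> and \<beta> have been stripped, while the integral still sees
  them.\<close>

lemma polynomial_regularity:
  assumes "\<epsilon> > 0"
  shows "\<exists>C>0. \<forall>m\<ge>1. \<forall>q \<alpha> \<beta>. degree q \<le> m \<longrightarrow>
     (\<forall>x\<in>{a..b}. \<bar>poly q x\<bar> \<le> C * exp (\<epsilon> * real m) * (\<integral>x. \<bar>poly q x\<bar> * ((x - \<alpha>)\<^sup>2 * (x - \<beta>)\<^sup>2) \<partial>\<mu>))"
proof -
  obtain s where s: "s > 0" and rem: "\<And>m q E x. m \<ge> 1 \<Longrightarrow> degree q \<le> m \<Longrightarrow> closed E \<Longrightarrow> E \<subseteq> {a..b} \<Longrightarrow>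
      b - a - s \<le> measure lborel E \<Longrightarrow> (\<forall>x\<in>E. \<bar>poly q x\<bar> \<le> 1) \<Longrightarrow> x \<in> {a..b} \<Longrightarrow> \<bar>poly q x\<bar> \<le> exp (\<epsilon> * real m)"
    using remez[OF ab assms] by metis
  obtain \<kappa> where \<kappa>: "\<kappa> > 0" and dom: "\<And>A. A \<in> sets borel \<Longrightarrow> A \<subseteq> {a..b} \<Longrightarrow> s / 2 \<le> measure lborel A \<Longrightarrow> \<kappa> \<le> measure \<mu> A"
    using dominates[of "s / 2"] s by auto
  define \<eta> where "\<eta> = s / 8"
  have \<eta>: "\<eta> > 0" using s by (simp add: \<eta>_def)
  have "\<bar>poly q \<xi>\<bar> \<le> 2 / (\<kappa> * \<eta> ^ 4) * exp (\<epsilon> * real m) * (\<integral>x. \<bar>poly q x\<bar> * ((x - \<alpha>)\<^sup>2 * (x - \<beta>)\<^sup>2) \<partial>\<mu>)"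
    if m: "m \<ge> 1" and q: "degree q \<le> m" and \<xi>: "\<xi> \<in> {a..b}" for m q \<alpha> \<beta> \<xi>
  proof (cases "poly q \<xi> = 0")
    case True
    then show ?thesis using \<kappa> \<eta> by (auto intro!: mult_nonneg_nonneg integral_nonneg_ab)
  next
    case False
    define M where "M = \<bar>poly q \<xi>\<bar>"
    define c where "c = M / 2 * exp (- (\<epsilon> * real m))"
    have M: "M > 0" and c: "c > 0" using False by (auto simp: M_def c_def)
    define E where "E = {x\<in>{a..b}. \<bar>poly q x\<bar> \<le> c}"
    have "closed E"
    proof -
      have "E = {a..b} \<inter> {x. \<bar>poly q x\<bar> \<le> c}" unfolding E_def by auto
      then show ?thesis by (auto intro!: closed_Int closed_Collect_le continuous_intros)
    qed
    have mE: "measure lborel E < b - a - s"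
    proof (rule ccontr)
      assume "\<not> ?thesis"
      then have "\<bar>poly (smult (1 / c) q) \<xi>\<bar> \<le> exp (\<epsilon> * real m)"
        using c m q \<xi> \<open>closed E\<close> by (intro rem[of m _ E]) (auto simp: E_def abs_mult field_simps)
      then have "M \<le> exp (\<epsilon> * real m) * c" using c by (simp add: M_def abs_mult field_simps)
      also have "\<dots> = M / 2" by (simp add: c_def exp_minus)
      finally show False using M by simp
    qed
    define A where "A = {a..b} - (E \<union> ({\<alpha> - \<eta>..\<alpha> + \<eta>} \<union> {\<beta> - \<eta>..\<beta> + \<eta>}))"
    have Am[measurable]: "A \<in> sets borel" unfolding A_def using \<open>closed E\<close> by auto
    have mA: "s / 2 \<le> measure lborel A"
    proof -
      have fE: "E \<in> fmeasurable lborel"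
        by (rule fmeasurableI2[of "{a..b}"]) (use \<open>closed E\<close> in \<open>auto simp: E_def\<close>)
      have fA: "A \<in> fmeasurable lborel"
        by (rule fmeasurableI2[of "{a..b}"]) (use Am in \<open>auto simp: A_def\<close>)
      have "measure lborel {a..b} \<le> measure lborel (A \<union> (E \<union> ({\<alpha> - \<eta>..\<alpha> + \<eta>} \<union> {\<beta> - \<eta>..\<beta> + \<eta>})))"
        by (rule measure_mono_fmeasurable)
           (use fE fA \<eta> in \<open>auto simp: A_def intro!: fmeasurable.Un\<close>)
      also have "\<dots> \<le> measure lborel A + measure lborel (E \<union> ({\<alpha> - \<eta>..\<alpha> + \<eta>} \<union> {\<beta> - \<eta>..\<beta> + \<eta>}))"
        by (rule measure_Un_le) (use \<open>closed E\<close> in auto)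
      also have "measure lborel (E \<union> ({\<alpha> - \<eta>..\<alpha> + \<eta>} \<union> {\<beta> - \<eta>..\<beta> + \<eta>})) \<le>
          measure lborel E + measure lborel ({\<alpha> - \<eta>..\<alpha> + \<eta>} \<union> {\<beta> - \<eta>..\<beta> + \<eta>})"
        by (rule measure_Un_le) (use \<open>closed E\<close> in auto)
      also have "measure lborel ({\<alpha> - \<eta>..\<alpha> + \<eta>} \<union> {\<beta> - \<eta>..\<beta> + \<eta>}) \<le>
          measure lborel {\<alpha> - \<eta>..\<alpha> + \<eta>} + measure lborel {\<beta> - \<eta>..\<beta> + \<eta>}"
        by (rule measure_Un_le) auto
      also have "\<dots> = s / 2" using \<eta> by (simp add: \<eta>_def)
      finally show ?thesis using mE ab by simp
    qed
    have "c * \<eta> ^ 4 * \<kappa> \<le> c * \<eta> ^ 4 * measure \<mu> A"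
      using dom[OF Am _ mA] c \<eta> by (intro mult_left_mono) (auto simp: A_def)
    also have "\<dots> = (\<integral>x. c * \<eta> ^ 4 * indicator A x \<partial>\<mu>)"
      by simp
    also have "\<dots> \<le> (\<integral>x. \<bar>poly q x\<bar> * ((x - \<alpha>)\<^sup>2 * (x - \<beta>)\<^sup>2) \<partial>\<mu>)"
    proof (rule integral_mono_ab)
      show "integrable \<mu> (\<lambda>x. c * \<eta> ^ 4 * indicator A x)"
        by (intro integrable_mult_right integrable_real_indicator) (auto simp: less_top[symmetric])
      show "integrable \<mu> (\<lambda>x. \<bar>poly q x\<bar> * ((x - \<alpha>)\<^sup>2 * (x - \<beta>)\<^sup>2))"
        by (intro integrable_cont continuous_intros)
    next
      fix x
      show "c * \<eta> ^ 4 * indicator A x \<le> \<bar>poly q x\<bar> * ((x - \<alpha>)\<^sup>2 * (x - \<beta>)\<^sup>2)"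
      proof (cases "x \<in> A")
        case True
        then have "c \<le> \<bar>poly q x\<bar>" by (auto simp: A_def E_def)
        moreover have "\<eta>\<^sup>2 \<le> (x - z)\<^sup>2" if "\<not> (z - \<eta> \<le> x \<and> x \<le> z + \<eta>)" for z
          using that \<eta> by (intro abs_le_square_iff[THEN iffD1]) auto
        then have "\<eta>\<^sup>2 \<le> (x - \<alpha>)\<^sup>2" "\<eta>\<^sup>2 \<le> (x - \<beta>)\<^sup>2" using True unfolding A_def by force+
        ultimately have "c * (\<eta>\<^sup>2 * \<eta>\<^sup>2) \<le> \<bar>poly q x\<bar> * ((x - \<alpha>)\<^sup>2 * (x - \<beta>)\<^sup>2)"
          using c by (intro mult_mono) auto
        then show ?thesis using True by (simp add: power4_eq_xxxx power2_eq_square mult_ac)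
      qed simp
    qed
    finally have "M * exp (- (\<epsilon> * real m)) * (\<kappa> * \<eta> ^ 4) \<le> 2 * (\<integral>x. \<bar>poly q x\<bar> * ((x - \<alpha>)\<^sup>2 * (x - \<beta>)\<^sup>2) \<partial>\<mu>)"
      by (simp add: c_def mult_ac)
    then show ?thesis using \<kappa> \<eta> unfolding M_def[symmetric]
      by (simp add: exp_minus field_simps)
  qed
  moreover have "2 / (\<kappa> * \<eta> ^ 4) > 0" using \<kappa> \<eta> by simp
  ultimately show ?thesis by blast
qed

end

section \<open>Growth off the interval and the logarithmic kernel\<close>

text \<open>The preimages of u are u + s and u - s with s^2 = u^2 - 1, and their product is 1. The
  sum of the distances from u to the foci -1 and 1 equals |w| + 1/|w|, so confocal ellipses
  correspond to circles.\<close>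

lemma joukowski_inverse:
  fixes u :: complex
  assumes "norm (u - 1) + norm (u + 1) \<le> 2 + 2 * \<delta>" "\<delta> \<ge> 0"
  obtains w where "w \<noteq> 0" "(w + 1 / w) / 2 = u" "norm w \<ge> 1" "norm w \<le> joukowski_growth \<delta>"
proof -
  define s where "s = csqrt (u\<^sup>2 - 1)"
  have "s\<^sup>2 = u\<^sup>2 - 1" by (simp add: s_def)
  then have p: "(u + s) * (u - s) = 1" by (simp add: algebra_simps power2_eq_square)
  have "\<exists>w. w \<noteq> 0 \<and> (w + 1 / w) / 2 = u \<and> norm w \<ge> 1"
  proof (cases "norm (u + s) \<ge> 1")
    case True
    have "u + s \<noteq> 0" using p by auto
    then have "1 / (u + s) = u - s" using p by (simp add: field_simps)
    then show ?thesis using True \<open>u + s \<noteq> 0\<close> by (intro exI[of _ "u + s"]) simp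
  next
    case False
    have "u - s \<noteq> 0" using p by auto
    then have "1 / (u - s) = u + s" using p by (simp add: field_simps)
    moreover have "norm (u + s) * norm (u - s) = 1" using p by (metis norm_mult norm_one)
    then have "norm (u - s) \<ge> 1" using False
      using mult_strict_mono'[of "norm (u + s)" 1 "norm (u - s)" 1] by force
    ultimately show ?thesis using \<open>u - s \<noteq> 0\<close> by (intro exI[of _ "u - s"]) simp
  qed
  then obtain w where w: "w \<noteq> 0" "(w + 1 / w) / 2 = u" "norm w \<ge> 1" by blast
  have sq: "norm (w - 1) ^ 2 + norm (w + 1) ^ 2 = 2 * (norm w ^ 2 + 1)"
    unfolding cmod_power2 by (simp add: power2_eq_square algebra_simps)
  have "u - 1 = (w - 1) ^ 2 / (2 * w)" "u + 1 = (w + 1) ^ 2 / (2 * w)"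
    using w(1) unfolding w(2)[symmetric] by (simp_all add: field_simps power2_eq_square)
  then have "norm (u - 1) + norm (u + 1) = (norm (w - 1) ^ 2 + norm (w + 1) ^ 2) / (2 * norm w)"
    by (simp add: norm_divide norm_power norm_mult add_divide_distrib)
  also have "\<dots> = norm w + 1 / norm w"
    unfolding sq using w(1) by (simp add: field_simps power2_eq_square)
  finally have le: "norm w + 1 / norm w \<le> 2 + 2 * \<delta>" using assms by simp
  have "norm w \<le> joukowski_growth \<delta>"
  proof (rule ccontr)
    let ?g = "joukowski_growth \<delta>" and ?t = "norm w"
    assume "\<not> ?thesis"
    then have gt: "?t > ?g" by simp
    have g1: "?g \<ge> 1" using assms by (intro joukowski_growth_ge_1)
    have "?g + 1 / ?g = 2 + 2 * \<delta>" using joukowski_growth_eq[OF assms(2)] by simp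
    then have "(?t + 1 / ?t) - (?g + 1 / ?g) \<le> 0" using le by simp
    moreover have "(?t + 1 / ?t) - (?g + 1 / ?g) = (?t - ?g) * (1 - 1 / (?t * ?g))"
    proof -
      have "?t \<noteq> 0" "?g \<noteq> 0" using gt g1 by linarith+
      then show ?thesis by (simp add: divide_simps) (simp add: algebra_simps)
    qed
    moreover have "?t * ?g > 1"
    proof -
      have "1 * 1 < ?t * ?g" by (rule mult_less_le_imp_less) (use gt g1 in linarith)+
      then show ?thesis by simp
    qed
    then have "(?t - ?g) * (1 - 1 / (?t * ?g)) > 0" using gt by (intro mult_pos_pos) auto
    ultimately show False by linarith
  qed
  then show thesis using w that by blast
qed

text \<open>The Bernstein-Walsh inequality. Under z = c + h (w + 1/w)/2 and \<zeta> = 1/w, the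
  function \<zeta>^d f(z) becomes the polynomial \<open>G\<close> in \<zeta>, with no singularity at
  0. The unit circle is mapped into \<open>{a..b}\<close>, so the maximum principle bounds
  \<open>G\<close> by \<open>M\<close> on the disc, and the point x + i \<eta> has a preimage w of
  modulus at most the growth factor.\<close>

lemma bernstein_walsh_product:
  fixes X Y :: "real set"
  assumes ab: "a < b" and M: "\<And>x. x \<in> {a..b} \<Longrightarrow> \<bar>(\<Prod>r\<in>X. x - r)\<^sup>2 * (\<Prod>r\<in>Y. x - r)\<bar> \<le> M"
    and x: "x \<in> {a..b}" and \<eta>: "\<eta> \<ge> 0"
  shows "norm ((\<Prod>r\<in>X. Complex x \<eta> - of_real r)\<^sup>2 * (\<Prod>r\<in>Y. Complex x \<eta> - of_real r)) \<le>
     M * joukowski_growth (2 * \<eta> / (b - a)) ^ (2 * card X + card Y)"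
proof -
  define h where "h = (b - a) / 2"
  define c where "c = (a + b) / 2"
  have h: "h > 0" using ab by (simp add: h_def)
  define d where "d = 2 * card X + card Y"
  define \<delta> where "\<delta> = 2 * \<eta> / (b - a)"
  have \<delta>: "\<delta> \<ge> 0" "\<delta> = \<eta> / h" using ab \<eta> by (auto simp: \<delta>_def h_def)
  define f where "f z = (\<Prod>r\<in>X. z - of_real r)\<^sup>2 * (\<Prod>r\<in>Y. z - of_real r)" for z :: complex
  define G where "G \<zeta> = (\<Prod>r\<in>X. of_real h * (\<zeta>\<^sup>2 + 1) / 2 + of_real (c - r) * \<zeta>)\<^sup>2
      * (\<Prod>r\<in>Y. of_real h * (\<zeta>\<^sup>2 + 1) / 2 + of_real (c - r) * \<zeta>)" for \<zeta> :: complex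
  have G_eq: "G \<zeta> = \<zeta> ^ d * f z" if "\<And>r. of_real h * (\<zeta>\<^sup>2 + 1) / 2 + of_real (c - r) * \<zeta> = \<zeta> * (z - of_real r)" for \<zeta> z
    unfolding G_def f_def that by (simp add: prod.distrib d_def power_add power_mult power_mult_distrib mult_ac)
  have bound: "norm (G \<zeta>) \<le> M" if "norm \<zeta> \<le> 1" for \<zeta>
  proof (rule maximum_modulus_frontier[of G "cball 0 1"])
    show "G holomorphic_on interior (cball 0 1)" unfolding G_def by (intro holomorphic_intros) auto
    show "continuous_on (closure (cball 0 1)) G" unfolding G_def by (intro continuous_intros) auto
  next
    fix z :: complex assume "z \<in> frontier (cball 0 1)"
    then have nz: "norm z = 1" by simp
    have z2: "z\<^sup>2 + 1 = 2 * z * of_real (Re z)"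
    proof -
      have "z * cnj z = 1" using nz by (simp add: complex_norm_square[symmetric])
      then have "z\<^sup>2 + 1 = z * (z + cnj z)" by (simp add: power2_eq_square algebra_simps)
      then show ?thesis by (simp add: complex_add_cnj)
    qed
    define t where "t = c + h * Re z"
    have "G z = z ^ d * f (of_real t)"
      by (rule G_eq) (simp only: z2, simp add: t_def algebra_simps)
    then have "norm (G z) = norm (f (of_real t))" using nz by (simp add: norm_mult norm_power)
    also have "f (of_real t) = of_real ((\<Prod>r\<in>X. t - r)\<^sup>2 * (\<Prod>r\<in>Y. t - r))"
      unfolding f_def by simp
    also have "norm \<dots> \<le> M"
    proof -
      have "\<bar>Re z\<bar> \<le> 1" using abs_Re_le_cmod[of z] nz by simp
      then have "\<bar>h * Re z\<bar> \<le> h" using h by (simp add: abs_mult)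
      then have "t \<in> {a..b}" by (auto simp: t_def c_def h_def abs_le_iff field_simps)
      then show ?thesis unfolding norm_of_real by (rule M)
    qed
    finally show "norm (G z) \<le> M" .
  qed (use that in auto)
  define u where "u = (Complex x \<eta> - of_real c) / of_real h"
  have uC: "u = Complex ((x - c) / h) \<delta>"
    unfolding u_def using h \<delta> by (simp add: complex_eq_iff)
  have xi: "\<bar>(x - c) / h\<bar> \<le> 1" using x h unfolding c_def h_def by (auto simp: abs_le_iff field_simps)
  have "norm (u - 1) + norm (u + 1) \<le> 2 + 2 * \<delta>"
    using cmod_le[of "u - 1"] cmod_le[of "u + 1"] xi \<delta> unfolding uC by (simp add: abs_le_iff)
  then obtain w where w: "w \<noteq> 0" "(w + 1 / w) / 2 = u" "norm w \<ge> 1" "norm w \<le> joukowski_growth \<delta>"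
    using joukowski_inverse \<delta> by blast
  define \<zeta> where "\<zeta> = 1 / w"
  have z: "Complex x \<eta> = of_real c + of_real h * ((w + 1 / w) / 2)"
    unfolding w(2) u_def using h by simp
  have "G \<zeta> = \<zeta> ^ d * f (Complex x \<eta>)"
  proof (rule G_eq)
    fix r
    show "of_real h * (\<zeta>\<^sup>2 + 1) / 2 + of_real (c - r) * \<zeta> = \<zeta> * (Complex x \<eta> - of_real r)"
      unfolding z \<zeta>_def using w(1) by (simp add: field_simps power2_eq_square)
  qed
  then have "f (Complex x \<eta>) = w ^ d * G \<zeta>" unfolding \<zeta>_def using w(1) by (simp add: power_one_over)
  then have "norm (f (Complex x \<eta>)) = norm w ^ d * norm (G \<zeta>)" by (simp add: norm_mult norm_power)
  also have "\<dots> \<le> joukowski_growth \<delta> ^ d * M"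
    by (intro mult_mono power_mono bound w(4)) (use w in \<open>auto simp: \<zeta>_def norm_divide joukowski_growth_ge_1 \<delta> order.trans[OF _ joukowski_growth_ge_1]\<close>)
  finally show ?thesis unfolding f_def d_def \<delta>_def by (simp add: mult_ac)
qed

text \<open>h / (s^2 + h^2) is the integral of exp (-h t) cos (t s) over t > 0, and the cosines of
  the differences sum to two squares. Instead of an improper integral, the antiderivative
  \<open>F\<close> is used: \<open>G\<close> is nondecreasing and tends to 0, so G 0 <= 0.\<close>

lemma cauchy_kernel_pos_def:
  fixes x d :: "'i \<Rightarrow> real"
  assumes "h > 0"
  shows "0 \<le> (\<Sum>i\<in>I. \<Sum>j\<in>I. d i * d j / ((x i - x j)\<^sup>2 + h\<^sup>2))"
proof -
  have pos: "s\<^sup>2 + h\<^sup>2 > 0" for s :: real using assms by (simp add: add_nonneg_pos)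
  define F where "F s t = exp (- h * t) * (s * sin (t * s) - h * cos (t * s)) / (s\<^sup>2 + h\<^sup>2)" for s t :: real
  define G where "G t = (\<Sum>i\<in>I. \<Sum>j\<in>I. d i * d j * F (x i - x j) t)" for t
  have dF: "(F s has_real_derivative exp (- h * t) * cos (t * s)) (at t)" for s t
  proof -
    have "((\<lambda>t. exp (- h * t) * (s * sin (t * s) - h * cos (t * s))) has_real_derivative
        exp (- h * t) * (cos (t * s) * (s\<^sup>2 + h\<^sup>2))) (at t)"
      by (rule derivative_eq_intros refl | simp)+ (simp add: algebra_simps power2_eq_square)
    from DERIV_cdivide[OF this, of "s\<^sup>2 + h\<^sup>2"]
    have "(F s has_real_derivative exp (- h * t) * (cos (t * s) * (s\<^sup>2 + h\<^sup>2)) / (s\<^sup>2 + h\<^sup>2)) (at t)"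
      unfolding F_def .
    then show ?thesis using pos[of s] assms by simp
  qed
  have dG: "(G has_real_derivative exp (- h * t) * ((\<Sum>i\<in>I. d i * cos (t * x i))\<^sup>2 + (\<Sum>i\<in>I. d i * sin (t * x i))\<^sup>2)) (at t)" for t
  proof -
    have "(G has_real_derivative (\<Sum>i\<in>I. \<Sum>j\<in>I. d i * d j * (exp (- h * t) * cos (t * (x i - x j))))) (at t)"
      unfolding G_def by (intro DERIV_sum DERIV_cmult dF)
    also have "(\<Sum>i\<in>I. \<Sum>j\<in>I. d i * d j * (exp (- h * t) * cos (t * (x i - x j)))) =
        exp (- h * t) * ((\<Sum>i\<in>I. d i * cos (t * x i))\<^sup>2 + (\<Sum>i\<in>I. d i * sin (t * x i))\<^sup>2)"
      by (simp add: power2_eq_square sum_product sum_distrib_left sum.distrib[symmetric] cos_diff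
           right_diff_distrib distrib_left mult_ac)
    finally show ?thesis .
  qed
  have "G 0 \<le> G t" if "0 \<le> t" for t
    by (rule DERIV_nonneg_imp_nondecreasing[OF that]) (use dG in \<open>auto intro!: exI mult_nonneg_nonneg add_nonneg_nonneg\<close>)
  moreover have "(F s \<longlongrightarrow> 0) at_top" for s
  proof (rule Lim_null_comparison)
    show "((\<lambda>t. exp (- h * t) * ((\<bar>s\<bar> + h) / (s\<^sup>2 + h\<^sup>2))) \<longlongrightarrow> 0) at_top"
      using assms by real_asymp
    have "norm (F s t) \<le> exp (- h * t) * ((\<bar>s\<bar> + h) / (s\<^sup>2 + h\<^sup>2))" for t
    proof -
      have "\<bar>s * sin (t * s)\<bar> \<le> \<bar>s\<bar>" "\<bar>h * cos (t * s)\<bar> \<le> h"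
        using assms by (auto simp: abs_mult mult_left_le)
      then have "\<bar>s * sin (t * s) - h * cos (t * s)\<bar> \<le> \<bar>s\<bar> + h" by linarith
      then show ?thesis unfolding F_def using pos[of s]
        by (simp add: abs_mult abs_divide divide_right_mono)
    qed
    then show "\<forall>\<^sub>F t in at_top. norm (F s t) \<le> exp (- h * t) * ((\<bar>s\<bar> + h) / (s\<^sup>2 + h\<^sup>2))" by simp
  qed
  then have "(G \<longlongrightarrow> (\<Sum>i\<in>I. \<Sum>j\<in>I. d i * d j * 0)) at_top"
    unfolding G_def by (intro tendsto_sum tendsto_mult tendsto_const)
  ultimately have "G 0 \<le> 0"
    by (intro tendsto_lowerbound[of G 0 at_top "G 0"])
       (auto simp: eventually_at_top_linorder trivial_limit_at_top_linorder intro: exI[of _ 0])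
  moreover have "G 0 = - h * (\<Sum>i\<in>I. \<Sum>j\<in>I. d i * d j / ((x i - x j)\<^sup>2 + h\<^sup>2))"
    unfolding G_def F_def by (simp add: sum_distrib_left sum_negf[symmetric] mult_ac)
  ultimately show ?thesis using assms by (simp add: zero_le_mult_iff)
qed

text \<open>The logarithmic kernel is, up to its behaviour at infinity, an integral of Cauchy kernels,
  hence conditionally negative definite.\<close>

lemma log_kernel_neg_def:
  fixes x d :: "'i \<Rightarrow> real"
  assumes "u > 0" "(\<Sum>i\<in>I. d i) = 0"
  shows "(\<Sum>i\<in>I. \<Sum>j\<in>I. d i * d j * ln ((x i - x j)\<^sup>2 + u)) \<le> 0"
proof -
  define g where "g v = (\<Sum>i\<in>I. \<Sum>j\<in>I. d i * d j * ln ((x i - x j)\<^sup>2 + v))" for v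
  have dg: "(g has_real_derivative (\<Sum>i\<in>I. \<Sum>j\<in>I. d i * d j * (1 / ((x i - x j)\<^sup>2 + v)))) (at v)" if "v > 0" for v
    unfolding g_def
  proof (intro DERIV_sum DERIV_cmult)
    fix i j
    have "(x i - x j)\<^sup>2 + v > 0" using that by (simp add: add_nonneg_pos)
    then show "((\<lambda>v. ln ((x i - x j)\<^sup>2 + v)) has_real_derivative 1 / ((x i - x j)\<^sup>2 + v)) (at v)"
      by (auto intro!: derivative_eq_intros)
  qed
  have pos: "0 \<le> (\<Sum>i\<in>I. \<Sum>j\<in>I. d i * d j * (1 / ((x i - x j)\<^sup>2 + v)))" if "v > 0" for v
    using cauchy_kernel_pos_def[of "sqrt v" d x I] that by simp
  have "g u \<le> g v" if "u \<le> v" for v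
    by (rule DERIV_nonneg_imp_nondecreasing[OF that]) (use dg pos assms in \<open>meson order_less_le_trans\<close>)
  moreover have "(g \<longlongrightarrow> 0) at_top"
  proof -
    \<comment> \<open>Total charge zero allows subtracting ln v from every entry, which makes each
      term vanish at infinity.\<close>
    have eq: "g v = (\<Sum>i\<in>I. \<Sum>j\<in>I. d i * d j * (ln ((x i - x j)\<^sup>2 + v) - ln v))" for v
    proof -
      have "(\<Sum>i\<in>I. \<Sum>j\<in>I. d i * d j * ln v) = (\<Sum>i\<in>I. d i * (\<Sum>j\<in>I. d j) * ln v)"
        by (simp only: sum_distrib_left sum_distrib_right)
      then show ?thesis unfolding g_def using assms by (simp add: right_diff_distrib sum_subtractf)
    qed
    have "((\<lambda>v. ln (s + v) - ln v) \<longlongrightarrow> 0) at_top" for s :: real by real_asymp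
    then have "((\<lambda>v. \<Sum>i\<in>I. \<Sum>j\<in>I. d i * d j * (ln ((x i - x j)\<^sup>2 + v) - ln v)) \<longlongrightarrow> (\<Sum>i\<in>I. \<Sum>j\<in>I. d i * d j * 0)) at_top"
      by (intro tendsto_sum tendsto_mult tendsto_const)
    then show ?thesis unfolding eq by simp
  qed
  ultimately have "g u \<le> 0"
    by (intro tendsto_lowerbound[of g 0 at_top "g u"])
       (auto simp: eventually_at_top_linorder trivial_limit_at_top_linorder)
  then show ?thesis by (simp add: g_def)
qed

section \<open>Weighted orthogonality\<close>

text \<open>On an interval free of the points z, each ln |x - z| is concave, hence so is their sum,
  and a concave function is at an interior point at least the smaller of its end values.
  \<open>Z\<close> is a multiset because the zeros of p enter the weight twice.\<close>

lemma prod_abs_log_concave: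
  fixes y y' \<alpha> :: real
  assumes Z: "\<And>z. z \<in># Z \<Longrightarrow> z < y \<or> y' < z" and y: "y < \<alpha>" "\<alpha> < y'"
  shows "min (\<Prod>z\<in>#Z. \<bar>y - z\<bar>) (\<Prod>z\<in>#Z. \<bar>y' - z\<bar>) \<le> (\<Prod>z\<in>#Z. \<bar>\<alpha> - z\<bar>)"
proof -
  define l where "l = (\<alpha> - y) / (y' - y)"
  have l: "0 \<le> l" "l \<le> 1" using y by (auto simp: l_def)
  have \<alpha>: "\<alpha> = (1 - l) * y + l * y'"
  proof -
    have "l * (y' - y) = \<alpha> - y" using y by (simp add: l_def)
    then show ?thesis by (simp add: algebra_simps)
  qed
  have trm: "(1 - l) * ln \<bar>y - z\<bar> + l * ln \<bar>y' - z\<bar> \<le> ln \<bar>\<alpha> - z\<bar>" if "z < y \<or> y' < z" for z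
  proof -
    have "ln ((1 - l) * \<bar>y - z\<bar> + l * \<bar>y' - z\<bar>) \<ge> (1 - l) * ln \<bar>y - z\<bar> + l * ln \<bar>y' - z\<bar>"
      using that y l concave_onD[OF ln_concave, of l "\<bar>y - z\<bar>" "\<bar>y' - z\<bar>"] by auto
    also have "(1 - l) * \<bar>y - z\<bar> + l * \<bar>y' - z\<bar> = \<bar>\<alpha> - z\<bar>"
    proof (cases "z < y")
      case True
      then have "\<bar>y - z\<bar> = y - z" "\<bar>y' - z\<bar> = y' - z" "\<bar>\<alpha> - z\<bar> = \<alpha> - z" using y by auto
      then show ?thesis unfolding \<alpha> by (simp add: algebra_simps)
    next
      case False
      then have "\<bar>y - z\<bar> = z - y" "\<bar>y' - z\<bar> = z - y'" "\<bar>\<alpha> - z\<bar> = z - \<alpha>" using y that by auto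
      then show ?thesis unfolding \<alpha> by (simp add: algebra_simps)
    qed
    finally show ?thesis .
  qed
  have pos: "(\<Prod>z\<in>#Z. \<bar>x - z\<bar>) > 0" and lnp: "ln (\<Prod>z\<in>#Z. \<bar>x - z\<bar>) = (\<Sum>z\<in>#Z. ln \<bar>x - z\<bar>)"
    if "x \<in> {y..y'}" for x
  proof -
    have "(\<Prod>z\<in>#Z. \<bar>x - z\<bar>) > 0 \<and> ln (\<Prod>z\<in>#Z. \<bar>x - z\<bar>) = (\<Sum>z\<in>#Z. ln \<bar>x - z\<bar>)"
      using Z
    proof (induction Z)
      case (add z Z)
      then have z: "\<bar>x - z\<bar> > 0" using that by fastforce
      have IH: "(\<Prod>z\<in>#Z. \<bar>x - z\<bar>) > 0" "ln (\<Prod>z\<in>#Z. \<bar>x - z\<bar>) = (\<Sum>z\<in>#Z. ln \<bar>x - z\<bar>)"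
        using add by auto
      from ln_mult_pos[OF z IH(1)] show ?case using mult_pos_pos[OF z IH(1)] IH(2) by simp
    qed auto
    then show "(\<Prod>z\<in>#Z. \<bar>x - z\<bar>) > 0" "ln (\<Prod>z\<in>#Z. \<bar>x - z\<bar>) = (\<Sum>z\<in>#Z. ln \<bar>x - z\<bar>)" by auto
  qed
  let ?p = "\<lambda>x. \<Prod>z\<in>#Z. \<bar>x - z\<bar>"
  have "(1 - l) * ln (?p y) + l * ln (?p y') \<le> ln (?p \<alpha>)"
  proof -
    have "(1 - l) * (\<Sum>z\<in>#Z. ln \<bar>y - z\<bar>) + l * (\<Sum>z\<in>#Z. ln \<bar>y' - z\<bar>) \<le> (\<Sum>z\<in>#Z. ln \<bar>\<alpha> - z\<bar>)"
      using Z
    proof (induction Z)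
      case (add z Z)
      then show ?case using trm[of z] by (auto simp: algebra_simps)
    qed auto
    then show ?thesis using y by (simp add: lnp)
  qed
  moreover have "min (ln (?p y)) (ln (?p y')) \<le> (1 - l) * ln (?p y) + l * ln (?p y')"
    (is "min ?A ?B \<le> _")
  proof -
    have "(1 - l) * min ?A ?B + l * min ?A ?B \<le> (1 - l) * ?A + l * ?B"
      using l by (intro add_mono mult_left_mono) auto
    then show ?thesis by (simp add: algebra_simps)
  qed
  ultimately have "min (ln (?p y)) (ln (?p y')) \<le> ln (?p \<alpha>)" by linarith
  then show ?thesis using pos[of y] pos[of y'] pos[of \<alpha>] y
    by (auto simp: min_def split: if_splits)
qed

lemma poly_root_poly_remove:
  "finite X \<Longrightarrow> z \<in> X \<Longrightarrow> nodal X x = (x - z) * nodal (X - {z}) x"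
  by (simp add: poly_root_poly prod.remove)

lemma poly_root_poly_remove2:
  assumes "finite X" "\<alpha> \<in> X" "\<beta> \<in> X" "\<alpha> \<noteq> \<beta>"
  shows "nodal (X - {\<alpha>}) x = (x - \<beta>) * nodal (X - {\<alpha>, \<beta>}) x"
proof -
  have "X - {\<alpha>, \<beta>} = (X - {\<alpha>}) - {\<beta>}" by auto
  then show ?thesis using assms by (simp add: poly_root_poly_remove[of "X - {\<alpha>}" \<beta>])
qed

abbreviation nodal_weight :: "real set \<Rightarrow> real set \<Rightarrow> real \<Rightarrow> real" where
  "nodal_weight X Y x \<equiv> (nodal X x)\<^sup>2 * \<bar>nodal Y x\<bar>"

context reg_measure
begin

text \<open>\<open>Y\<close> may lie on either side, so that the same facts serve for
  \<open>\<mu>1\<close> with (X, Y) and for \<open>\<mu>2\<close> with (Y, X).\<close>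

definition config :: "nat \<Rightarrow> real set \<Rightarrow> real set \<Rightarrow> bool" where
  "config n X Y \<longleftrightarrow> n \<ge> 1 \<and> finite X \<and> finite Y \<and> card X = n \<and> card Y = n \<and> X \<subseteq> {a<..<b} \<and>
     ((\<forall>y\<in>Y. b < y) \<or> (\<forall>y\<in>Y. y < a)) \<and> orthogonal_upto \<mu> (root_poly X * root_poly Y) n"

definition weighted_norm :: "real set \<Rightarrow> real set \<Rightarrow> real" where
  "weighted_norm X Y = (\<integral>x. nodal_weight X Y x \<partial>\<mu>)"

lemma config_sign:
  assumes "config n X Y"
  obtains \<sigma> :: real where "\<sigma>\<^sup>2 = 1" "\<And>x. x \<in> {a..b} \<Longrightarrow> \<bar>nodal Y x\<bar> = \<sigma> * nodal Y x"
    "\<And>x. x \<in> {a..b} \<Longrightarrow> nodal Y x \<noteq> 0"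
proof -
  from assms have fin: "finite Y" and side: "(\<forall>y\<in>Y. b < y) \<or> (\<forall>y\<in>Y. y < a)"
    by (auto simp: config_def)
  have nz: "nodal Y x \<noteq> 0" if "x \<in> {a..b}" for x
    using side that fin by (auto simp: poly_root_poly_eq_0)
  have "(\<forall>x\<in>{a..b}. 0 \<le> nodal Y x) \<or> (\<forall>x\<in>{a..b}. nodal Y x \<le> 0)"
    by (rule poly_sign_const) (use nz in auto)
  then show thesis
  proof
    assume "\<forall>x\<in>{a..b}. 0 \<le> nodal Y x"
    then show thesis by (intro that[of 1]) (use nz in auto)
  next
    assume "\<forall>x\<in>{a..b}. nodal Y x \<le> 0"
    then show thesis by (intro that[of "- 1"]) (use nz in auto)
  qed
qed

lemma integral_cong_ab:
  assumes "f \<in> borel_measurable borel" "g \<in> borel_measurable borel" "\<And>x. x \<in> {a..b} \<Longrightarrow> f x = (g x :: real)"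
  shows "integral\<^sup>L \<mu> f = integral\<^sup>L \<mu> g"
  by (rule integral_cong_AE)
     (use assms AE_ab in \<open>auto simp: measurable_cong_sets[OF sets_mu refl]\<close>)

lemma poly_borel [measurable]: "poly p \<in> borel_measurable (borel :: real measure)"
  by (intro borel_measurable_continuous_onI continuous_intros)

lemma config_orth:
  assumes "config n X Y" "degree h < n"
  shows "(\<integral>x. poly (root_poly X * h) x * \<bar>nodal Y x\<bar> \<partial>\<mu>) = 0"
proof -
  obtain \<sigma> :: real where \<sigma>: "\<And>x. x \<in> {a..b} \<Longrightarrow> \<bar>nodal Y x\<bar> = \<sigma> * nodal Y x"
    using config_sign[OF assms(1)] by metis
  have "(\<integral>x. poly (root_poly X * h) x * \<bar>nodal Y x\<bar> \<partial>\<mu>) =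
      (\<integral>x. \<sigma> * poly (root_poly X * root_poly Y * h) x \<partial>\<mu>)"
    by (rule integral_cong_ab) (auto simp: \<sigma> mult_ac)
  also have "\<dots> = 0"
    using orthogonal_uptoD[of "root_poly X * root_poly Y" n h] assms by (simp add: config_def)
  finally show ?thesis .
qed

lemma weighted_norm_pos:
  assumes "config n X Y"
  shows "weighted_norm X Y > 0"
proof -
  obtain \<sigma> :: real where \<sigma>: "\<sigma>\<^sup>2 = 1" "\<And>x. x \<in> {a..b} \<Longrightarrow> \<bar>nodal Y x\<bar> = \<sigma> * nodal Y x"
    using config_sign[OF assms] by metis
  define p where "p = smult \<sigma> (root_poly X * root_poly X * root_poly Y)"
  have "\<sigma> \<noteq> 0" using \<sigma>(1) by auto
  have p0: "p \<noteq> 0" using \<open>\<sigma> \<noteq> 0\<close> by (simp add: p_def)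
  have pe: "poly p x = nodal_weight X Y x" if "x \<in> {a..b}" for x
    using \<sigma>(2)[OF that] by (simp add: p_def power2_eq_square)
  have eq: "weighted_norm X Y = integral\<^sup>L \<mu> (poly p)"
    unfolding weighted_norm_def by (rule integral_cong_ab) (use pe in auto)
  have "weighted_norm X Y \<ge> 0" unfolding weighted_norm_def by (rule integral_nonneg_ab) auto
  moreover have "weighted_norm X Y \<noteq> 0"
    using integral_poly_eq_0D[of p] p0 pe eq by auto
  ultimately show ?thesis by simp
qed

text \<open>\<open>root_poly X\<close> is the monic orthogonal polynomial of degree n for the
  varying measure \<open>\<bar>nodal Y x\<bar> d\<mu>\<close>, and such a polynomial has the least
  norm by Pythagoras.\<close>

lemma weighted_norm_minimal:
  assumes "config n X Y" "card Z = n"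
  shows "weighted_norm X Y \<le> weighted_norm Z Y"
proof -
  let ?X = "nodal X" and ?Y = "\<lambda>x. \<bar>nodal Y x\<bar>"
  define h where "h = root_poly Z - root_poly X"
  have cX: "card X = n" "n \<ge> 1" using assms by (auto simp: config_def)
  have h: "degree h < n"
  proof (cases "h = 0")
    case False
    have "degree h \<le> n" unfolding h_def using cX assms by (intro degree_diff_le) auto
    moreover have "coeff h n = 0" unfolding h_def
      using lead_coeff_root_poly[of X] lead_coeff_root_poly[of Z] cX assms by simp
    ultimately show ?thesis using False by (metis le_neq_implies_less leading_coeff_0_iff)
  qed (use cX in simp)
  have "weighted_norm X Y = (\<integral>x. (?X x)\<^sup>2 * ?Y x + 2 * (poly (root_poly X * h) x * ?Y x) \<partial>\<mu>)"
    unfolding weighted_norm_def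
    by (subst Bochner_Integration.integral_add)
       (auto intro!: integrable_cont continuous_intros simp: config_orth[OF assms(1) h] simp del: poly_mult)
  also have "\<dots> \<le> weighted_norm Z Y"
    unfolding weighted_norm_def
  proof (intro integral_mono_ab integrable_cont continuous_intros)
    fix x
    have "nodal Z x = ?X x + poly h x" by (simp add: h_def)
    then have "(nodal Z x)\<^sup>2 * ?Y x - ((?X x)\<^sup>2 * ?Y x + 2 * (poly (root_poly X * h) x * ?Y x)) = (poly h x)\<^sup>2 * ?Y x"
      by (simp add: power2_eq_square algebra_simps)
    moreover have "(poly h x)\<^sup>2 * ?Y x \<ge> 0" by simp
    ultimately show "(?X x)\<^sup>2 * ?Y x + 2 * (poly (root_poly X * h) x * ?Y x) \<le> (nodal Z x)\<^sup>2 * ?Y x"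
      by linarith
  qed
  finally show ?thesis .
qed

text \<open>If \<open>- c e\<close> were small wherever \<open>e < 0\<close>, then \<open>e\<^sup>2 c\<close> would have a too small integral,
  since \<open>e c\<close> has integral zero.\<close>

lemma orthogonality_forces_large_value:
  fixes c e :: "real \<Rightarrow> real"
  assumes cont: "continuous_on UNIV c" "continuous_on UNIV e"
    and c: "\<And>x. c x \<ge> 0" and e: "\<And>x. x \<in> {a..b} \<Longrightarrow> \<bar>e x\<bar> \<le> K" and K: "K > 0"
    and zero: "(\<integral>x. e x * c x \<partial>\<mu>) = 0" and pos: "(\<integral>x. (e x)\<^sup>2 * c x \<partial>\<mu>) > 0"
  shows "\<exists>y\<in>{a..b}. e y < 0 \<and> (\<integral>x. (e x)\<^sup>2 * c x \<partial>\<mu>) / (4 * K * mass) \<le> c y * (- e y)"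
proof (rule ccontr)
  assume neg: "\<not> ?thesis"
  define N where "N = (\<integral>x. (e x)\<^sup>2 * c x \<partial>\<mu>)"
  \<comment> \<open>The factor 4 makes the error \<open>2 * K * k * mass\<close> below equal to
    N/2.\<close>
  define k where "k = N / (4 * K * mass)"
  have k: "k \<ge> 0" using pos mass_pos K by (simp add: k_def N_def)
  have "N \<le> (\<integral>x. K * (e x * c x) + 2 * K * k \<partial>\<mu>)"
    unfolding N_def
  proof (intro integral_mono_ab integrable_cont continuous_intros cont)
    fix x assume x: "x \<in> {a..b}"
    show "(e x)\<^sup>2 * c x \<le> K * (e x * c x) + 2 * K * k"
    proof (cases "e x < 0")
      case True
      then have lt: "c x * (- e x) \<le> k" using neg x unfolding k_def N_def by fastforce
      have "(e x)\<^sup>2 * c x = (- e x) * (c x * (- e x))" by (simp add: power2_eq_square)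
      also have "\<dots> \<le> K * k" using lt e[OF x] True c[of x] K by (intro mult_mono) (auto intro: mult_nonneg_nonpos)
      finally have "(e x)\<^sup>2 * c x \<le> K * k" .
      moreover have "K * (c x * (- e x)) \<le> K * k" using lt K by (intro mult_left_mono) auto
      ultimately show ?thesis by (simp add: algebra_simps)
    next
      case False
      then have "e x * (e x * c x) \<le> K * (e x * c x)" using e[OF x] c[of x] by (intro mult_right_mono) auto
      moreover have "0 \<le> 2 * K * k" using k K by simp
      ultimately show ?thesis by (simp add: power2_eq_square mult_ac)
    qed
  qed
  also have "\<dots> = K * (\<integral>x. e x * c x \<partial>\<mu>) + 2 * K * k * mass"
    by (subst Bochner_Integration.integral_add)
       (auto intro!: integrable_cont continuous_intros cont simp: mult_ac)
  also have "\<dots> = N / 2" unfolding zero k_def using K mass_pos by simp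
  finally show False using pos by (simp add: N_def)
qed

lemma config_node_bound:
  assumes "config n X Y" "\<alpha> \<in> X" "x \<in> {a..b}"
  shows "\<bar>x - \<alpha>\<bar> \<le> b - a"
  using assms unfolding config_def by (auto simp: abs_le_iff)

text \<open>The test polynomial is p / ((x - \<alpha>)(x - \<beta>)); the factor \<open>e\<close> it
  leaves is negative exactly between \<alpha> and \<beta>, so the large value occurs there.\<close>

lemma gap_large_value:
  assumes cf: "config n X Y" and \<alpha>\<beta>: "\<alpha> \<in> X" "\<beta> \<in> X" "\<alpha> \<noteq> \<beta>"
  shows "\<exists>y\<in>{a..b}. (y - \<alpha>) * (y - \<beta>) < 0 \<and> weighted_norm X Y / (4 * (b - a)\<^sup>2 * mass) \<le>
     nodal_weight (X - {\<alpha>, \<beta>}) Y y * (- ((y - \<alpha>) * (y - \<beta>)))"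
proof -
  let ?Z = "X - {\<alpha>, \<beta>}"
  have fin: "finite X" "card X = n" "n \<ge> 1" using cf by (auto simp: config_def)
  have X: "nodal X x = (x - \<alpha>) * ((x - \<beta>) * nodal ?Z x)" for x
    using poly_root_poly_remove2[of X \<alpha> \<beta>] poly_root_poly_remove[of X \<alpha>] fin \<alpha>\<beta> by simp
  let ?c = "\<lambda>x. nodal_weight ?Z Y x" and ?e = "\<lambda>x. (x - \<alpha>) * (x - \<beta>)"
  have N: "weighted_norm X Y = (\<integral>x. (?e x)\<^sup>2 * ?c x \<partial>\<mu>)"
    unfolding weighted_norm_def X by (simp add: power_mult_distrib mult_ac)
  have "degree (root_poly ?Z) < n"
    using fin \<alpha>\<beta> by (simp add: card_Diff_subset)
  from config_orth[OF cf this] have z: "(\<integral>x. ?e x * ?c x \<partial>\<mu>) = 0"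
    by (simp add: X power2_eq_square mult_ac)
  have "\<exists>y\<in>{a..b}. ?e y < 0 \<and> (\<integral>x. (?e x)\<^sup>2 * ?c x \<partial>\<mu>) / (4 * (b - a)\<^sup>2 * mass) \<le> ?c y * (- ?e y)"
  proof (rule orthogonality_forces_large_value)
    fix x assume x: "x \<in> {a..b}"
    show "\<bar>?e x\<bar> \<le> (b - a)\<^sup>2"
      using config_node_bound[OF cf \<alpha>\<beta>(1) x] config_node_bound[OF cf \<alpha>\<beta>(2) x]
      by (simp add: abs_mult power2_eq_square mult_mono)
  qed (use ab z weighted_norm_pos[OF cf] N in \<open>auto intro!: continuous_intros simp: mult_ac\<close>)
  then show ?thesis unfolding N .
qed

text \<open>Here the test polynomial is p / (x - \<alpha>), and the sign \<sigma> selects the side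
  of \<alpha> on which \<open>e\<close> is negative. This serves zeros that have no neighbour on
  that side.\<close>

lemma side_large_value:
  assumes cf: "config n X Y" and \<alpha>: "\<alpha> \<in> X" and \<sigma>: "\<sigma> = 1 \<or> \<sigma> = (- 1 :: real)"
  shows "\<exists>y\<in>{a..b}. 0 < \<sigma> * (y - \<alpha>) \<and> weighted_norm X Y / (4 * (b - a) * mass) \<le>
     nodal_weight (X - {\<alpha>}) Y y * (\<sigma> * (y - \<alpha>))"
proof -
  let ?Z = "X - {\<alpha>}"
  have fin: "finite X" "card X = n" "n \<ge> 1" using cf by (auto simp: config_def)
  have X: "nodal X x = (x - \<alpha>) * nodal ?Z x" for x
    using poly_root_poly_remove[of X \<alpha>] fin \<alpha> by simp
  let ?c = "\<lambda>x. nodal_weight ?Z Y x" and ?e = "\<lambda>x. - \<sigma> * (x - \<alpha>)"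
  have \<sigma>2: "\<sigma>\<^sup>2 = 1" using \<sigma> by auto
  have N: "weighted_norm X Y = (\<integral>x. (?e x)\<^sup>2 * ?c x \<partial>\<mu>)"
    unfolding weighted_norm_def X by (simp add: power_mult_distrib mult_ac \<sigma>2)
  have "degree (root_poly ?Z) < n" using fin \<alpha> by simp
  from config_orth[OF cf this] have z: "(\<integral>x. (x - \<alpha>) * ?c x \<partial>\<mu>) = 0"
    by (simp add: X power2_eq_square mult_ac)
  have "(\<integral>x. ?e x * ?c x \<partial>\<mu>) = - \<sigma> * (\<integral>x. (x - \<alpha>) * ?c x \<partial>\<mu>)"
    by (subst integral_mult_right_zero[symmetric]) (simp add: mult_ac)
  with z have z': "(\<integral>x. ?e x * ?c x \<partial>\<mu>) = 0" by simp
  have "\<exists>y\<in>{a..b}. ?e y < 0 \<and> (\<integral>x. (?e x)\<^sup>2 * ?c x \<partial>\<mu>) / (4 * (b - a) * mass) \<le> ?c y * (- ?e y)"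
  proof (rule orthogonality_forces_large_value)
    fix x assume x: "x \<in> {a..b}"
    show "\<bar>?e x\<bar> \<le> b - a"
      using config_node_bound[OF cf \<alpha> x] \<sigma> by auto
  qed (use ab z' weighted_norm_pos[OF cf] N in \<open>auto intro!: continuous_intros\<close>)
  then show ?thesis unfolding N by simp
qed

text \<open>The case \<alpha> = \<beta> is included and strips a single zero; the integral then
  keeps a surplus factor (x - \<alpha>)^2, which \<open>K\<close> absorbs. The weight has degree at
  most 3n, hence the rate \<epsilon>/3.\<close>

lemma config_regularity:
  assumes "\<epsilon> > 0"
  shows "\<exists>C>0. \<forall>n X Y. config n X Y \<longrightarrow> (\<forall>\<alpha>\<in>X. \<forall>\<beta>\<in>X. \<forall>x\<in>{a..b}.
     nodal_weight (X - {\<alpha>, \<beta>}) Y x \<le> C * exp (\<epsilon> * real n) * weighted_norm X Y)"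
proof -
  obtain C where C: "C > 0" and reg: "\<And>m q \<alpha> \<beta> x. m \<ge> 1 \<Longrightarrow> degree q \<le> m \<Longrightarrow> x \<in> {a..b} \<Longrightarrow>
     \<bar>poly q x\<bar> \<le> C * exp (\<epsilon> / 3 * real m) * (\<integral>x. \<bar>poly q x\<bar> * ((x - \<alpha>)\<^sup>2 * (x - \<beta>)\<^sup>2) \<partial>\<mu>)"
    using polynomial_regularity[of "\<epsilon> / 3"] assms by auto
  define K where "K = 1 + (b - a)\<^sup>2"
  have K: "K \<ge> 1" by (simp add: K_def)
  have "nodal_weight (X - {\<alpha>, \<beta>}) Y x \<le> C * K * exp (\<epsilon> * real n) * weighted_norm X Y"
    if cf: "config n X Y" and \<alpha>: "\<alpha> \<in> X" and \<beta>: "\<beta> \<in> X" and x: "x \<in> {a..b}" for n X Y \<alpha> \<beta> x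
  proof -
    have fin: "finite X" "card X = n" "card Y = n" "n \<ge> 1" using cf by (auto simp: config_def)
    let ?Z = "X - {\<alpha>, \<beta>}"
    define q where "q = (root_poly ?Z)\<^sup>2 * root_poly Y"
    have qa: "\<bar>poly q x\<bar> = nodal_weight ?Z Y x" for x
      by (simp add: q_def abs_mult)
    have "card ?Z \<le> n" using fin by (metis card_mono Diff_subset)
    then have "degree q \<le> 3 * n"
      unfolding q_def using fin by (intro order.trans[OF degree_mult_le]) (simp add: degree_power_eq)
    then have "\<bar>poly q x\<bar> \<le> C * exp (\<epsilon> / 3 * real (3 * n)) * (\<integral>x. \<bar>poly q x\<bar> * ((x - \<alpha>)\<^sup>2 * (x - \<beta>)\<^sup>2) \<partial>\<mu>)"
      using fin x by (intro reg) auto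
    also have "(\<integral>x. \<bar>poly q x\<bar> * ((x - \<alpha>)\<^sup>2 * (x - \<beta>)\<^sup>2) \<partial>\<mu>) \<le>
        (\<integral>x. K * (nodal_weight X Y x) \<partial>\<mu>)"
    proof (intro integral_mono_ab integrable_cont continuous_intros)
      fix x assume x: "x \<in> {a..b}"
      let ?w = "nodal_weight X Y x"
      have w: "?w \<ge> 0" by simp
      have Xa: "nodal X x = (x - \<alpha>) * nodal (X - {\<alpha>}) x"
        using fin \<alpha> by (simp add: poly_root_poly_remove)
      show "\<bar>poly q x\<bar> * ((x - \<alpha>)\<^sup>2 * (x - \<beta>)\<^sup>2) \<le> K * ?w"
      proof (cases "\<alpha> = \<beta>")
        case True
        have "\<bar>poly q x\<bar> * ((x - \<alpha>)\<^sup>2 * (x - \<beta>)\<^sup>2) = (x - \<alpha>)\<^sup>2 * ?w"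
          unfolding qa Xa True by (simp add: power_mult_distrib mult_ac)
        also have "\<dots> \<le> K * ?w"
        proof (rule mult_right_mono[OF _ w])
          have "(x - \<alpha>)\<^sup>2 \<le> (b - a)\<^sup>2"
            using config_node_bound[OF cf \<alpha> x] ab by (intro abs_le_square_iff[THEN iffD1]) auto
          then show "(x - \<alpha>)\<^sup>2 \<le> K" by (simp add: K_def)
        qed
        finally show ?thesis .
      next
        case False
        have "nodal (X - {\<alpha>}) x = (x - \<beta>) * nodal ?Z x"
          using poly_root_poly_remove2 fin \<alpha> \<beta> False by blast
        then have "\<bar>poly q x\<bar> * ((x - \<alpha>)\<^sup>2 * (x - \<beta>)\<^sup>2) = ?w"
          unfolding qa Xa by (simp add: power_mult_distrib mult_ac)
        then show ?thesis using mult_right_mono[OF K w] by simp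
      qed
    qed
    also have "\<dots> = K * weighted_norm X Y" unfolding weighted_norm_def by simp
    finally show ?thesis using C unfolding qa by (simp add: mult_ac mult_left_mono)
  qed
  moreover have "C * K > 0" using C K by simp
  ultimately show ?thesis by blast
qed

text \<open>Let u and v be the distances of y to \<alpha> and to the next zero \<beta>, and D the
  weight without both zeros. Orthogonality bounds D u v from below, whereas D v^2 is wanted, and y
  might be too close to \<beta>. This is excluded by the upper bound on D from
  \<open>config_regularity\<close>: it forces v to be at least of order exp (-\<epsilon> n / 2).
  Since u and v are bounded, D itself is at least of the order of the norm, so D v^2 loses only exp
  (-\<epsilon> n).\<close>

lemma neighbour_large_value:
  assumes "\<epsilon> > 0"
  shows "\<exists>c>0. \<forall>n X Y \<alpha> \<sigma>. config n X Y \<longrightarrow> \<alpha> \<in> X \<longrightarrow> (\<sigma> = 1 \<or> \<sigma> = - 1) \<longrightarrow>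
     (\<exists>y\<in>{a..b}. 0 < \<sigma> * (y - \<alpha>) \<and> (\<forall>z\<in>X - {\<alpha>}. \<sigma> * z < \<sigma> * \<alpha> \<or> \<sigma> * y < \<sigma> * z) \<and>
       c * exp (- \<epsilon> * real n) * weighted_norm X Y \<le> nodal_weight (X - {\<alpha>}) Y y)"
proof -
  define L where "L = b - a"
  have L: "L > 0" using ab by (simp add: L_def)
  obtain C where C: "C > 0" and reg: "\<And>n X Y \<alpha> \<beta> x. config n X Y \<Longrightarrow> \<alpha> \<in> X \<Longrightarrow> \<beta> \<in> X \<Longrightarrow> x \<in> {a..b} \<Longrightarrow>
     nodal_weight (X - {\<alpha>, \<beta>}) Y x \<le> C * exp (\<epsilon> / 2 * real n) * weighted_norm X Y"
    using config_regularity[of "\<epsilon> / 2"] assms by auto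
  define c1 where "c1 = 1 / (4 * L * mass)"
  define c2 where "c2 = 1 / (4 * L\<^sup>2 * mass)"
  have c1: "c1 > 0" and c2: "c2 > 0" using L mass_pos by (auto simp: c1_def c2_def)
  define c where "c = min (c1 / L) (c2 / L\<^sup>2 * (c2 / (C * L))\<^sup>2)"
  have c: "c > 0" using c1 c2 C L by (simp add: c_def)
  have "\<exists>y\<in>{a..b}. 0 < \<sigma> * (y - \<alpha>) \<and> (\<forall>z\<in>X - {\<alpha>}. \<sigma> * z < \<sigma> * \<alpha> \<or> \<sigma> * y < \<sigma> * z) \<and>
       c * exp (- \<epsilon> * real n) * weighted_norm X Y \<le> nodal_weight (X - {\<alpha>}) Y y"
    if cf: "config n X Y" and \<alpha>: "\<alpha> \<in> X" and \<sigma>: "\<sigma> = 1 \<or> \<sigma> = (- 1 :: real)" for n X Y \<alpha> \<sigma>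
  proof -
    have fin: "finite X" using cf by (auto simp: config_def)
    define N where "N = weighted_norm X Y"
    have N: "N > 0" using weighted_norm_pos[OF cf] by (simp add: N_def)
    have e1: "exp (- \<epsilon> * real n) \<le> 1" using assms by simp
    define R where "R = {x\<in>X. 0 < \<sigma> * (x - \<alpha>)}"
    have bd: "\<bar>y - z\<bar> \<le> L" if "y \<in> {a..b}" "z \<in> X" for y z
      using config_node_bound[OF cf that(2,1)] by (simp add: L_def)
    show ?thesis
    proof (cases "R = {}")
      case True
      obtain y where y: "y \<in> {a..b}" "0 < \<sigma> * (y - \<alpha>)" and
        ge: "N / (4 * (b - a) * mass) \<le> nodal_weight (X - {\<alpha>}) Y y * (\<sigma> * (y - \<alpha>))"
        using side_large_value[OF cf \<alpha> \<sigma>] by (auto simp: N_def)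
      let ?F = "nodal_weight (X - {\<alpha>}) Y y"
      have "c1 * N \<le> ?F * (\<sigma> * (y - \<alpha>))" using ge by (simp add: c1_def L_def)
      also have "\<dots> \<le> ?F * L" using bd[OF y(1) \<alpha>] \<sigma> by (intro mult_left_mono) auto
      finally have "c1 / L * N \<le> ?F" using L by (simp add: field_simps)
      moreover have "c * exp (- \<epsilon> * real n) * N \<le> c1 / L * 1 * N"
        using e1 c N by (intro mult_right_mono mult_mono) (auto simp: c_def)
      ultimately have "c * exp (- \<epsilon> * real n) * N \<le> ?F" by simp
      moreover have "\<forall>z\<in>X - {\<alpha>}. \<sigma> * z < \<sigma> * \<alpha> \<or> \<sigma> * y < \<sigma> * z"
        using True \<sigma> unfolding R_def by force
      ultimately show ?thesis using y unfolding N_def by blast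
    next
      case False
      have finR: "finite R" using fin by (simp add: R_def)
      define \<beta> where "\<beta> = arg_min_on (\<lambda>x. \<sigma> * x) R"
      have \<beta>R: "\<beta> \<in> R" unfolding \<beta>_def using finR False by (rule arg_min_if_finite)
      have \<beta>min: "\<sigma> * \<beta> \<le> \<sigma> * x" if "x \<in> R" for x
        unfolding \<beta>_def by (rule arg_min_least[OF finR False that])
      have \<beta>: "\<beta> \<in> X" "0 < \<sigma> * (\<beta> - \<alpha>)" using \<beta>R by (auto simp: R_def)
      then have ne: "\<alpha> \<noteq> \<beta>" by auto
      obtain y where y: "y \<in> {a..b}" "(y - \<alpha>) * (y - \<beta>) < 0" and
        ge: "N / (4 * (b - a)\<^sup>2 * mass) \<le>
          nodal_weight (X - {\<alpha>, \<beta>}) Y y * (- ((y - \<alpha>) * (y - \<beta>)))"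
        using gap_large_value[OF cf \<alpha> \<beta>(1) ne] by (auto simp: N_def)
      let ?D = "nodal_weight (X - {\<alpha>, \<beta>}) Y y"
      let ?F = "nodal_weight (X - {\<alpha>}) Y y"
      define u where "u = \<bar>y - \<alpha>\<bar>"
      define v where "v = \<bar>y - \<beta>\<bar>"
      have uv: "- ((y - \<alpha>) * (y - \<beta>)) = u * v"
        unfolding u_def v_def abs_mult[symmetric] using y(2) by simp
      have u: "0 < u" "u \<le> L" and v: "0 < v" "v \<le> L"
        using y(2) bd[OF y(1) \<alpha>] bd[OF y(1) \<beta>(1)] by (auto simp: u_def v_def)
      have ge': "c2 * N \<le> ?D * (u * v)" using ge unfolding uv by (simp add: c2_def L_def)
      have D0: "?D \<ge> 0" by simp
      have "c2 * N \<le> ?D * (L * L)"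
        using ge' mult_left_mono[OF mult_mono[OF u(2) v(2)] D0] L u v by linarith
      then have D1: "c2 / L\<^sup>2 * N \<le> ?D" using L by (simp add: field_simps power2_eq_square)
      have "c2 * N \<le> (C * exp (\<epsilon> / 2 * real n) * N) * (L * v)"
      proof (rule order.trans[OF ge'])
        show "?D * (u * v) \<le> (C * exp (\<epsilon> / 2 * real n) * N) * (L * v)"
          unfolding N_def by (rule mult_mono[OF reg[OF cf \<alpha> \<beta>(1) y(1)]])
            (use u v C N in \<open>auto simp: N_def intro!: mult_right_mono mult_nonneg_nonneg\<close>)
      qed
      then have "c2 \<le> C * exp (\<epsilon> / 2 * real n) * (L * v)" using N by simp
      then have v1: "c2 / (C * L) * exp (- (\<epsilon> / 2 * real n)) \<le> v"
        using C L by (simp add: exp_minus field_simps)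
      have "(c2 / (C * L) * exp (- (\<epsilon> / 2 * real n)))\<^sup>2 \<le> v\<^sup>2"
        using v1 c2 C L by (intro power_mono) auto
      moreover have "(exp (- (\<epsilon> / 2 * real n)))\<^sup>2 = exp (- \<epsilon> * real n)"
        by (simp add: power2_eq_square exp_add[symmetric])
      ultimately have v2: "(c2 / (C * L))\<^sup>2 * exp (- \<epsilon> * real n) \<le> v\<^sup>2" by (simp only: power_mult_distrib)
      have F: "?F = ?D * v\<^sup>2"
      proof -
        have "nodal (X - {\<alpha>}) y = (y - \<beta>) * nodal (X - {\<alpha>, \<beta>}) y"
          using poly_root_poly_remove2[of X \<alpha> \<beta> y] fin \<alpha> \<beta> ne by simp
        then show ?thesis by (simp add: v_def power_mult_distrib mult_ac)
      qed
      have "c * exp (- \<epsilon> * real n) * N \<le> (c2 / L\<^sup>2 * (c2 / (C * L))\<^sup>2) * exp (- \<epsilon> * real n) * N"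
        using N by (intro mult_right_mono) (auto simp: c_def)
      also have "\<dots> = (c2 / L\<^sup>2 * N) * ((c2 / (C * L))\<^sup>2 * exp (- \<epsilon> * real n))" by simp
      also have "\<dots> \<le> ?D * v\<^sup>2" by (intro mult_mono D1 v2) auto
      finally have "c * exp (- \<epsilon> * real n) * N \<le> ?F" unfolding F .
      moreover have "0 < \<sigma> * (y - \<alpha>)" and y\<beta>: "\<sigma> * y < \<sigma> * \<beta>"
        using y(2) \<beta>(2) \<sigma> by (auto simp: mult_less_0_iff)
      moreover have "\<forall>z\<in>X - {\<alpha>}. \<sigma> * z < \<sigma> * \<alpha> \<or> \<sigma> * y < \<sigma> * z"
      proof
        fix z assume z: "z \<in> X - {\<alpha>}"
        show "\<sigma> * z < \<sigma> * \<alpha> \<or> \<sigma> * y < \<sigma> * z"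
        proof (cases "z \<in> R")
          case True
          then show ?thesis using \<beta>min[of z] y\<beta> by auto
        next
          case False
          then show ?thesis using z \<sigma> by (auto simp: R_def)
        qed
      qed
      ultimately show ?thesis using y unfolding N_def by blast
    qed
  qed
  then show ?thesis using c by blast
qed

text \<open>The quantity bounded from below is \<open>p\<^sub>X'(\<alpha>)\<^sup>2 \<bar>p\<^sub>Y(\<alpha>)\<bar>\<close>.\<close>

lemma derivative_lower_bound:
  assumes "\<epsilon> > 0"
  shows "\<exists>c>0. \<forall>n X Y. config n X Y \<longrightarrow> (\<forall>\<alpha>\<in>X. c * exp (- \<epsilon> * real n) * weighted_norm X Y \<le>
     (nodal (X - {\<alpha>}) \<alpha>)\<^sup>2 * \<bar>nodal Y \<alpha>\<bar>)"
proof -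
  obtain c where c: "c > 0" and nb: "\<And>n X Y \<alpha> \<sigma>. config n X Y \<Longrightarrow> \<alpha> \<in> X \<Longrightarrow> (\<sigma> = 1 \<or> \<sigma> = - 1) \<Longrightarrow>
     (\<exists>y\<in>{a..b}. 0 < \<sigma> * (y - \<alpha>) \<and> (\<forall>z\<in>X - {\<alpha>}. \<sigma> * z < \<sigma> * \<alpha> \<or> \<sigma> * y < \<sigma> * z) \<and>
       c * exp (- \<epsilon> * real n) * weighted_norm X Y \<le> nodal_weight (X - {\<alpha>}) Y y)"
    using neighbour_large_value[OF assms] by blast
  have "c * exp (- \<epsilon> * real n) * weighted_norm X Y \<le> (nodal (X - {\<alpha>}) \<alpha>)\<^sup>2 * \<bar>nodal Y \<alpha>\<bar>"
    if cf: "config n X Y" and \<alpha>: "\<alpha> \<in> X" for n X Y \<alpha>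
  proof -
    let ?N = "c * exp (- \<epsilon> * real n) * weighted_norm X Y"
    obtain y' where y': "y' \<in> {a..b}" "\<alpha> < y'" "\<forall>z\<in>X - {\<alpha>}. z < \<alpha> \<or> y' < z"
      "?N \<le> nodal_weight (X - {\<alpha>}) Y y'"
      using nb[OF cf \<alpha>, of 1] by auto
    obtain y where y: "y \<in> {a..b}" "y < \<alpha>" "\<forall>z\<in>X - {\<alpha>}. z < y \<or> \<alpha> < z"
      "?N \<le> nodal_weight (X - {\<alpha>}) Y y"
    proof -
      obtain y where "y \<in> {a..b}" "0 < - 1 * (y - \<alpha>)" "\<forall>z\<in>X - {\<alpha>}. - 1 * z < - 1 * \<alpha> \<or> - 1 * y < - 1 * z"
        "?N \<le> nodal_weight (X - {\<alpha>}) Y y"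
        using nb[OF cf \<alpha>, of "- 1"] by blast
      then show thesis by (intro that[of y]) auto
    qed
    have fin: "finite X" "finite Y" and side: "(\<forall>y\<in>Y. b < y) \<or> (\<forall>y\<in>Y. y < a)"
      using cf by (auto simp: config_def)
    define M where "M = mset_set (X - {\<alpha>}) + mset_set (X - {\<alpha>}) + mset_set Y"
    have eq: "(\<Prod>z\<in>#M. \<bar>x - z\<bar>) = nodal_weight (X - {\<alpha>}) Y x" for x
    proof -
      have "(\<Prod>z\<in>#M. \<bar>x - z\<bar>) = \<bar>nodal (X - {\<alpha>}) x\<bar> * \<bar>nodal (X - {\<alpha>}) x\<bar> * \<bar>nodal Y x\<bar>"
        unfolding M_def by (simp add: poly_root_poly abs_prod flip: prod_unfold_prod_mset)
      then show ?thesis by (simp add: power2_eq_square flip: abs_mult)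
    qed
    \<comment> \<open>Between y and y' the weight without \<alpha> has no zeros, so log-concavity
      carries its lower bounds at y and y' over to \<alpha>.\<close>
    have "min (\<Prod>z\<in>#M. \<bar>y - z\<bar>) (\<Prod>z\<in>#M. \<bar>y' - z\<bar>) \<le> (\<Prod>z\<in>#M. \<bar>\<alpha> - z\<bar>)"
    proof (rule prod_abs_log_concave)
      fix z assume "z \<in># M"
      then have "z \<in> X - {\<alpha>} \<or> z \<in> Y" using fin by (auto simp: M_def)
      then show "z < y \<or> y' < z"
      proof
        assume "z \<in> X - {\<alpha>}"
        then have "z < y \<or> \<alpha> < z" "z < \<alpha> \<or> y' < z" using y(3) y'(3) by blast+
        then show ?thesis by linarith
      next
        assume "z \<in> Y"
        then have "b < z \<or> z < a" using side by blast
        then show ?thesis using y(1) y'(1) by auto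
      qed
    qed (use y y' in auto)
    then show ?thesis using y y' unfolding eq by linarith
  qed
  then show ?thesis using c by blast
qed

end

section \<open>Energy comparison with the reflected configuration\<close>

text \<open>This is ln |s + i \<eta>|^2, twice the logarithm with one point lifted to height \<eta>.
  Because of the factor 2, ln (p^2 |q|) turns into weight 1 on the zeros of p and 1/2 on those of
  q.\<close>

definition smooth_log :: "real \<Rightarrow> real \<Rightarrow> real" where
  "smooth_log \<eta> s = ln (s\<^sup>2 + \<eta>\<^sup>2)"

text \<open>The sign is opposite to that of the usual energy: the form is nonpositive on neutral
  charges. Each diagonal pair contributes ln (\<eta>^2).\<close>

definition mutual_energy :: "real \<Rightarrow> real set \<Rightarrow> real set \<Rightarrow> real" where
  "mutual_energy \<eta> A B = (\<Sum>x\<in>A. \<Sum>y\<in>B. smooth_log \<eta> (x - y))"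

lemma smooth_log_minus: "smooth_log \<eta> (x - y) = smooth_log \<eta> (y - x)"
  by (simp add: smooth_log_def power2_commute)

lemma mutual_energy_commute: "mutual_energy \<eta> A B = mutual_energy \<eta> B A"
  unfolding mutual_energy_def by (subst sum.swap) (simp add: smooth_log_minus)

lemma mutual_energy_reflect:
  "mutual_energy \<eta> ((\<lambda>x. c - x) ` A) B = mutual_energy \<eta> A ((\<lambda>x. c - x) ` B)"
proof -
  have inj: "inj_on (\<lambda>x. c - x) A" for A :: "real set" by (auto simp: inj_on_def)
  have "smooth_log \<eta> (c - x - y) = smooth_log \<eta> (x - (c - y))" for x y
    using smooth_log_minus[of \<eta> "c - y" x] by (simp add: algebra_simps)
  then show ?thesis unfolding mutual_energy_def by (simp add: sum.reindex[OF inj])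
qed

lemma reflect_reflect: "(\<lambda>x. c - x) ` (\<lambda>x. c - x) ` A = (A :: real set)"
  by (auto simp: image_image)

text \<open>Charge \<open>c k\<close> sits on each point of \<open>A k\<close>. Indexing by
  \<open>Sigma\<close> keeps points apart that belong to several of the sets, so these may
  overlap.\<close>

lemma mutual_energy_neg_def:
  fixes A :: "nat \<Rightarrow> real set" and c :: "nat \<Rightarrow> real"
  assumes "\<eta> > 0" "\<And>k. k < m \<Longrightarrow> finite (A k)" "(\<Sum>k<m. c k * real (card (A k))) = 0"
  shows "(\<Sum>k<m. \<Sum>l<m. c k * c l * mutual_energy \<eta> (A k) (A l)) \<le> 0"
proof -
  let ?I = "Sigma {..<m} A"
  have fin: "finite (A k)" if "k \<in> {..<m}" for k using assms that by auto
  have S: "(\<Sum>i\<in>?I. f i) = (\<Sum>k<m. \<Sum>x\<in>A k. f (k, x))" for f :: "nat \<times> real \<Rightarrow> real"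
    using sum.Sigma[of "{..<m}" A "\<lambda>k x. f (k, x)"] fin by (simp add: case_prod_unfold)
  have "(\<Sum>i\<in>?I. c (fst i)) = 0" using assms(3) by (simp add: S mult.commute)
  then have "(\<Sum>i\<in>?I. \<Sum>j\<in>?I. c (fst i) * c (fst j) * ln ((snd i - snd j)\<^sup>2 + \<eta>\<^sup>2)) \<le> 0"
    using assms(1) by (intro log_kernel_neg_def) auto
  also have "(\<Sum>i\<in>?I. \<Sum>j\<in>?I. c (fst i) * c (fst j) * ln ((snd i - snd j)\<^sup>2 + \<eta>\<^sup>2)) =
      (\<Sum>k<m. \<Sum>l<m. c k * c l * mutual_energy \<eta> (A k) (A l))"
    unfolding S mutual_energy_def smooth_log_def
    by (simp add: sum_distrib_left) (rule sum.cong[OF refl], rule sum.swap)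
  finally show ?thesis .
qed

lemma abs_poly_root_poly: "\<bar>nodal X x\<bar> = (\<Prod>z\<in>X. \<bar>x - z\<bar>)"
  by (simp add: poly_root_poly abs_prod)

lemma ln_abs_poly_root_poly:
  assumes "finite X" "x \<notin> X"
  shows "ln \<bar>nodal X x\<bar> = (\<Sum>z\<in>X. ln \<bar>x - z\<bar>)"
  unfolding abs_poly_root_poly using assms by (subst ln_prod) auto

lemma poly_root_poly_reflect:
  assumes "finite Y"
  shows "\<bar>nodal ((\<lambda>x. c - x) ` Y) z\<bar> = \<bar>nodal Y (c - z)\<bar>"
proof -
  have inj: "inj_on (\<lambda>x. c - x) Y" by (auto simp: inj_on_def)
  have "\<bar>z - (c - y)\<bar> = \<bar>c - z - y\<bar>" for y by (simp add: abs_minus_commute algebra_simps)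
  then show ?thesis unfolding abs_poly_root_poly by (simp add: prod.reindex[OF inj])
qed

lemma ln_le_smooth_log: "s \<noteq> 0 \<Longrightarrow> 2 * ln \<bar>s\<bar> \<le> smooth_log \<eta> s"
proof -
  assume "s \<noteq> 0"
  then have "2 * ln \<bar>s\<bar> = ln (s\<^sup>2)" using ln_realpow[of "\<bar>s\<bar>" 2] by simp
  also have "\<dots> \<le> ln (s\<^sup>2 + \<eta>\<^sup>2)"
    using \<open>s \<noteq> 0\<close> by (intro ln_mono) auto
  finally show ?thesis by (simp add: smooth_log_def)
qed

lemma smooth_log_le:
  assumes "g > 0" "g \<le> \<bar>s\<bar>"
  shows "smooth_log \<eta> s \<le> 2 * ln \<bar>s\<bar> + \<eta>\<^sup>2 / g\<^sup>2"
proof -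
  have s: "s \<noteq> 0" using assms by auto
  have gs: "g\<^sup>2 \<le> s\<^sup>2" using assms by (intro abs_le_square_iff[THEN iffD1]) auto
  have "s\<^sup>2 + \<eta>\<^sup>2 = s\<^sup>2 * (1 + \<eta>\<^sup>2 / s\<^sup>2)" using s by (simp add: field_simps)
  then have "smooth_log \<eta> s = ln (s\<^sup>2) + ln (1 + \<eta>\<^sup>2 / s\<^sup>2)"
    unfolding smooth_log_def using s by (simp add: ln_mult_pos add_pos_nonneg)
  also have "ln (s\<^sup>2) = 2 * ln \<bar>s\<bar>" using s ln_realpow[of "\<bar>s\<bar>" 2] by simp
  also have "ln (1 + \<eta>\<^sup>2 / s\<^sup>2) \<le> \<eta>\<^sup>2 / s\<^sup>2" by (rule ln_add_one_self_le_self) simp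
  also have "\<eta>\<^sup>2 / s\<^sup>2 \<le> \<eta>\<^sup>2 / g\<^sup>2" using gs assms by (intro divide_left_mono) (auto simp: s)
  finally show ?thesis by simp
qed

context reg_measure
begin

lemma config_sup_bound:
  assumes "\<epsilon> > 0"
  shows "\<exists>C>0. \<forall>n X Y. config n X Y \<longrightarrow> (\<forall>x\<in>{a..b}.
     nodal_weight X Y x \<le> C * exp (\<epsilon> * real n) * weighted_norm X Y)"
proof -
  obtain C where C: "C > 0" and reg: "\<And>n X Y \<alpha> \<beta> x. config n X Y \<Longrightarrow> \<alpha> \<in> X \<Longrightarrow> \<beta> \<in> X \<Longrightarrow> x \<in> {a..b} \<Longrightarrow>
     nodal_weight (X - {\<alpha>, \<beta>}) Y x \<le> C * exp (\<epsilon> * real n) * weighted_norm X Y"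
    using config_regularity[OF assms] by auto
  have "nodal_weight X Y x \<le> ((b - a)\<^sup>2 * C) * exp (\<epsilon> * real n) * weighted_norm X Y"
    if cf: "config n X Y" and x: "x \<in> {a..b}" for n X Y x
  proof -
    have fin: "finite X" "card X = n" "n \<ge> 1" using cf by (auto simp: config_def)
    then obtain \<alpha> where \<alpha>: "\<alpha> \<in> X" by fastforce
    have "nodal_weight X Y x =
        (x - \<alpha>)\<^sup>2 * (nodal_weight (X - {\<alpha>, \<alpha>}) Y x)"
      using poly_root_poly_remove[OF fin(1) \<alpha>, of x] by (simp add: power_mult_distrib)
    also have "\<dots> \<le> (b - a)\<^sup>2 * (C * exp (\<epsilon> * real n) * weighted_norm X Y)"
    proof (rule mult_mono[OF _ reg[OF cf \<alpha> \<alpha> x]])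
      show "(x - \<alpha>)\<^sup>2 \<le> (b - a)\<^sup>2"
        using config_node_bound[OF cf \<alpha> x] ab by (intro abs_le_square_iff[THEN iffD1]) auto
    qed auto
    finally show ?thesis by (simp add: mult_ac)
  qed
  moreover have "(b - a)\<^sup>2 * C > 0" using C ab by simp
  ultimately show ?thesis by blast
qed

text \<open>The left side is the logarithm of |p^2 q| at x + i \<eta>, so
  \<open>config_sup_bound\<close> is transported by the Bernstein-Walsh inequality; the 3 comes from
  the degree 3n.\<close>

lemma smooth_upper_bound:
  assumes "\<epsilon> > 0"
  shows "\<exists>C. \<forall>\<eta>>0. \<forall>n X Y. config n X Y \<longrightarrow> (\<forall>x\<in>{a..b}.
     (\<Sum>z\<in>X. smooth_log \<eta> (x - z)) + (\<Sum>z\<in>Y. smooth_log \<eta> (x - z)) / 2 \<le>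
     ln (weighted_norm X Y) + C + (\<epsilon> + 3 * ln (joukowski_growth (2 * \<eta> / (b - a)))) * real n)"
proof -
  obtain C where C: "C > 0" and sup: "\<And>n X Y x. config n X Y \<Longrightarrow> x \<in> {a..b} \<Longrightarrow>
     nodal_weight X Y x \<le> C * exp (\<epsilon> * real n) * weighted_norm X Y"
    using config_sup_bound[OF assms] by auto
  have "(\<Sum>z\<in>X. smooth_log \<eta> (x - z)) + (\<Sum>z\<in>Y. smooth_log \<eta> (x - z)) / 2 \<le>
     ln (weighted_norm X Y) + ln C + (\<epsilon> + 3 * ln (joukowski_growth (2 * \<eta> / (b - a)))) * real n"
    if \<eta>: "\<eta> > 0" and cf: "config n X Y" and x: "x \<in> {a..b}" for \<eta> n X Y x
  proof -
    have fin: "finite X" "card X = n" "finite Y" "card Y = n" using cf by (auto simp: config_def)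
    define N where "N = weighted_norm X Y"
    have N: "N > 0" using weighted_norm_pos[OF cf] by (simp add: N_def)
    define J where "J = joukowski_growth (2 * \<eta> / (b - a))"
    have J: "J \<ge> 1" unfolding J_def using \<eta> ab by (intro joukowski_growth_ge_1) simp
    have nC: "norm (Complex x \<eta> - of_real z) ^ 2 = (x - z)\<^sup>2 + \<eta>\<^sup>2" for z
      by (simp add: cmod_power2)
    have pos: "(x - z)\<^sup>2 + \<eta>\<^sup>2 > 0" for z using \<eta> by (simp add: add_nonneg_pos)
    have sq: "norm (Complex x \<eta> - of_real z) = sqrt ((x - z)\<^sup>2 + \<eta>\<^sup>2)" for z
      using nC[of z] by (metis norm_ge_zero real_sqrt_unique)
    have "norm ((\<Prod>r\<in>X. Complex x \<eta> - of_real r)\<^sup>2 * (\<Prod>r\<in>Y. Complex x \<eta> - of_real r)) \<le>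
        (C * exp (\<epsilon> * real n) * N) * J ^ (2 * card X + card Y)"
      unfolding J_def N_def
      by (rule bernstein_walsh_product[OF ab])
         (use sup[OF cf] x \<eta> in \<open>auto simp: poly_root_poly abs_mult\<close>)
    also have "norm ((\<Prod>r\<in>X. Complex x \<eta> - of_real r)\<^sup>2 * (\<Prod>r\<in>Y. Complex x \<eta> - of_real r)) =
        (\<Prod>z\<in>X. (x - z)\<^sup>2 + \<eta>\<^sup>2) * (\<Prod>z\<in>Y. sqrt ((x - z)\<^sup>2 + \<eta>\<^sup>2))"
      by (simp only: norm_mult norm_power prod_norm[symmetric] prod_power_distrib nC) (simp only: sq)
    finally have "ln ((\<Prod>z\<in>X. (x - z)\<^sup>2 + \<eta>\<^sup>2) * (\<Prod>z\<in>Y. sqrt ((x - z)\<^sup>2 + \<eta>\<^sup>2))) \<le>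
        ln ((C * exp (\<epsilon> * real n) * N) * J ^ (3 * n))"
      using fin by (subst ln_le_cancel_iff) (use pos C N J in \<open>auto intro!: mult_pos_pos prod_pos\<close>)
    moreover have "ln ((\<Prod>z\<in>X. (x - z)\<^sup>2 + \<eta>\<^sup>2) * (\<Prod>z\<in>Y. sqrt ((x - z)\<^sup>2 + \<eta>\<^sup>2))) =
        (\<Sum>z\<in>X. smooth_log \<eta> (x - z)) + (\<Sum>z\<in>Y. smooth_log \<eta> (x - z)) / 2"
    proof -
      have "ln ((\<Prod>z\<in>X. (x - z)\<^sup>2 + \<eta>\<^sup>2) * (\<Prod>z\<in>Y. sqrt ((x - z)\<^sup>2 + \<eta>\<^sup>2))) =
          ln (\<Prod>z\<in>X. (x - z)\<^sup>2 + \<eta>\<^sup>2) + ln (\<Prod>z\<in>Y. sqrt ((x - z)\<^sup>2 + \<eta>\<^sup>2))"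
        by (rule ln_mult_pos) (use pos in \<open>auto intro!: prod_pos\<close>)
      also have "ln (\<Prod>z\<in>X. (x - z)\<^sup>2 + \<eta>\<^sup>2) = (\<Sum>z\<in>X. smooth_log \<eta> (x - z))"
        unfolding smooth_log_def using fin pos \<eta> by (intro ln_prod) auto
      also have "ln (\<Prod>z\<in>Y. sqrt ((x - z)\<^sup>2 + \<eta>\<^sup>2)) = (\<Sum>z\<in>Y. ln (sqrt ((x - z)\<^sup>2 + \<eta>\<^sup>2)))"
        using fin pos \<eta> by (intro ln_prod) auto
      also have "\<dots> = (\<Sum>z\<in>Y. smooth_log \<eta> (x - z)) / 2"
        unfolding sum_divide_distrib smooth_log_def by (intro sum.cong refl ln_sqrt) simp
      finally show ?thesis .
    qed
    moreover have "ln ((C * exp (\<epsilon> * real n) * N) * J ^ (3 * n)) = ln N + ln C + (\<epsilon> + 3 * ln J) * real n"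
      using C N J by (simp add: ln_mult_pos ln_realpow algebra_simps)
    ultimately show ?thesis unfolding N_def J_def by simp
  qed
  then show ?thesis by blast
qed

text \<open>Valid at zeros of p only: smoothing increases all logarithms, and the zero itself
  contributes ln (\<eta>^2) in place of minus infinity. What remains is the logarithm of p'(x)^2
  |q(x)|.\<close>

lemma smooth_lower_bound:
  assumes "\<epsilon> > 0"
  shows "\<exists>C. \<forall>\<eta>>0. \<forall>n X Y. config n X Y \<longrightarrow> (\<forall>x\<in>X.
     ln (weighted_norm X Y) - C + ln (\<eta>\<^sup>2) - \<epsilon> * real n \<le>
     (\<Sum>z\<in>X. smooth_log \<eta> (x - z)) + (\<Sum>z\<in>Y. smooth_log \<eta> (x - z)) / 2)"
proof -
  obtain c where c: "c > 0" and low: "\<And>n X Y x. config n X Y \<Longrightarrow> x \<in> X \<Longrightarrow>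
     c * exp (- \<epsilon> * real n) * weighted_norm X Y \<le> nodal_weight (X - {x}) Y x"
    using derivative_lower_bound[OF assms] by auto
  have "ln (weighted_norm X Y) - (- ln c) + ln (\<eta>\<^sup>2) - \<epsilon> * real n \<le>
     (\<Sum>z\<in>X. smooth_log \<eta> (x - z)) + (\<Sum>z\<in>Y. smooth_log \<eta> (x - z)) / 2"
    if \<eta>: "\<eta> > 0" and cf: "config n X Y" and x: "x \<in> X" for \<eta> n X Y x
  proof -
    have fin: "finite X" "finite Y" using cf by (auto simp: config_def)
    define N where "N = weighted_norm X Y"
    have N: "N > 0" using weighted_norm_pos[OF cf] by (simp add: N_def)
    have xY: "x \<notin> Y" using x cf by (force simp: config_def)
    let ?P = "\<bar>nodal (X - {x}) x\<bar>" and ?Q = "\<bar>nodal Y x\<bar>"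
    have P: "?P > 0" "?Q > 0" using fin xY by (auto simp: poly_root_poly_eq_0)
    have "ln (c * exp (- \<epsilon> * real n) * N) \<le> ln (?P\<^sup>2 * ?Q)"
      using low[OF cf x] c N P by (subst ln_le_cancel_iff) (auto simp: N_def)
    moreover have "ln (c * exp (- \<epsilon> * real n) * N) = ln N + ln c - \<epsilon> * real n"
      using c N by (simp add: ln_mult_pos)
    moreover have "ln (?P\<^sup>2 * ?Q) = (\<Sum>z\<in>X - {x}. 2 * ln \<bar>x - z\<bar>) + (\<Sum>z\<in>Y. 2 * ln \<bar>x - z\<bar>) / 2"
    proof -
      have "ln (?P\<^sup>2 * ?Q) = 2 * ln ?P + ln ?Q" 
        using P ln_mult_pos[of "?P\<^sup>2" ?Q] ln_realpow[of ?P 2] by (simp del: power2_abs)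
      then show ?thesis using fin xY by (simp add: ln_abs_poly_root_poly sum_distrib_left sum_divide_distrib)
    qed
    moreover have "(\<Sum>z\<in>X - {x}. 2 * ln \<bar>x - z\<bar>) \<le> (\<Sum>z\<in>X - {x}. smooth_log \<eta> (x - z))"
      by (intro sum_mono ln_le_smooth_log) auto
    moreover have "(\<Sum>z\<in>Y. 2 * ln \<bar>x - z\<bar>) \<le> (\<Sum>z\<in>Y. smooth_log \<eta> (x - z))"
      using xY by (intro sum_mono ln_le_smooth_log) auto
    moreover have "(\<Sum>z\<in>X. smooth_log \<eta> (x - z)) = ln (\<eta>\<^sup>2) + (\<Sum>z\<in>X - {x}. smooth_log \<eta> (x - z))"
      using fin x by (subst sum.remove[of X x]) (auto simp: smooth_log_def)
    ultimately show ?thesis unfolding N_def by linarith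
  qed
  then show ?thesis by blast
qed

end

text \<open>The order of the intervals is left open so that the locale is closed under interchanging
  the two measures.\<close>

locale equal_pair = m1: reg_measure \<mu>1 a1 b1 + m2: reg_measure \<mu>2 a2 b2
  for \<mu>1 :: "real measure" and a1 b1 :: real and \<mu>2 :: "real measure" and a2 b2 :: real +
  assumes separated: "b1 < a2 \<or> b2 < a1" and same_length: "b1 - a1 = b2 - a2"
begin

definition gap where "gap = max (a2 - b1) (a1 - b2)"
definition width where "width = max (b2 - a1) (b1 - a2)"
definition reflect where "reflect x = (a1 + b2) - x"
definition pair where "pair n X Y \<longleftrightarrow> m1.config n X Y \<and> m2.config n Y X"

lemma gap_pos: "gap > 0" using separated by (auto simp: gap_def)

lemma dist_bounds:
  assumes "x \<in> {a1..b1}" "y \<in> {a2..b2}"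
  shows "gap \<le> \<bar>y - x\<bar>" "\<bar>y - x\<bar> \<le> width"
  using assms separated m1.ab m2.ab by (auto simp: gap_def width_def)

lemma width_pos: "width > 0"
  using dist_bounds[of a1 a2] gap_pos m1.ab m2.ab by auto

lemma reflect_in:
  "x \<in> {a1..b1} \<Longrightarrow> reflect x \<in> {a2..b2}" "x \<in> {a2..b2} \<Longrightarrow> reflect x \<in> {a1..b1}"
  using same_length by (auto simp: reflect_def)

lemma swap: "equal_pair \<mu>2 a2 b2 \<mu>1 a1 b1"
  by unfold_locales (use separated same_length in auto)

text \<open>The value of the form on the neutral charge \<nu> that is +1 on \<open>X\<close> and -1
  on the mirror image of \<open>Y\<close>; it is nonpositive, and near 0 when the two sets almost
  agree.\<close>

abbreviation discrepancy where
  "discrepancy \<eta> X Y \<equiv> mutual_energy \<eta> X X + mutual_energy \<eta> (reflect ` Y) (reflect ` Y) - 2 * mutual_energy \<eta> X (reflect ` Y)"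

text \<open>Summing the lower bounds over \<open>X\<close> and \<open>Y\<close> and subtracting the
  upper bounds summed over their mirror images cancels both norms. In terms of the charge \<nu> of
  \<open>discrepancy\<close>, with E the form at (\<nu>, \<nu>) and E' the form at (\<nu>, reflected
  \<nu>), this says that E - E'/2 is at least minus a small error. The 1/2 is the relative weight of
  |q| against p^2. Definiteness at \<nu> minus its reflection gives E <= E', hence E/2 >= E - E'/2,
  and -E is at most twice the error.\<close>

lemma energy_bound:
  assumes "\<epsilon> > 0"
  shows "\<exists>C. \<forall>\<eta>>0. \<forall>n X Y. pair n X Y \<longrightarrow>
     - discrepancy \<eta> X Y \<le>
     real n * (C - 4 * ln (\<eta>\<^sup>2) + (8 * \<epsilon> + 12 * ln (joukowski_growth (2 * \<eta> / (b1 - a1)))) * real n)"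
proof -
  obtain U1 where U1: "\<And>\<eta> n X Y x. \<eta> > 0 \<Longrightarrow> m1.config n X Y \<Longrightarrow> x \<in> {a1..b1} \<Longrightarrow>
     (\<Sum>z\<in>X. smooth_log \<eta> (x - z)) + (\<Sum>z\<in>Y. smooth_log \<eta> (x - z)) / 2 \<le>
     ln (m1.weighted_norm X Y) + U1 + (\<epsilon> + 3 * ln (joukowski_growth (2 * \<eta> / (b1 - a1)))) * real n"
    using m1.smooth_upper_bound[OF assms] by blast
  obtain U2 where U2: "\<And>\<eta> n X Y x. \<eta> > 0 \<Longrightarrow> m2.config n X Y \<Longrightarrow> x \<in> {a2..b2} \<Longrightarrow>
     (\<Sum>z\<in>X. smooth_log \<eta> (x - z)) + (\<Sum>z\<in>Y. smooth_log \<eta> (x - z)) / 2 \<le>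
     ln (m2.weighted_norm X Y) + U2 + (\<epsilon> + 3 * ln (joukowski_growth (2 * \<eta> / (b2 - a2)))) * real n"
    using m2.smooth_upper_bound[OF assms] by blast
  obtain L1 where L1: "\<And>\<eta> n X Y x. \<eta> > 0 \<Longrightarrow> m1.config n X Y \<Longrightarrow> x \<in> X \<Longrightarrow>
     ln (m1.weighted_norm X Y) - L1 + ln (\<eta>\<^sup>2) - \<epsilon> * real n \<le>
     (\<Sum>z\<in>X. smooth_log \<eta> (x - z)) + (\<Sum>z\<in>Y. smooth_log \<eta> (x - z)) / 2"
    using m1.smooth_lower_bound[OF assms] by blast
  obtain L2 where L2: "\<And>\<eta> n X Y x. \<eta> > 0 \<Longrightarrow> m2.config n X Y \<Longrightarrow> x \<in> X \<Longrightarrow>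
     ln (m2.weighted_norm X Y) - L2 + ln (\<eta>\<^sup>2) - \<epsilon> * real n \<le>
     (\<Sum>z\<in>X. smooth_log \<eta> (x - z)) + (\<Sum>z\<in>Y. smooth_log \<eta> (x - z)) / 2"
    using m2.smooth_lower_bound[OF assms] by blast
  have "- discrepancy \<eta> X Y \<le>
     real n * (2 * (L1 + L2 + U1 + U2) - 4 * ln (\<eta>\<^sup>2) + (8 * \<epsilon> + 12 * ln (joukowski_growth (2 * \<eta> / (b1 - a1)))) * real n)"
    if \<eta>: "\<eta> > 0" and p: "pair n X Y" for \<eta> n X Y
  proof -
    have c1: "m1.config n X Y" and c2: "m2.config n Y X" using p by (auto simp: pair_def)
    have fin: "finite X" "finite Y" "card X = n" "card Y = n" and XI: "X \<subseteq> {a1..b1}" and YI: "Y \<subseteq> {a2..b2}"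
      using c1 c2 by (auto simp: m1.config_def m2.config_def)
    let ?X' = "reflect ` X" and ?Y' = "reflect ` Y" and ?S = "mutual_energy \<eta>"
    have rr: "reflect = (\<lambda>x. (a1 + b2) - x)" by (simp add: fun_eq_iff reflect_def)
    have cX': "finite ?X'" "finite ?Y'" "card ?X' = n" "card ?Y' = n"
      using fin by (auto simp: card_image rr inj_on_def)
    define w where "w = (\<epsilon> + 3 * ln (joukowski_growth (2 * \<eta> / (b1 - a1)))) * real n"
    define N1 where "N1 = ln (m1.weighted_norm X Y)"
    define N2 where "N2 = ln (m2.weighted_norm Y X)"
    have e1: "real n * (N1 - L1 + ln (\<eta>\<^sup>2) - \<epsilon> * real n) \<le> ?S X X + ?S X Y / 2"
      unfolding mutual_energy_def sum_divide_distrib sum.distrib[symmetric] fin(3)[symmetric] N1_def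
      by (rule sum_bounded_below) (use L1[OF \<eta> c1] fin in \<open>simp add: sum_divide_distrib\<close>)
    have e3: "real n * (N2 - L2 + ln (\<eta>\<^sup>2) - \<epsilon> * real n) \<le> ?S Y Y + ?S Y X / 2"
      unfolding mutual_energy_def sum_divide_distrib sum.distrib[symmetric] fin(4)[symmetric] N2_def
      by (rule sum_bounded_below) (use L2[OF \<eta> c2] fin in \<open>simp add: sum_divide_distrib\<close>)
    \<comment> \<open>By equal length the mirror image of \<open>Y\<close> lies in
      \<open>{a1..b1}\<close>, where the upper bound for \<open>\<mu>1\<close> holds.\<close>
    have e2: "?S ?Y' X + ?S ?Y' Y / 2 \<le> real n * (N1 + U1 + w)"
      unfolding mutual_energy_def sum_divide_distrib sum.distrib[symmetric] cX'(4)[symmetric] N1_def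
    proof (rule sum_bounded_above)
      fix x assume "x \<in> ?Y'"
      then have "x \<in> {a1..b1}" using YI reflect_in(2) by blast
      from U1[OF \<eta> c1 this]
      show "(\<Sum>y\<in>X. smooth_log \<eta> (x - y)) + (\<Sum>n\<in>Y. smooth_log \<eta> (x - n) / 2) \<le> ln (m1.weighted_norm X Y) + U1 + w"
        by (simp add: w_def sum_divide_distrib)
    qed
    have e4: "?S ?X' Y + ?S ?X' X / 2 \<le> real n * (N2 + U2 + w)"
      unfolding mutual_energy_def sum_divide_distrib sum.distrib[symmetric] cX'(3)[symmetric] N2_def
    proof (rule sum_bounded_above)
      fix x assume "x \<in> ?X'"
      then have "x \<in> {a2..b2}" using XI reflect_in(1) by blast
      from U2[OF \<eta> c2 this]
      show "(\<Sum>y\<in>Y. smooth_log \<eta> (x - y)) + (\<Sum>n\<in>X. smooth_log \<eta> (x - n) / 2) \<le> ln (m2.weighted_norm Y X) + U2 + w"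
        by (simp add: w_def sum_divide_distrib same_length)
    qed
    have refl: "?S (reflect ` A) B = ?S A (reflect ` B)" "reflect ` reflect ` A = A" for A B
      unfolding rr by (rule mutual_energy_reflect, rule reflect_reflect)
    define E where "E = ?S X X + ?S Y Y - 2 * ?S X ?Y'"
    define E' where "E' = ?S X ?X' + ?S Y ?Y' - 2 * ?S X Y"
    have "E - E' / 2 \<ge> - (real n * (L1 + L2 + U1 + U2 - 2 * ln (\<eta>\<^sup>2) + 2 * \<epsilon> * real n + 2 * w))"
    proof -
      have "real n * (N1 - L1 + ln (\<eta>\<^sup>2) - \<epsilon> * real n) + real n * (N2 - L2 + ln (\<eta>\<^sup>2) - \<epsilon> * real n)
          - real n * (N1 + U1 + w) - real n * (N2 + U2 + w) =
          - (real n * (L1 + L2 + U1 + U2 - 2 * ln (\<eta>\<^sup>2) + 2 * \<epsilon> * real n + 2 * w))"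
        by (simp add: algebra_simps)
      moreover have "?S ?Y' X = ?S X ?Y'" "?S ?X' Y = ?S X ?Y'" "?S Y X = ?S X Y" "?S ?Y' Y = ?S Y ?Y'" "?S ?X' X = ?S X ?X'"
        using refl(1) mutual_energy_commute by metis+
      moreover have "u1 + u3 - u2 - u4 \<le> (s1 + s2 - 2 * s3) - (s4 + s5 - 2 * s6) / 2"
        if "u1 \<le> s1 + s6 / 2" "u3 \<le> s2 + s6 / 2" "s3 + s5 / 2 \<le> u2" "s3 + s4 / 2 \<le> u4"
        for u1 u2 u3 u4 s1 s2 s3 s4 s5 s6 :: real
        using that by (simp add: field_simps)
      ultimately show ?thesis using e1 e2 e3 e4 unfolding E_def E'_def by metis
    qed
    \<comment> \<open>The signs are those of \<nu> minus its reflection; its form is E - 2E' +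
      E.\<close>
    moreover have "2 * E - 2 * E' \<le> 0"
    proof -
      have "(\<Sum>k<4. \<Sum>l<4. [1, - 1, - 1, 1] ! k * [1, - 1, - 1, 1] ! l *
          ?S ([X, ?Y', ?X', Y] ! k) ([X, ?Y', ?X', Y] ! l)) \<le> 0"
        by (rule mutual_energy_neg_def[OF \<eta>])
           (use fin cX' in \<open>auto simp: numeral_eq_Suc less_Suc_eq\<close>)
      moreover have "(\<Sum>k<4. \<Sum>l<4. [1, - 1, - 1, 1] ! k * [1, - 1, - 1, 1] ! l *
          ?S ([X, ?Y', ?X', Y] ! k) ([X, ?Y', ?X', Y] ! l)) = 2 * E - 2 * E'"
        using refl(1)[of X Y] refl(1)[of X X] refl(1)[of Y Y] refl(1)[of Y X]
          refl(1)[of X ?X'] refl(1)[of X ?Y'] refl(1)[of Y ?Y'] refl(1)[of Y ?X']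
          mutual_energy_commute[of \<eta> Y X] mutual_energy_commute[of \<eta> ?Y' X] mutual_energy_commute[of \<eta> ?X' X]
          mutual_energy_commute[of \<eta> ?Y' Y] mutual_energy_commute[of \<eta> ?X' Y] mutual_energy_commute[of \<eta> ?X' ?Y']
        unfolding E_def E'_def by (simp add: numeral_eq_Suc refl(2))
      ultimately show ?thesis by simp
    qed
    ultimately have "- E \<le> 2 * (real n * (L1 + L2 + U1 + U2 - 2 * ln (\<eta>\<^sup>2) + 2 * \<epsilon> * real n + 2 * w))"
      by linarith
    moreover have "?S X X + ?S ?Y' ?Y' - 2 * ?S X ?Y' = E"
      unfolding E_def using refl(1)[of Y ?Y'] by (simp add: refl(2))
    ultimately show ?thesis unfolding w_def by (simp add: algebra_simps)
  qed
  then show ?thesis by blast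
qed

end

section \<open>Exponential decay\<close>

text \<open>The bound is of order W/R for large R: at a distant point a neutral charge of bounded
  extent has negligible potential.\<close>

lemma smooth_log_far:
  assumes "W > 0" "R > W" "\<bar>s\<bar> \<le> W" "\<bar>t\<bar> \<le> W"
  shows "smooth_log \<eta> (R + s) - smooth_log \<eta> (R + t) \<le> 4 * R * W / (R - W)\<^sup>2"
proof -
  define A where "A = (R + s)\<^sup>2 + \<eta>\<^sup>2"
  define B where "B = (R + t)\<^sup>2 + \<eta>\<^sup>2"
  have s: "(R + s)\<^sup>2 \<le> (R + W)\<^sup>2" and t: "(R - W)\<^sup>2 \<le> (R + t)\<^sup>2"
    using assms by (auto intro!: power_mono simp: abs_le_iff)
  have RW: "(R - W)\<^sup>2 > 0" using assms by simp
  have B: "B \<ge> (R - W)\<^sup>2" using t by (simp add: B_def add_increasing2)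
  then have B0: "B > 0" using RW by linarith
  have A0: "A > 0" using assms by (simp add: A_def add_pos_nonneg)
  have "ln A - ln B = ln (A / B)" using A0 B0 by (simp add: ln_div)
  also have "\<dots> \<le> A / B - 1" using A0 B0 by (intro ln_le_minus_one) simp
  also have "\<dots> = (A - B) / B" using B0 by (simp add: field_simps)
  also have "\<dots> \<le> (4 * R * W) / (R - W)\<^sup>2"
  proof (rule frac_le)
    show "A - B \<le> 4 * R * W" using s t by (simp add: A_def B_def power2_eq_square algebra_simps)
  qed (use assms RW B in auto)
  finally show ?thesis unfolding A_def B_def smooth_log_def .
qed

context equal_pair
begin

lemma node_in:
  assumes "pair n X Y"
  shows "x \<in> X \<Longrightarrow> x \<in> {a1..b1}" "y \<in> Y \<Longrightarrow> y \<in> {a2..b2}" "finite X" "finite Y" "card X = n" "card Y = n" "n \<ge> 1"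
  using assms by (auto simp: pair_def m1.config_def m2.config_def)

text \<open>A Cauchy-Schwarz argument: the form is evaluated at \<nu> + \<tau> (\<delta>_z -
  \<delta>_{z+R}), where the far point keeps the charge neutral. The linear term in \<tau> is the
  potential difference \<open>dv\<close>, the quadratic one the self-energy \<open>\<Lambda>\<close>
  of the dipole; \<tau> = n \<theta> and -n \<theta> give both signs. The last two error terms are
  the potential at the far point and the cost of removing the smoothing at distance at least
  \<open>gap\<close>.\<close>

lemma potential_difference:
  assumes p: "pair n X Y" and \<eta>: "\<eta> > 0" and z: "z \<in> {a2..b2}" and R: "R > width" and \<theta>: "\<theta> > 0"
    and E: "- discrepancy \<eta> X Y \<le> real n * E"
  shows "\<bar>ln \<bar>nodal X z\<bar> - ln \<bar>nodal Y (reflect z)\<bar>\<bar> \<le>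
     E / (4 * \<theta>) + real n * (\<theta> * (ln (R\<^sup>2 + \<eta>\<^sup>2) - ln (\<eta>\<^sup>2)) / 2
       + 2 * R * width / (R - width)\<^sup>2 + \<eta>\<^sup>2 / (2 * gap\<^sup>2))"
proof -
  let ?Y = "reflect ` Y"
  have rr: "reflect = (\<lambda>x. (a1 + b2) - x)" by (simp add: fun_eq_iff reflect_def)
  note nd = node_in[OF p]
  have fY: "finite ?Y" "card ?Y = n" using nd by (auto simp: card_image rr inj_on_def)
  have YI: "y \<in> {a1..b1}" if "y \<in> ?Y" for y using that nd(2) reflect_in(2) by blast
  have XI: "x \<in> {a1..b1}" if "x \<in> X" for x using that nd(1) by blast
  have n: "real n > 0" using nd by simp
  define D where "D = mutual_energy \<eta> X X + mutual_energy \<eta> ?Y ?Y - 2 * mutual_energy \<eta> X ?Y"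
  define V where "V u = (\<Sum>x\<in>X. smooth_log \<eta> (u - x)) - (\<Sum>y\<in>?Y. smooth_log \<eta> (u - y))" for u
  define \<Lambda> where "\<Lambda> = ln (R\<^sup>2 + \<eta>\<^sup>2) - ln (\<eta>\<^sup>2)"
  define dv where "dv = V z - V (z + R)"
  have quad: "D + 2 * \<tau> * dv - 2 * \<tau>\<^sup>2 * \<Lambda> \<le> 0" for \<tau>
  proof -
    have me: "mutual_energy \<eta> A {u} = (\<Sum>x\<in>A. smooth_log \<eta> (u - x))" for A u
      unfolding mutual_energy_def by (simp add: smooth_log_minus[of \<eta> _ u])
    have me': "mutual_energy \<eta> {u} A = (\<Sum>x\<in>A. smooth_log \<eta> (u - x))" for A u
      unfolding mutual_energy_def by simp
    let ?c = "[1, - 1, \<tau>, - \<tau>]" and ?A = "[X, ?Y, {z}, {z + R}]"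
    have "(\<Sum>k<4. \<Sum>l<4. ?c ! k * ?c ! l * mutual_energy \<eta> (?A ! k) (?A ! l)) \<le> 0"
      by (rule mutual_energy_neg_def[OF \<eta>])
         (use nd fY in \<open>auto simp: numeral_eq_Suc less_Suc_eq\<close>)
    moreover have "(\<Sum>k<4. \<Sum>l<4. ?c ! k * ?c ! l * mutual_energy \<eta> (?A ! k) (?A ! l)) =
        D + 2 * \<tau> * dv - 2 * \<tau>\<^sup>2 * \<Lambda>"
      unfolding D_def dv_def V_def \<Lambda>_def
      by (simp add: numeral_eq_Suc me me' mutual_energy_commute[of \<eta> ?Y X])
         (simp add: smooth_log_def algebra_simps power2_eq_square)
    ultimately show ?thesis by simp
  qed
  have "2 * (real n * \<theta>) * \<bar>dv\<bar> \<le> real n * E + 2 * (real n * \<theta>)\<^sup>2 * \<Lambda>"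
    using quad[of "real n * \<theta>"] quad[of "- (real n * \<theta>)"] E unfolding D_def[symmetric]
    by (cases "dv \<ge> 0") (auto simp: algebra_simps)
  then have "\<bar>dv\<bar> \<le> (real n * E + 2 * (real n * \<theta>)\<^sup>2 * \<Lambda>) / (2 * (real n * \<theta>))"
    using n \<theta> by (simp add: pos_le_divide_eq mult_ac)
  also have "\<dots> = E / (2 * \<theta>) + real n * (\<theta> * \<Lambda>)"
    using n \<theta> by (simp add: field_simps power2_eq_square)
  finally have dv: "\<bar>dv\<bar> \<le> E / (2 * \<theta>) + real n * (\<theta> * \<Lambda>)" .
  \<comment> \<open>Both sets have n points in the same interval, so any bijection between them
    reduces the difference of sums to differences of two values.\<close>
  have sums: "\<bar>(\<Sum>x\<in>X. f x) - (\<Sum>y\<in>?Y. f y)\<bar> \<le> real n * K"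
    if "\<And>x y. x \<in> {a1..b1} \<Longrightarrow> y \<in> {a1..b1} \<Longrightarrow> f x - f y \<le> K" for f :: "real \<Rightarrow> real" and K
  proof -
    obtain h where h: "bij_betw h X ?Y"
      using nd fY by (metis finite_same_card_bij)
    have "(\<Sum>x\<in>X. f x) - (\<Sum>y\<in>?Y. f y) = (\<Sum>x\<in>X. f x - f (h x))"
      using sum.reindex_bij_betw[OF h, of f] by (simp add: sum_subtractf)
    also have "\<bar>\<dots>\<bar> \<le> (\<Sum>x\<in>X. \<bar>f x - f (h x)\<bar>)" by (rule sum_abs)
    also have "\<dots> \<le> real (card X) * K"
    proof (rule sum_bounded_above)
      fix x assume "x \<in> X"
      then have "x \<in> {a1..b1}" "h x \<in> {a1..b1}" using XI YI bij_betwE[OF h] by blast+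
      then show "\<bar>f x - f (h x)\<bar> \<le> K" using that[of x "h x"] that[of "h x" x] by linarith
    qed
    finally show ?thesis using nd by simp
  qed
  have far: "\<bar>V (z + R)\<bar> \<le> real n * (4 * R * width / (R - width)\<^sup>2)"
    unfolding V_def
  proof (rule sums)
    fix x y assume "x \<in> {a1..b1}" "y \<in> {a1..b1}"
    then show "smooth_log \<eta> (z + R - x) - smooth_log \<eta> (z + R - y) \<le> 4 * R * width / (R - width)\<^sup>2"
      using smooth_log_far[OF width_pos R, of "z - x" "z - y" \<eta>] dist_bounds(2)[OF _ z]
      by (simp add: algebra_simps)
  qed
  have zX: "z \<notin> X" "z \<notin> ?Y" using XI YI dist_bounds(1)[OF _ z] gap_pos by fastforce+
  have v: "ln \<bar>nodal X z\<bar> - ln \<bar>nodal Y (reflect z)\<bar> =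
      (\<Sum>x\<in>X. ln \<bar>z - x\<bar>) - (\<Sum>y\<in>?Y. ln \<bar>z - y\<bar>)"
  proof -
    have "\<bar>nodal Y (reflect z)\<bar> = \<bar>nodal ?Y z\<bar>"
      unfolding rr using poly_root_poly_reflect[OF nd(4)] by simp
    then show ?thesis using ln_abs_poly_root_poly zX nd fY by simp
  qed
  have near: "(\<Sum>x\<in>A. smooth_log \<eta> (z - x)) - 2 * (\<Sum>x\<in>A. ln \<bar>z - x\<bar>) \<in> {0..real n * (\<eta>\<^sup>2 / gap\<^sup>2)}"
    if A: "\<And>x. x \<in> A \<Longrightarrow> x \<in> {a1..b1}" "card A = n" for A
  proof -
    have t: "smooth_log \<eta> (z - x) - 2 * ln \<bar>z - x\<bar> \<in> {0..\<eta>\<^sup>2 / gap\<^sup>2}" if "x \<in> A" for x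
      using ln_le_smooth_log[of "z - x" \<eta>] smooth_log_le[OF gap_pos, of "z - x" \<eta>]
        dist_bounds(1)[OF A(1)[OF that] z] gap_pos by auto
    have "(\<Sum>x\<in>A. smooth_log \<eta> (z - x) - 2 * ln \<bar>z - x\<bar>) \<le> real (card A) * (\<eta>\<^sup>2 / gap\<^sup>2)"
      by (rule sum_bounded_above) (use t in auto)
    moreover have "0 \<le> (\<Sum>x\<in>A. smooth_log \<eta> (z - x) - 2 * ln \<bar>z - x\<bar>)"
      by (rule sum_nonneg) (use t in auto)
    ultimately show ?thesis using A by (simp add: sum_subtractf sum_distrib_left)
  qed
  have "\<bar>2 * ((\<Sum>x\<in>X. ln \<bar>z - x\<bar>) - (\<Sum>y\<in>?Y. ln \<bar>z - y\<bar>))\<bar> \<le> \<bar>V z\<bar> + real n * (\<eta>\<^sup>2 / gap\<^sup>2)"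
    using near[of X] near[of ?Y] XI YI nd fY unfolding V_def by auto
  also have "\<bar>V z\<bar> \<le> \<bar>dv\<bar> + \<bar>V (z + R)\<bar>" unfolding dv_def by simp
  finally have "2 * \<bar>ln \<bar>nodal X z\<bar> - ln \<bar>nodal Y (reflect z)\<bar>\<bar> \<le>
      E / (2 * \<theta>) + real n * (\<theta> * \<Lambda>) + real n * (4 * R * width / (R - width)\<^sup>2) + real n * (\<eta>\<^sup>2 / gap\<^sup>2)"
    unfolding v abs_mult using dv far by simp
  note final = this
  have id: "e / (2 * q) + m * (q * l) + m * (4 * R * w / D) + m * (h / G) =
      2 * (e / (4 * q) + m * (q * l / 2 + 2 * R * w / D + h / (2 * G)))" for e q m l R w D h G :: real
    by (simp add: algebra_simps)
  from final[unfolded id] show ?thesis unfolding \<Lambda>_def[symmetric] by (rule mult_left_le_imp_le) simp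
qed

text \<open>\<open>R\<close> is fixed first, to make the far potential small. As \<eta> tends to 0,
  \<open>\<Lambda>\<close> grows like ln (1/\<eta>) while \<open>ln (J \<eta>)\<close> decays like
  the square root of \<eta>. Their product tends to 0, which leaves room for a \<theta> of order
  \<epsilon> / \<Lambda>.\<close>

lemma reflected_potentials_close:
  assumes "\<epsilon> > 0"
  shows "\<exists>C. \<forall>n X Y. pair n X Y \<longrightarrow> (\<forall>z\<in>{a2..b2}.
     \<bar>ln \<bar>nodal X z\<bar> - ln \<bar>nodal Y (reflect z)\<bar>\<bar> \<le> C + \<epsilon> * real n)"
proof -
  have "((\<lambda>R. 2 * R * width / (R - width)\<^sup>2) \<longlongrightarrow> 0) at_top"
    using width_pos by real_asymp
  then have "eventually (\<lambda>R. 2 * R * width / (R - width)\<^sup>2 < \<epsilon> / 5) at_top"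
    using assms by (intro order_tendstoD) auto
  then have "eventually (\<lambda>R. 2 * R * width / (R - width)\<^sup>2 < \<epsilon> / 5 \<and> R > width) at_top"
    using eventually_gt_at_top[of width] by eventually_elim auto
  then obtain R where R: "2 * R * width / (R - width)\<^sup>2 < \<epsilon> / 5" "R > width"
    by (auto simp: eventually_at_top_linorder)
  have R0: "R > 0" using R width_pos by simp
  define k where "k = 2 / (b1 - a1)"
  have k: "k > 0" using m1.ab by (simp add: k_def)
  define \<Lambda> where "\<Lambda> \<eta> = ln (R\<^sup>2 + \<eta>\<^sup>2) - ln (\<eta>\<^sup>2)" for \<eta>
  define J where "J \<eta> = joukowski_growth (2 * \<eta> / (b1 - a1))" for \<eta>
  have "((\<lambda>\<eta>. (ln (R\<^sup>2 + \<eta>\<^sup>2) - ln (\<eta>\<^sup>2)) * ln (1 + k * \<eta> + sqrt (2 * (k * \<eta>) + (k * \<eta>)\<^sup>2))) \<longlongrightarrow> 0) (at_right 0)"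
    using R0 k by real_asymp
  then have "((\<lambda>\<eta>. \<Lambda> \<eta> * ln (J \<eta>)) \<longlongrightarrow> 0) (at_right 0)"
    unfolding \<Lambda>_def J_def joukowski_growth_def k_def by simp
  then have "eventually (\<lambda>\<eta>. \<Lambda> \<eta> * ln (J \<eta>) < \<epsilon>\<^sup>2 / 200) (at_right 0)"
    using assms by (intro order_tendstoD) auto
  moreover have "((\<lambda>\<eta>. \<eta>\<^sup>2 / (2 * gap\<^sup>2)) \<longlongrightarrow> 0\<^sup>2 / (2 * gap\<^sup>2)) (at_right 0)"
    using gap_pos by (intro tendsto_intros) auto
  then have "eventually (\<lambda>\<eta>. \<eta>\<^sup>2 / (2 * gap\<^sup>2) < \<epsilon> / 5) (at_right 0)"
    using assms by (intro order_tendstoD) auto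
  ultimately have "eventually (\<lambda>\<eta>. \<Lambda> \<eta> * ln (J \<eta>) < \<epsilon>\<^sup>2 / 200 \<and> \<eta>\<^sup>2 / (2 * gap\<^sup>2) < \<epsilon> / 5 \<and> 0 < \<eta>) (at_right 0)"
    using eventually_at_right_less by eventually_elim auto
  then obtain \<eta> where \<eta>: "\<Lambda> \<eta> * ln (J \<eta>) < \<epsilon>\<^sup>2 / 200" "\<eta>\<^sup>2 / (2 * gap\<^sup>2) < \<epsilon> / 5" "0 < \<eta>"
    using eventually_happens'[OF trivial_limit_at_right_real] by blast
  have "ln (\<eta>\<^sup>2) < ln (R\<^sup>2 + \<eta>\<^sup>2)"
    by (subst ln_less_cancel_iff) (use R0 \<eta>(3) in \<open>auto intro: add_pos_pos\<close>)
  then have \<Lambda>: "\<Lambda> \<eta> > 0" by (simp add: \<Lambda>_def)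
  \<comment> \<open>With this \<theta> the self-energy term is exactly \<epsilon>/5. The choice of
    \<epsilon>' and the bound \<epsilon>^2/200 keep the energy term below \<epsilon>/5 as well; the
    other two terms are already below it.\<close>
  define \<theta> where "\<theta> = 2 * \<epsilon> / (5 * \<Lambda> \<eta>)"
  define \<epsilon>' where "\<epsilon>' = \<epsilon>\<^sup>2 / (100 * \<Lambda> \<eta>)"
  have \<theta>: "\<theta> > 0" and \<epsilon>': "\<epsilon>' > 0" using \<Lambda> assms by (auto simp: \<theta>_def \<epsilon>'_def)
  obtain C where C: "\<And>n X Y. pair n X Y \<Longrightarrow>
     - discrepancy \<eta> X Y \<le>
     real n * (C - 4 * ln (\<eta>\<^sup>2) + (8 * \<epsilon>' + 12 * ln (J \<eta>)) * real n)"
    using energy_bound[OF \<epsilon>'] \<eta>(3) unfolding J_def by blast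
  define C0 where "C0 = (C - 4 * ln (\<eta>\<^sup>2)) / (4 * \<theta>)"
  have "\<bar>ln \<bar>nodal X z\<bar> - ln \<bar>nodal Y (reflect z)\<bar>\<bar> \<le> C0 + \<epsilon> * real n"
    if p: "pair n X Y" and z: "z \<in> {a2..b2}" for n X Y z
  proof -
    have "\<bar>ln \<bar>nodal X z\<bar> - ln \<bar>nodal Y (reflect z)\<bar>\<bar> \<le>
        (C - 4 * ln (\<eta>\<^sup>2) + (8 * \<epsilon>' + 12 * ln (J \<eta>)) * real n) / (4 * \<theta>) +
        real n * (\<theta> * \<Lambda> \<eta> / 2 + 2 * R * width / (R - width)\<^sup>2 + \<eta>\<^sup>2 / (2 * gap\<^sup>2))"
      using potential_difference[OF p \<eta>(3) z R(2) \<theta> C[OF p]] by (simp add: \<Lambda>_def)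
    also have "\<dots> = C0 + real n * ((8 * \<epsilon>' + 12 * ln (J \<eta>)) / (4 * \<theta>) + \<theta> * \<Lambda> \<eta> / 2
        + 2 * R * width / (R - width)\<^sup>2 + \<eta>\<^sup>2 / (2 * gap\<^sup>2))"
      using \<theta> by (simp add: C0_def field_simps)
    also have "\<dots> \<le> C0 + real n * \<epsilon>"
    proof (intro add_left_mono mult_left_mono)
      have t1: "\<theta> * \<Lambda> \<eta> / 2 = \<epsilon> / 5" using \<Lambda> by (simp add: \<theta>_def)
      have "(8 * \<epsilon>' + 12 * ln (J \<eta>)) / (4 * \<theta>) = (2 * \<epsilon>' + 3 * ln (J \<eta>)) * (5 * \<Lambda> \<eta> / (2 * \<epsilon>))"
        using \<Lambda> assms by (simp add: \<theta>_def field_simps)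
      also have "\<dots> = (5 * (\<epsilon>' * \<Lambda> \<eta>) + 15 / 2 * (\<Lambda> \<eta> * ln (J \<eta>))) / \<epsilon>"
        using assms by (simp add: field_simps)
      also have "\<dots> \<le> (5 * (\<epsilon>\<^sup>2 / 100) + 15 / 2 * (\<epsilon>\<^sup>2 / 200)) / \<epsilon>"
        using assms \<eta>(1) \<Lambda> by (intro divide_right_mono add_mono mult_left_mono) (auto simp: \<epsilon>'_def)
      also have "\<dots> \<le> \<epsilon> / 5" using assms by (simp add: field_simps power2_eq_square)
      finally show "(8 * \<epsilon>' + 12 * ln (J \<eta>)) / (4 * \<theta>) + \<theta> * \<Lambda> \<eta> / 2
        + 2 * R * width / (R - width)\<^sup>2 + \<eta>\<^sup>2 / (2 * gap\<^sup>2) \<le> \<epsilon>"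
        using t1 R(1) \<eta>(2) assms by linarith
    qed simp
    finally show ?thesis by (simp add: mult_ac)
  qed
  then show ?thesis by blast
qed

lemma reflected_poly_le:
  assumes "\<epsilon> > 0"
  shows "\<exists>C>0. \<forall>n X Y. pair n X Y \<longrightarrow> (\<forall>x\<in>{a1..b1}.
     \<bar>nodal Y x\<bar> \<le> C * exp (\<epsilon> * real n) * \<bar>nodal X (reflect x)\<bar>)"
proof -
  obtain C where C: "\<And>n X Y z. pair n X Y \<Longrightarrow> z \<in> {a2..b2} \<Longrightarrow>
     \<bar>ln \<bar>nodal X z\<bar> - ln \<bar>nodal Y (reflect z)\<bar>\<bar> \<le> C + \<epsilon> * real n"
    using reflected_potentials_close[OF assms] by blast
  have "\<bar>nodal Y x\<bar> \<le> exp C * exp (\<epsilon> * real n) * \<bar>nodal X (reflect x)\<bar>"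
    if p: "pair n X Y" and x: "x \<in> {a1..b1}" for n X Y x
  proof -
    note nd = node_in[OF p]
    have rx: "reflect x \<in> {a2..b2}" "reflect (reflect x) = x" using reflect_in x by (auto simp: reflect_def)
    have "x \<notin> Y" using nd(2)[of x] dist_bounds(1)[OF x, of x] gap_pos by auto
    then have Y: "\<bar>nodal Y x\<bar> > 0" using nd by (simp add: poly_root_poly_eq_0)
    have "reflect x \<notin> X" using nd(1)[of "reflect x"] dist_bounds(1)[OF _ rx(1), of "reflect x"] gap_pos by auto
    then have X: "\<bar>nodal X (reflect x)\<bar> > 0" using nd by (simp add: poly_root_poly_eq_0)
    have "ln \<bar>nodal Y x\<bar> \<le> C + \<epsilon> * real n + ln \<bar>nodal X (reflect x)\<bar>"
      using C[OF p rx(1)] unfolding rx(2) by linarith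
    then have "exp (ln \<bar>nodal Y x\<bar>) \<le> exp (C + \<epsilon> * real n + ln \<bar>nodal X (reflect x)\<bar>)"
      by simp
    then show ?thesis using X Y by (simp only: exp_ln exp_add)
  qed
  then show ?thesis by (intro exI[of _ "exp C"]) auto
qed

text \<open>The mirror images of the zeros of q compete in the minimum problem that p solves for
  \<open>\<mu>1\<close>. Since |q(x)| is about |p| at the mirror image of x, the competitor's weight
  at x is the weight q^2 |p| of the second measure at that mirror image.\<close>

lemma weighted_norm_compare:
  assumes "\<epsilon> > 0"
  shows "\<exists>C>0. \<forall>n X Y. pair n X Y \<longrightarrow>
     m1.weighted_norm X Y \<le> C * exp (\<epsilon> * real n) * m2.weighted_norm Y X"
proof -
  obtain C1 where C1: "C1 > 0" and le: "\<And>n X Y x. pair n X Y \<Longrightarrow> x \<in> {a1..b1} \<Longrightarrow>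
     \<bar>nodal Y x\<bar> \<le> C1 * exp (\<epsilon> / 2 * real n) * \<bar>nodal X (reflect x)\<bar>"
    using reflected_poly_le[of "\<epsilon> / 2"] assms by auto
  obtain C2 where C2: "C2 > 0" and sup: "\<And>n X Y x. m2.config n X Y \<Longrightarrow> x \<in> {a2..b2} \<Longrightarrow>
     nodal_weight X Y x \<le> C2 * exp (\<epsilon> / 2 * real n) * m2.weighted_norm X Y"
    using m2.config_sup_bound[of "\<epsilon> / 2"] assms by auto
  have "m1.weighted_norm X Y \<le> C1 * C2 * m1.mass * exp (\<epsilon> * real n) * m2.weighted_norm Y X"
    if p: "pair n X Y" for n X Y
  proof -
    note nd = node_in[OF p]
    have rr: "reflect = (\<lambda>x. (a1 + b2) - x)" by (simp add: fun_eq_iff reflect_def)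
    have c: "m1.config n X Y" "m2.config n Y X" using p by (auto simp: pair_def)
    define K where "K = C1 * C2 * exp (\<epsilon> * real n) * m2.weighted_norm Y X"
    have "m1.weighted_norm X Y \<le> m1.weighted_norm (reflect ` Y) Y"
      by (rule m1.weighted_norm_minimal[OF c(1)]) (use nd in \<open>simp add: card_image rr inj_on_def\<close>)
    also have "\<dots> \<le> (\<integral>x. K \<partial>\<mu>1)"
      unfolding m1.weighted_norm_def
    proof (intro m1.integral_mono_ab m1.integrable_cont continuous_intros)
      fix x assume x: "x \<in> {a1..b1}"
      let ?t = "reflect x"
      have t: "?t \<in> {a2..b2}" using reflect_in x by auto
      have "\<bar>nodal (reflect ` Y) x\<bar> = \<bar>nodal Y ?t\<bar>"
        unfolding rr using poly_root_poly_reflect[OF nd(4)] by simp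
      then have "nodal_weight (reflect ` Y) Y x = (nodal Y ?t)\<^sup>2 * \<bar>nodal Y x\<bar>"
        by (metis power2_abs)
      also have "\<dots> \<le> (nodal Y ?t)\<^sup>2 * (C1 * exp (\<epsilon> / 2 * real n) * \<bar>nodal X ?t\<bar>)"
        by (intro mult_left_mono le[OF p x]) simp
      also have "\<dots> = C1 * exp (\<epsilon> / 2 * real n) * (nodal_weight Y X ?t)" by simp
      also have "\<dots> \<le> C1 * exp (\<epsilon> / 2 * real n) * (C2 * exp (\<epsilon> / 2 * real n) * m2.weighted_norm Y X)"
        using C1 by (intro mult_left_mono sup[OF c(2) t]) simp
      also have "\<dots> = C1 * C2 * (exp (\<epsilon> / 2 * real n) * exp (\<epsilon> / 2 * real n)) * m2.weighted_norm Y X" by simp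
      also have "exp (\<epsilon> / 2 * real n) * exp (\<epsilon> / 2 * real n) = exp (\<epsilon> * real n)"
        by (simp flip: exp_add)
      finally show "nodal_weight (reflect ` Y) Y x \<le> K" by (simp add: K_def)
    qed
    also have "\<dots> = m1.mass * K" by simp
    finally show ?thesis by (simp add: K_def mult_ac)
  qed
  moreover have "C1 * C2 * m1.mass > 0" using C1 C2 m1.mass_pos by simp
  ultimately show ?thesis by blast
qed

text \<open>\<open>side\<close> is the direction from the first interval to the second;
  \<open>near1\<close> and \<open>near2\<close> are the endpoints facing each other across the
  gap.\<close>

definition side :: real where "side = (if b1 < a2 then 1 else - 1)"
definition near1 :: real where "near1 = (if b1 < a2 then b1 else a1)"
definition near2 :: real where "near2 = (if b1 < a2 then a2 else b2)"

lemma near_facts: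
  shows "side * (near2 - near1) = gap" "near2 \<in> {a2..b2}" "near1 \<in> {a1..b1}"
    "reflect y = near1 + near2 - y" "side = 1 \<or> side = - 1"
    "x \<in> {a1..b1} \<Longrightarrow> 0 \<le> side * (near1 - x)" "y \<in> {a2..b2} \<Longrightarrow> 0 \<le> side * (y - near2)"
  using separated same_length m1.ab m2.ab
  by (auto simp: side_def near1_def near2_def gap_def reflect_def)

text \<open>Since \<open>\<mu>1\<close>-mass must be visible between the last zero and \<open>near1\<close>, the norm is controlled by
  \<open>2 u(y) + u(y\<^sup>*)\<close> where \<open>u = ln \<bar>p\<^sub>X\<bar>\<close> and \<open>y\<^sup>*\<close> is the reflection of \<open>y\<close>; the concavity of \<open>u\<close> to
  the right of all zeros bounds this by \<open>3 u(near2) - 2 gap u'(near2)\<close>.\<close>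

lemma weighted_norm_decay:
  assumes "\<epsilon> > 0"
  shows "\<exists>C>0. \<forall>n X Y. pair n X Y \<longrightarrow>
     m1.weighted_norm X Y \<le> C * exp ((\<epsilon> - 2 * gap / width) * real n) * \<bar>nodal X near2\<bar> ^ 3"
proof -
  obtain C1 where C1: "C1 > 0" and le: "\<And>n X Y x. pair n X Y \<Longrightarrow> x \<in> {a1..b1} \<Longrightarrow>
     \<bar>nodal Y x\<bar> \<le> C1 * exp (\<epsilon> * real n) * \<bar>nodal X (reflect x)\<bar>"
    using reflected_poly_le[OF assms] by auto
  define K where "K = 4 * (b1 - a1) * m1.mass"
  have K: "K > 0" using m1.ab m1.mass_pos by (simp add: K_def)
  define \<rho> where "\<rho> = exp (- (2 * gap / width))"
  define C where "C = K * (b1 - a1) * C1 * (width / gap ^ 3) / \<rho>"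
  have C: "C > 0" using K m1.ab C1 width_pos gap_pos by (simp add: C_def \<rho>_def)
  have "m1.weighted_norm X Y \<le> C * exp ((\<epsilon> - 2 * gap / width) * real n) * \<bar>nodal X near2\<bar> ^ 3"
    if p: "pair n X Y" for n X Y
  proof -
    note nd = node_in[OF p]
    have cf: "m1.config n X Y" using p by (simp add: pair_def)
    have X0: "X \<noteq> {}" using nd by auto
    \<comment> \<open>The zero closest to the second interval; \<open>side_large_value\<close> then
      yields a point y beyond all zeros.\<close>
    define \<alpha> where "\<alpha> = arg_min_on (\<lambda>x. - side * x) X"
    have \<alpha>: "\<alpha> \<in> X" unfolding \<alpha>_def using nd(3) X0 by (rule arg_min_if_finite)
    have \<alpha>max: "side * x \<le> side * \<alpha>" if "x \<in> X" for x
      using arg_min_least[OF nd(3) X0 that, of "\<lambda>x. - side * x"] by (simp add: \<alpha>_def)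
    let ?Z = "X - {\<alpha>}"
    obtain y where y: "y \<in> {a1..b1}" "0 < side * (y - \<alpha>)" and
      ge: "m1.weighted_norm X Y / K \<le> nodal_weight ?Z Y y * (side * (y - \<alpha>))"
      using m1.side_large_value[OF cf \<alpha> near_facts(5)] unfolding K_def by blast
    define t where "t = reflect y"
    have t: "t \<in> {a2..b2}" using y reflect_in by (simp add: t_def)
    define s where "s = side * (near1 - y)"
    have s: "s \<ge> 0" using near_facts(6)[OF y(1)] by (simp add: s_def)
    have side2: "\<bar>side * u\<bar> = \<bar>u\<bar>" for u using near_facts(5) by (auto simp: abs_mult)
    \<comment> \<open>With r the distance of x to \<open>near2\<close> and s that of y to
      \<open>near1\<close>, the distances of x to y and t are r - (gap + s) and r + s. The
      inequality 1 + v <= exp v, used for both, leaves the exponent -(2 gap + s)/r, at most -2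
      gap/width.\<close>
    have trm: "\<bar>y - x\<bar>\<^sup>2 * \<bar>t - x\<bar> \<le> \<bar>near2 - x\<bar> ^ 3 * \<rho>" if x: "x \<in> ?Z" for x
    proof -
      define r where "r = side * (near2 - x)"
      have xI: "x \<in> {a1..b1}" using nd(1) x by blast
      have r1: "r = \<bar>near2 - x\<bar>"
      proof -
        have "r = gap + side * (near1 - x)" unfolding r_def using near_facts(1) by (simp add: algebra_simps)
        then have "r \<ge> 0" using near_facts(6)[OF xI] gap_pos by simp
        then show ?thesis using side2[of "near2 - x"] by (simp add: r_def)
      qed
      have r: "0 < r" "r \<le> width" using dist_bounds[OF xI near_facts(2)] gap_pos by (auto simp: r1)
      have yx: "side * (y - x) = r - (gap + s)"
        unfolding r_def s_def using near_facts(1) by (simp add: algebra_simps)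
      have tx: "side * (t - x) = r + s"
        unfolding r_def s_def t_def near_facts(4) by (simp add: algebra_simps)
      have "side * (y - x) > 0" using \<alpha>max[of x] x y(2) by (simp add: algebra_simps)
      then have yx': "\<bar>y - x\<bar> = r - (gap + s)" "r - (gap + s) > 0" using side2[of "y - x"] yx by auto
      have tx': "\<bar>t - x\<bar> = r + s" using side2[of "t - x"] tx r s by simp
      have "r - (gap + s) = r * (1 + - ((gap + s) / r))" using r by (simp add: field_simps)
      also have "\<dots> \<le> r * exp (- ((gap + s) / r))" using r by (intro mult_left_mono exp_ge_add_one_self) auto
      finally have e1: "r - (gap + s) \<le> r * exp (- ((gap + s) / r))" .
      have "r + s = r * (1 + s / r)" using r by (simp add: field_simps)
      also have "\<dots> \<le> r * exp (s / r)" using r by (intro mult_left_mono exp_ge_add_one_self) auto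
      finally have e2: "r + s \<le> r * exp (s / r)" .
      have "\<bar>y - x\<bar>\<^sup>2 * \<bar>t - x\<bar> \<le> (r * exp (- ((gap + s) / r)))\<^sup>2 * (r * exp (s / r))"
        unfolding yx'(1) tx' using e1 e2 yx'(2) r s by (intro mult_mono power_mono) auto
      also have "\<dots> = r ^ 3 * exp (- ((gap + s) / r) + - ((gap + s) / r) + s / r)"
        unfolding exp_add by (simp add: power2_eq_square power3_eq_cube mult_ac)
      also have "\<dots> \<le> r ^ 3 * \<rho>"
      proof (intro mult_left_mono)
        have "- ((gap + s) / r) + - ((gap + s) / r) + s / r = - ((2 * gap + s) / r)"
          using r by (simp add: field_simps)
        also have "\<dots> \<le> - (2 * gap / width)"
          using r s gap_pos by (simp add: frac_le)
        finally show "exp (- ((gap + s) / r) + - ((gap + s) / r) + s / r) \<le> \<rho>" by (simp add: \<rho>_def)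
      qed (use r in simp)
      finally show ?thesis by (simp add: r1)
    qed
    have "(nodal ?Z y)\<^sup>2 * \<bar>nodal X t\<bar> =
        \<bar>t - \<alpha>\<bar> * (\<Prod>x\<in>?Z. \<bar>y - x\<bar>\<^sup>2 * \<bar>t - x\<bar>)"
    proof -
      have "(nodal ?Z y)\<^sup>2 = (\<Prod>x\<in>?Z. \<bar>y - x\<bar>\<^sup>2)"
        using abs_poly_root_poly[of ?Z y] by (metis power2_abs prod_power_distrib)
      moreover have "\<bar>nodal X t\<bar> = \<bar>t - \<alpha>\<bar> * (\<Prod>x\<in>?Z. \<bar>t - x\<bar>)"
        unfolding abs_poly_root_poly using nd \<alpha> by (simp add: prod.remove)
      ultimately show ?thesis by (simp add: prod.distrib)
    qed
    \<comment> \<open>The zero \<alpha> contributes no gain: \<open>\<bar>t - \<alpha>\<bar>\<close>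
      is at most \<open>width\<close>, and \<open>\<bar>near2 - \<alpha>\<bar> ^ 3\<close> at least
      \<open>gap ^ 3\<close>.\<close>
    also have "\<dots> \<le> width / gap ^ 3 * \<bar>near2 - \<alpha>\<bar> ^ 3 * (\<Prod>x\<in>?Z. \<bar>near2 - x\<bar> ^ 3 * \<rho>)"
    proof (rule mult_mono)
      show "(\<Prod>x\<in>?Z. \<bar>y - x\<bar>\<^sup>2 * \<bar>t - x\<bar>) \<le> (\<Prod>x\<in>?Z. \<bar>near2 - x\<bar> ^ 3 * \<rho>)"
        by (intro prod_mono conjI trm) auto
      have "gap ^ 3 \<le> \<bar>near2 - \<alpha>\<bar> ^ 3"
        using dist_bounds(1)[OF nd(1)[OF \<alpha>] near_facts(2)] gap_pos by (intro power_mono) auto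
      then have "width * gap ^ 3 \<le> width * \<bar>near2 - \<alpha>\<bar> ^ 3" using width_pos by (intro mult_left_mono) auto
      then have "width \<le> width / gap ^ 3 * \<bar>near2 - \<alpha>\<bar> ^ 3" using gap_pos by (simp add: field_simps)
      then show "\<bar>t - \<alpha>\<bar> \<le> width / gap ^ 3 * \<bar>near2 - \<alpha>\<bar> ^ 3"
        using dist_bounds(2)[OF nd(1)[OF \<alpha>] t] by linarith
    qed (use width_pos gap_pos in \<open>auto intro!: prod_nonneg mult_nonneg_nonneg\<close>)
    also have "\<dots> = width / gap ^ 3 * \<bar>nodal X near2\<bar> ^ 3 * \<rho> ^ (n - 1)"
    proof -
      have "\<bar>nodal X near2\<bar> ^ 3 = \<bar>near2 - \<alpha>\<bar> ^ 3 * (\<Prod>x\<in>?Z. \<bar>near2 - x\<bar> ^ 3)"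
        unfolding abs_poly_root_poly using nd \<alpha> by (simp add: prod.remove power_mult_distrib prod_power_distrib)
      then show ?thesis using nd \<alpha> by (simp add: prod.distrib)
    qed
    \<comment> \<open>Only n - 1 zeros remain without \<alpha>; the factor 1/\<rho> goes into
      \<open>C\<close>.\<close>
    also have "\<rho> ^ (n - 1) = \<rho> ^ n / \<rho>"
      using nd(7) by (simp add: \<rho>_def power_diff)
    also have "\<rho> ^ n = exp (- (2 * gap / width) * real n)"
      unfolding \<rho>_def by (simp add: exp_of_nat2_mult flip: exp_of_nat_mult)
    finally have main: "(nodal ?Z y)\<^sup>2 * \<bar>nodal X t\<bar> \<le>
        width / gap ^ 3 * \<bar>nodal X near2\<bar> ^ 3 * (exp (- (2 * gap / width) * real n) / \<rho>)" .
    have "m1.weighted_norm X Y \<le> K * (nodal_weight ?Z Y y * (side * (y - \<alpha>)))"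
      using ge K by (simp add: field_simps)
    also have "\<dots> \<le> K * ((nodal ?Z y)\<^sup>2 * (C1 * exp (\<epsilon> * real n) * \<bar>nodal X t\<bar>) * (b1 - a1))"
    proof (intro mult_left_mono[OF mult_mono[OF mult_left_mono]])
      show "\<bar>nodal Y y\<bar> \<le> C1 * exp (\<epsilon> * real n) * \<bar>nodal X t\<bar>"
        unfolding t_def by (rule le[OF p y(1)])
      show "side * (y - \<alpha>) \<le> b1 - a1"
        using m1.config_node_bound[OF cf \<alpha> y(1)] side2[of "y - \<alpha>"] by linarith
    qed (use K y C1 in auto)
    also have "\<dots> = K * (b1 - a1) * C1 * exp (\<epsilon> * real n) * ((nodal ?Z y)\<^sup>2 * \<bar>nodal X t\<bar>)"
      by simp
    also have "\<dots> \<le> K * (b1 - a1) * C1 * exp (\<epsilon> * real n) *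
        (width / gap ^ 3 * \<bar>nodal X near2\<bar> ^ 3 * (exp (- (2 * gap / width) * real n) / \<rho>))"
      using K m1.ab C1 by (intro mult_left_mono main) auto
    also have "\<dots> = C * (exp (\<epsilon> * real n) * exp (- (2 * gap / width) * real n)) * \<bar>nodal X near2\<bar> ^ 3"
      by (simp add: C_def)
    also have "exp (\<epsilon> * real n) * exp (- (2 * gap / width) * real n) = exp ((\<epsilon> - 2 * gap / width) * real n)"
      by (simp add: algebra_simps flip: exp_add)
    finally show ?thesis .
  qed
  then show ?thesis using C by blast
qed

lemma weight_decay:
  "\<exists>C>0. \<exists>\<kappa>>0. \<forall>n X Y. pair n X Y \<longrightarrow> (\<forall>z\<in>Y.
     m1.weighted_norm X Y \<le> C * exp (- \<kappa> * real n) * (nodal_weight X (Y - {z}) z))"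
proof -
  \<comment> \<open>Three losses exp (\<epsilon> n) meet one gain exp (-2 gap n / width), leaving
    exp (-gap n / width), the square of exp (-\<kappa> n).\<close>
  define \<epsilon> where "\<epsilon> = gap / (3 * width)"
  have \<epsilon>: "\<epsilon> > 0" using gap_pos width_pos by (simp add: \<epsilon>_def)
  obtain c where c: "c > 0" and low: "\<And>n X Y z. m2.config n X Y \<Longrightarrow> z \<in> X \<Longrightarrow>
     c * exp (- \<epsilon> * real n) * m2.weighted_norm X Y \<le> nodal_weight (X - {z}) Y z"
    using m2.derivative_lower_bound[OF \<epsilon>] by auto
  obtain C1 where C1: "C1 > 0" and cmp: "\<And>n X Y. pair n X Y \<Longrightarrow>
     m1.weighted_norm X Y \<le> C1 * exp (\<epsilon> * real n) * m2.weighted_norm Y X"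
    using weighted_norm_compare[OF \<epsilon>] by auto
  obtain C2 where C2: "C2 > 0" and dec: "\<And>n X Y. pair n X Y \<Longrightarrow>
     m1.weighted_norm X Y \<le> C2 * exp ((\<epsilon> - 2 * gap / width) * real n) * \<bar>nodal X near2\<bar> ^ 3"
    using weighted_norm_decay[OF \<epsilon>] by auto
  define \<kappa> where "\<kappa> = gap / (2 * width)"
  have \<kappa>: "\<kappa> > 0" using gap_pos width_pos by (simp add: \<kappa>_def)
  define C where "C = sqrt (C1 * C2 / c)"
  have C: "C > 0" using c C1 C2 by (simp add: C_def)
  have "m1.weighted_norm X Y \<le> C * exp (- \<kappa> * real n) * (nodal_weight X (Y - {z}) z)"
    if p: "pair n X Y" and z: "z \<in> Y" for n X Y z
  proof -
    note nd = node_in[OF p]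
    have cf: "m1.config n X Y" "m2.config n Y X" using p by (auto simp: pair_def)
    define N1 where "N1 = m1.weighted_norm X Y"
    define N2 where "N2 = m2.weighted_norm Y X"
    have N: "N1 > 0" "N2 > 0" using m1.weighted_norm_pos[OF cf(1)] m2.weighted_norm_pos[OF cf(2)]
      by (auto simp: N1_def N2_def)
    define P where "P = \<bar>nodal X z\<bar>"
    define Q where "Q = \<bar>nodal (Y - {z}) z\<bar>"
    have PQ: "P \<ge> 0" "Q \<ge> 0" by (auto simp: P_def Q_def)
    \<comment> \<open>z lies at \<open>near2\<close> or beyond it, hence at least as far from every
      zero of p.\<close>
    have Pge: "\<bar>nodal X near2\<bar> \<le> P"
      unfolding P_def abs_poly_root_poly
    proof (intro prod_mono conjI)
      fix x assume "x \<in> X"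
      then have x: "x \<in> {a1..b1}" using nd(1) by blast
      have "side * (near2 - x) \<le> side * (z - x)" "0 \<le> side * (near2 - x)"
        using near_facts(1) near_facts(6)[OF x] near_facts(7)[OF nd(2)[OF z]] gap_pos
        by (auto simp: algebra_simps)
      then show "\<bar>near2 - x\<bar> \<le> \<bar>z - x\<bar>" using near_facts(5) by auto
    qed auto
    have "N1 \<le> C2 * exp ((\<epsilon> - 2 * gap / width) * real n) * P ^ 3"
      using dec[OF p] unfolding N1_def[symmetric]
      by (rule order.trans) (use C2 Pge in \<open>auto intro!: mult_left_mono power_mono\<close>)
    moreover have "N1 \<le> C1 * exp (\<epsilon> * real n) * (exp (\<epsilon> * real n) / c * (Q\<^sup>2 * P))"
    proof -
      have "c * exp (- \<epsilon> * real n) * N2 \<le> Q\<^sup>2 * P" using low[OF cf(2) z] by (simp add: N2_def P_def Q_def)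
      then have "N2 \<le> exp (\<epsilon> * real n) / c * (Q\<^sup>2 * P)" using c by (simp add: exp_minus field_simps)
      then have "C1 * exp (\<epsilon> * real n) * N2 \<le> C1 * exp (\<epsilon> * real n) * (exp (\<epsilon> * real n) / c * (Q\<^sup>2 * P))"
        using C1 by (intro mult_left_mono) auto
      then show ?thesis using cmp[OF p] unfolding N1_def N2_def by linarith
    qed
    \<comment> \<open>Multiplying the bounds by P^3 and by Q^2 P produces the perfect square (P^2
      Q)^2.\<close>
    ultimately have "N1 * N1 \<le> (C2 * exp ((\<epsilon> - 2 * gap / width) * real n) * P ^ 3) *
        (C1 * exp (\<epsilon> * real n) * (exp (\<epsilon> * real n) / c * (Q\<^sup>2 * P)))"
      using N by (intro mult_mono) auto
    also have "\<dots> = C1 * C2 / c * (exp ((\<epsilon> - 2 * gap / width) * real n) * exp (\<epsilon> * real n) * exp (\<epsilon> * real n)) * (P\<^sup>2 * Q)\<^sup>2"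
      by (simp add: power2_eq_square power3_eq_cube)
    also have "exp ((\<epsilon> - 2 * gap / width) * real n) * exp (\<epsilon> * real n) * exp (\<epsilon> * real n) = (exp (- \<kappa> * real n))\<^sup>2"
      unfolding power2_eq_square exp_add[symmetric] \<epsilon>_def \<kappa>_def using width_pos by (simp add: field_simps)
    also have "C1 * C2 / c * (exp (- \<kappa> * real n))\<^sup>2 * (P\<^sup>2 * Q)\<^sup>2 = (C * exp (- \<kappa> * real n) * (P\<^sup>2 * Q))\<^sup>2"
      using c C1 C2 by (simp add: C_def power_mult_distrib)
    finally have "N1\<^sup>2 \<le> (C * exp (- \<kappa> * real n) * (P\<^sup>2 * Q))\<^sup>2" by (simp add: power2_eq_square)
    then have "N1 \<le> C * exp (- \<kappa> * real n) * (P\<^sup>2 * Q)"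
      by (rule power2_le_imp_le) (use C PQ in auto)
    then show ?thesis by (simp add: N1_def P_def Q_def)
  qed
  then show ?thesis using C \<kappa> by blast
qed

end

section \<open>Convergence of the quadrature rules\<close>

lemma weierstrass_poly:
  fixes f :: "real \<Rightarrow> real"
  assumes "continuous_on {a..b} f" "e > 0"
  obtains p where "\<And>x. x \<in> {a..b} \<Longrightarrow> \<bar>f x - poly p x\<bar> < e"
proof -
  obtain g where g: "real_polynomial_function g" "\<And>x. x \<in> {a..b} \<Longrightarrow> \<bar>f x - g x\<bar> < e"
    using Stone_Weierstrass_real_polynomial_function[of "{a..b}" f e] assms by auto
  then obtain c n where "g = (\<lambda>x. \<Sum>i\<le>n. c i * x ^ i)"
    by (auto simp: real_polynomial_function_iff_sum)
  then have "g x = poly (\<Sum>i\<le>n. monom (c i) i) x" for x by (simp add: poly_sum poly_monom)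
  then show thesis using g(2) by (intro that[of "\<Sum>i\<le>n. monom (c i) i"]) simp
qed

section \<open>Quadrature sums indexed by the set of nodes\<close>

context
  fixes \<mu>1 \<mu>2 :: "real measure" and n :: nat and Z :: "real set"
  assumes P: "diag_mop \<mu>1 \<mu>2 n = root_poly Z" and Z: "finite Z" "card Z = 2 * n"
begin

lemma bij_betw_node: "bij_betw (node \<mu>1 \<mu>2 n) {1..2 * n} Z"
proof -
  have "{x. poly (diag_mop \<mu>1 \<mu>2 n) x = 0} = Z" unfolding P using Z by (simp add: poly_root_poly_eq_0)
  then have nd: "node \<mu>1 \<mu>2 n k = sorted_list_of_set Z ! (k - 1)" for k
    by (simp add: node_def)
  have "bij_betw (\<lambda>i. sorted_list_of_set Z ! i) {..<2 * n} Z"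
    using Z by (intro bij_betw_nth) auto
  moreover have "bij_betw (\<lambda>k. k - 1) {1..2 * n} {..<2 * n}"
    by (rule bij_betw_byWitness[of _ "\<lambda>i. i + 1"]) auto
  ultimately have "bij_betw ((\<lambda>i. sorted_list_of_set Z ! i) \<circ> (\<lambda>k. k - 1)) {1..2 * n} Z"
    by (rule bij_betw_trans[rotated])
  then show ?thesis by (simp add: nd[abs_def] comp_def)
qed

lemma fundamental_poly_eq:
  assumes k: "k \<in> {1..2 * n}"
  shows "fundamental_poly \<mu>1 \<mu>2 n k = lagrange_poly Z (node \<mu>1 \<mu>2 n k)"
  unfolding fundamental_poly_def
proof (rule the_equality)
  let ?x = "node \<mu>1 \<mu>2 n"
  have inZ: "?x i \<in> Z" if "i \<in> {1..2 * n}" for i using bij_betwE[OF bij_betw_node] that by blast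
  have inj: "?x i = ?x k \<longleftrightarrow> i = k" if "i \<in> {1..2 * n}" for i
    using bij_betw_node k that by (auto simp: bij_betw_def inj_on_eq_iff)
  show L: "degree (lagrange_poly Z (?x k)) \<le> 2 * n - 1 \<and>
      (\<forall>i\<in>{1..2 * n}. poly (lagrange_poly Z (?x k)) (?x i) = (if i = k then 1 else 0))"
    using inZ inj k Z by (simp add: degree_lagrange_poly poly_lagrange_poly_node)
  fix l assume l: "degree l \<le> 2 * n - 1 \<and> (\<forall>i\<in>{1..2 * n}. poly l (?x i) = (if i = k then 1 else 0))"
  show "l = lagrange_poly Z (?x k)"
  proof (rule poly_eqI_degree[of Z])
    fix x assume "x \<in> Z"
    then obtain i where "i \<in> {1..2 * n}" "x = ?x i" using bij_betw_node by (auto simp: bij_betw_def)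
    then show "poly l x = poly (lagrange_poly Z (?x k)) x" using l L by simp
  qed (use l L Z k in auto)
qed

lemma quadrature_sum_eq:
  "(\<Sum>j=1..2*n. quad_weight \<mu>1 \<mu>2 \<mu> n j * f (node \<mu>1 \<mu>2 n j)) =
   (\<Sum>z\<in>Z. (\<integral>x. poly (lagrange_poly Z z) x \<partial>\<mu>) * f z)"
proof -
  have "(\<Sum>j=1..2*n. quad_weight \<mu>1 \<mu>2 \<mu> n j * f (node \<mu>1 \<mu>2 n j)) =
      (\<Sum>j=1..2*n. (\<integral>x. poly (lagrange_poly Z (node \<mu>1 \<mu>2 n j)) x \<partial>\<mu>) * f (node \<mu>1 \<mu>2 n j))"
    by (intro sum.cong refl) (simp add: quad_weight_def fundamental_poly_eq)
  also have "\<dots> = (\<Sum>z\<in>Z. (\<integral>x. poly (lagrange_poly Z z) x \<partial>\<mu>) * f z)"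
    by (rule sum.reindex_bij_betw[OF bij_betw_node])
  finally show ?thesis .
qed

end

context reg_measure
begin

lemma lagrange_quadrature_exact:
  assumes "finite Z" "degree p < card Z"
  shows "(\<Sum>z\<in>Z. (\<integral>x. poly (lagrange_poly Z z) x \<partial>\<mu>) * poly p z) = (\<integral>x. poly p x \<partial>\<mu>)"
proof -
  have e: "poly p x = (\<Sum>z\<in>Z. poly p z * poly (lagrange_poly Z z) x)" for x
    using arg_cong[OF lagrange_interpolation[OF assms], of "\<lambda>q. poly q x"] by (simp add: poly_sum)
  have "(\<integral>x. poly p x \<partial>\<mu>) = (\<integral>x. (\<Sum>z\<in>Z. poly p z * poly (lagrange_poly Z z) x) \<partial>\<mu>)"
    by (rule Bochner_Integration.integral_cong[OF refl e])
  also have "\<dots> = (\<Sum>z\<in>Z. poly p z * (\<integral>x. poly (lagrange_poly Z z) x \<partial>\<mu>))"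
    by (subst Bochner_Integration.integral_sum) auto
  finally show ?thesis by (simp add: mult.commute)
qed

text \<open>Polynomials that agree at all nodes differ by a multiple of \<open>root_poly Z\<close>,
  whose cofactor has degree below m and is annihilated by orthogonality.\<close>

lemma lagrange_integral_eq:
  assumes "finite Z" "z \<in> Z" and orth: "orthogonal_upto \<mu> (root_poly Z) m"
    and h: "degree h < card Z + m" "\<And>x. x \<in> Z \<Longrightarrow> poly h x = (if x = z then 1 else 0)"
  shows "(\<integral>x. poly (lagrange_poly Z z) x \<partial>\<mu>) = (\<integral>x. poly h x \<partial>\<mu>)"
proof -
  have "root_poly Z dvd h - lagrange_poly Z z"
    using assms by (intro root_poly_dvd) (auto simp: poly_lagrange_poly_node)
  then obtain q where q: "h - lagrange_poly Z z = root_poly Z * q" by auto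
  have "(\<integral>x. poly (root_poly Z * q) x \<partial>\<mu>) = 0"
  proof (cases "q = 0")
    case False
    have cZ: "card Z > 0" using assms(1,2) by (auto simp: card_gt_0_iff)
    have "degree (root_poly Z * q) < card Z + m"
      unfolding q[symmetric] using h cZ assms by (intro degree_diff_less) (simp_all add: degree_lagrange_poly)
    then have "degree q < m" using False by (simp add: degree_mult_eq)
    then show ?thesis by (rule orthogonal_uptoD[OF orth])
  qed simp
  then show ?thesis unfolding q[symmetric] by simp
qed

text \<open>Exactness for constants bounds the sum of the nonnegative weights on \<open>X n\<close>
  by mass + s n. The polynomial approximates f on \<open>{a..b}\<close> only; on
  \<open>{c..d}\<close> the error is merely bounded, and the vanishing sum of weights makes up for
  it.\<close>

lemma quadrature_convergence:
  fixes w :: "nat \<Rightarrow> real \<Rightarrow> real"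
  assumes fin: "\<And>n. n \<ge> 1 \<Longrightarrow> finite (X n) \<and> finite (Y n) \<and> X n \<inter> Y n = {}"
    and sub: "\<And>n. n \<ge> 1 \<Longrightarrow> X n \<subseteq> {a..b} \<and> Y n \<subseteq> {c..d}"
    and nonneg: "\<And>n z. n \<ge> 1 \<Longrightarrow> z \<in> X n \<Longrightarrow> 0 \<le> w n z"
    and exact: "\<And>n p. n \<ge> 1 \<Longrightarrow> degree p < n \<Longrightarrow> (\<Sum>z\<in>X n \<union> Y n. w n z * poly p z) = (\<integral>x. poly p x \<partial>\<mu>)"
    and small: "(\<lambda>n. \<Sum>z\<in>Y n. \<bar>w n z\<bar>) \<longlonglongrightarrow> 0"
    and cont: "continuous_on {a..b} f" "continuous_on {c..d} f"
  shows "(\<lambda>n. \<Sum>z\<in>X n \<union> Y n. w n z * f z) \<longlonglongrightarrow> (LINT x:{a..b}|\<mu>. f x)"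
proof (rule LIMSEQ_I)
  fix \<delta> :: real assume \<delta>: "\<delta> > 0"
  define s where "s n = (\<Sum>z\<in>Y n. \<bar>w n z\<bar>)" for n
  \<comment> \<open>Once s n < 1, the two errors e (mass + s n) and e mass add up to at most
    \<delta>/2.\<close>
  define e where "e = \<delta> / (4 * (mass + 1))"
  have e: "e > 0" using \<delta> mass_pos by (simp add: e_def)
  obtain p where p: "\<And>x. x \<in> {a..b} \<Longrightarrow> \<bar>f x - poly p x\<bar> < e" using weierstrass_poly[OF cont(1) e] by blast
  have "compact ((\<lambda>x. f x - poly p x) ` {c..d})"
    using cont by (intro compact_continuous_image continuous_intros) auto
  then obtain B where "B > 0" "\<forall>y\<in>(\<lambda>x. f x - poly p x) ` {c..d}. norm y \<le> B"
    using compact_imp_bounded bounded_pos by blast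
  then have B: "B > 0" "\<And>x. x \<in> {c..d} \<Longrightarrow> \<bar>f x - poly p x\<bar> \<le> B" by auto
  have "eventually (\<lambda>n. s n < min 1 (\<delta> / (4 * B))) sequentially"
    using small \<delta> B(1) unfolding s_def by (intro order_tendstoD) auto
  moreover have "eventually (\<lambda>n. n > degree p) sequentially" by (rule eventually_gt_at_top)
  ultimately have "eventually (\<lambda>n. norm ((\<Sum>z\<in>X n \<union> Y n. w n z * f z) - (LINT x:{a..b}|\<mu>. f x)) < \<delta>) sequentially"
  proof eventually_elim
    case (elim n)
    then have n: "n \<ge> 1" by simp
    note fin = fin[OF n] and sub = sub[OF n]
    have un: "(\<Sum>z\<in>X n \<union> Y n. g z) = (\<Sum>z\<in>X n. g z) + (\<Sum>z\<in>Y n. g z)" for g :: "real \<Rightarrow> real"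
      using fin by (simp add: sum.union_disjoint)
    have s0: "\<bar>\<Sum>z\<in>Y n. w n z\<bar> \<le> s n" unfolding s_def by (rule sum_abs)
    have "(\<Sum>z\<in>X n. w n z) + (\<Sum>z\<in>Y n. w n z) = mass"
      using exact[OF n, of 1] n by (simp add: un)
    then have sX: "(\<Sum>z\<in>X n. w n z) \<le> mass + s n" using s0 by linarith
    have "(\<Sum>z\<in>X n \<union> Y n. w n z * f z) - (\<integral>x. poly p x \<partial>\<mu>) =
        (\<Sum>z\<in>X n. w n z * (f z - poly p z)) + (\<Sum>z\<in>Y n. w n z * (f z - poly p z))"
      using exact[OF n, of p] elim(2) unfolding un by (simp add: algebra_simps sum_subtractf)
    moreover have "\<bar>\<Sum>z\<in>X n. w n z * (f z - poly p z)\<bar> \<le> e * (mass + s n)"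
    proof -
      have "\<bar>\<Sum>z\<in>X n. w n z * (f z - poly p z)\<bar> \<le> (\<Sum>z\<in>X n. \<bar>w n z * (f z - poly p z)\<bar>)" by (rule sum_abs)
      also have "\<dots> \<le> (\<Sum>z\<in>X n. w n z * e)"
      proof (rule sum_mono)
        fix z assume z: "z \<in> X n"
        then have "\<bar>f z - poly p z\<bar> \<le> e" using p sub by (simp add: less_imp_le subset_iff)
        then show "\<bar>w n z * (f z - poly p z)\<bar> \<le> w n z * e"
          using nonneg[OF n z] by (simp add: abs_mult mult_left_mono)
      qed
      also have "\<dots> = e * (\<Sum>z\<in>X n. w n z)" by (simp add: sum_distrib_left mult.commute)
      also have "\<dots> \<le> e * (mass + s n)" using sX e by (intro mult_left_mono) auto
      finally show ?thesis .
    qed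
    moreover have "\<bar>\<Sum>z\<in>Y n. w n z * (f z - poly p z)\<bar> \<le> s n * B"
    proof -
      have "\<bar>\<Sum>z\<in>Y n. w n z * (f z - poly p z)\<bar> \<le> (\<Sum>z\<in>Y n. \<bar>w n z * (f z - poly p z)\<bar>)" by (rule sum_abs)
      also have "\<dots> \<le> (\<Sum>z\<in>Y n. \<bar>w n z\<bar> * B)"
        unfolding abs_mult using B(2) sub by (intro sum_mono mult_left_mono) auto
      finally show ?thesis by (simp add: s_def sum_distrib_right)
    qed
    moreover have "\<bar>(\<integral>x. poly p x \<partial>\<mu>) - (LINT x:{a..b}|\<mu>. f x)\<bar> \<le> e * mass"
    proof -
      let ?g = "\<lambda>x. indicator {a..b} x *\<^sub>R f x"
      have gm: "?g \<in> borel_measurable borel"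
        by (rule borel_measurable_continuous_on_indicator) (use cont in auto)
      have gi: "integrable \<mu> ?g"
      proof (rule integrable_continuous[OF _ gm])
        show "continuous_on {a..b} ?g"
          by (rule continuous_on_cong[THEN iffD1, OF refl _ cont(1)]) auto
      qed
      have "\<bar>(\<integral>x. poly p x \<partial>\<mu>) - (LINT x:{a..b}|\<mu>. f x)\<bar> = \<bar>\<integral>x. poly p x - ?g x \<partial>\<mu>\<bar>"
        unfolding set_lebesgue_integral_def using gi by simp
      also have "\<dots> \<le> (\<integral>x. \<bar>poly p x - ?g x\<bar> \<partial>\<mu>)" by (rule integral_abs_bound)
      also have "\<dots> \<le> (\<integral>x. e \<partial>\<mu>)"
        by (rule integral_mono_ab) (use gi p in \<open>auto simp: abs_minus_commute less_imp_le\<close>)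
      finally show ?thesis by (simp add: mult.commute)
    qed
    ultimately have "\<bar>(\<Sum>z\<in>X n \<union> Y n. w n z * f z) - (LINT x:{a..b}|\<mu>. f x)\<bar> \<le> e * (mass + s n) + s n * B + e * mass"
      by linarith
    also have "\<dots> < \<delta>"
    proof -
      have "e * (mass + s n) + e * mass \<le> e * (2 * (mass + 1))"
        using elim(1) e by (simp add: algebra_simps)
      also have "\<dots> = \<delta> / 2" using mass_pos by (simp add: e_def field_simps)
      finally have "e * (mass + s n) + e * mass \<le> \<delta> / 2" .
      moreover have "s n * B < \<delta> / 4" using elim(1) B(1) by (simp add: field_simps)
      ultimately show ?thesis using \<delta> by linarith
    qed
    finally show ?case by simp
  qed
  then show "\<exists>no. \<forall>n\<ge>no. norm ((\<Sum>z\<in>X n \<union> Y n. w n z * f z) - (LINT x:{a..b}|\<mu>. f x)) < \<delta>"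
    by (simp add: eventually_sequentially)
qed

end

lemma root_poly_union: "finite X \<Longrightarrow> finite Y \<Longrightarrow> X \<inter> Y = {} \<Longrightarrow> root_poly (X \<union> Y) = root_poly X * root_poly Y"
  unfolding root_poly_def by (rule prod.union_disjoint)

context equal_pair
begin

lemma nodes_disjoint:
  assumes "pair n X Y" shows "X \<inter> Y = {}"
proof (rule equals0I)
  fix x assume "x \<in> X \<inter> Y"
  then have "x \<in> {a1..b1}" "x \<in> {a2..b2}" using node_in[OF assms] by blast+
  then show False using dist_bounds(1)[of x x] gap_pos by simp
qed

text \<open>Both kinds of weights are computed by integrating, instead of the Lagrange polynomial, a
  polynomial of degree less than \<open>3n\<close> that agrees with it at all nodes.\<close>

lemma weight_nonneg:
  assumes p: "pair n X Y" and z: "z \<in> X"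
  shows "0 \<le> (\<integral>x. poly (lagrange_poly (X \<union> Y) z) x \<partial>\<mu>1)"
proof -
  note nd = node_in[OF p]
  have cf: "m1.config n X Y" using p by (simp add: pair_def)
  have dis: "X \<inter> Y = {}" by (rule nodes_disjoint[OF p])
  obtain \<sigma> :: real where \<sigma>: "\<sigma>\<^sup>2 = 1" "\<And>x. x \<in> {a1..b1} \<Longrightarrow> \<bar>nodal Y x\<bar> = \<sigma> * nodal Y x"
    using m1.config_sign[OF cf] by metis
  define K where "K = (nodal (X - {z}) z)\<^sup>2 * nodal Y z"
  have K: "K \<noteq> 0" using nd dis z by (auto simp: K_def poly_root_poly_eq_0)
  \<comment> \<open>A constant times (p / (x - z))^2 q, of degree 3n - 2: since q has constant sign
    on \<open>{a1..b1}\<close> and h z = 1, it is nonnegative there.\<close>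
  define h where "h = smult (1 / K) ((root_poly (X - {z}))\<^sup>2 * root_poly Y)"
  have "(\<integral>x. poly (lagrange_poly (X \<union> Y) z) x \<partial>\<mu>1) = (\<integral>x. poly h x \<partial>\<mu>1)"
  proof (rule m1.lagrange_integral_eq)
    show "orthogonal_upto \<mu>1 (root_poly (X \<union> Y)) n"
      using cf nd dis by (simp add: root_poly_union m1.config_def)
    have "degree ((root_poly (X - {z}))\<^sup>2 * root_poly Y) \<le> 2 * (n - 1) + n"
      using nd z by (intro order.trans[OF degree_mult_le]) (simp add: degree_power_eq)
    then have "degree h < 3 * n" unfolding h_def using nd(7) K by simp
    then show "degree h < card (X \<union> Y) + n" using nd dis by (simp add: card_Un_disjoint)
    fix x assume "x \<in> X \<union> Y"
    then show "poly h x = (if x = z then 1 else 0)"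
      using nd K dis z by (auto simp: h_def K_def poly_root_poly_eq_0)
  qed (use nd z in auto)
  also have "\<dots> \<ge> 0"
  proof (rule m1.integral_nonneg_ab)
    fix x assume x: "x \<in> {a1..b1}"
    have "z \<in> {a1..b1}" using nd(1) z by blast
    then have "poly h x = (nodal (X - {z}) x)\<^sup>2 / (nodal (X - {z}) z)\<^sup>2 *
        ((\<sigma> * nodal Y x) / (\<sigma> * nodal Y z))"
      using \<sigma>(1) by (auto simp: h_def K_def)
    also have "\<dots> \<ge> 0" using \<sigma>(2)[OF x] \<sigma>(2)[OF \<open>z \<in> {a1..b1}\<close>] by (metis abs_ge_zero divide_nonneg_nonneg mult_nonneg_nonneg zero_le_power2)
    finally show "0 \<le> poly h x" .
  qed
  finally show ?thesis .
qed

lemma weight_abs_le: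
  assumes p: "pair n X Y" and z: "z \<in> Y"
  shows "\<bar>\<integral>x. poly (lagrange_poly (X \<union> Y) z) x \<partial>\<mu>1\<bar> \<le>
    m1.weighted_norm X Y / (gap * (nodal_weight X (Y - {z}) z))"
proof -
  note nd = node_in[OF p]
  have cf: "m1.config n X Y" using p by (simp add: pair_def)
  have dis: "X \<inter> Y = {}" by (rule nodes_disjoint[OF p])
  define K where "K = (nodal X z)\<^sup>2 * nodal (Y - {z}) z"
  have K: "K \<noteq> 0" using nd dis z by (auto simp: K_def poly_root_poly_eq_0)
  define h where "h = smult (1 / K) ((root_poly X)\<^sup>2 * root_poly (Y - {z}))"
  have "(\<integral>x. poly (lagrange_poly (X \<union> Y) z) x \<partial>\<mu>1) = (\<integral>x. poly h x \<partial>\<mu>1)"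
  proof (rule m1.lagrange_integral_eq)
    show "orthogonal_upto \<mu>1 (root_poly (X \<union> Y)) n"
      using cf nd dis by (simp add: root_poly_union m1.config_def)
    have "degree ((root_poly X)\<^sup>2 * root_poly (Y - {z})) \<le> 2 * n + (n - 1)"
      using nd z by (intro order.trans[OF degree_mult_le]) (simp add: degree_power_eq)
    then have "degree h < 3 * n" unfolding h_def using nd(7) K by simp
    then show "degree h < card (X \<union> Y) + n" using nd dis by (simp add: card_Un_disjoint)
    fix x assume "x \<in> X \<union> Y"
    then show "poly h x = (if x = z then 1 else 0)"
      using nd K dis z by (auto simp: h_def K_def poly_root_poly_eq_0)
  qed (use nd z in auto)
  also have "\<bar>\<dots>\<bar> \<le> (\<integral>x. \<bar>poly h x\<bar> \<partial>\<mu>1)" by (rule integral_abs_bound)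
  also have "\<dots> \<le> (\<integral>x. 1 / (gap * \<bar>K\<bar>) * (nodal_weight X Y x) \<partial>\<mu>1)"
  proof (intro m1.integral_mono_ab m1.integrable_cont continuous_intros)
    fix x assume x: "x \<in> {a1..b1}"
    let ?q = "\<bar>nodal (Y - {z}) x\<bar>"
    have "gap * ?q \<le> \<bar>x - z\<bar> * ?q"
      using dist_bounds(1)[OF x nd(2)[OF z]] by (intro mult_right_mono) (auto simp: abs_minus_commute)
    also have "\<dots> = \<bar>nodal Y x\<bar>"
      using poly_root_poly_remove[OF nd(4) z, of x] by (simp add: abs_mult)
    finally have q: "?q \<le> \<bar>nodal Y x\<bar> / gap" using gap_pos by (simp add: field_simps)
    have "\<bar>poly h x\<bar> = (nodal X x)\<^sup>2 * ?q / \<bar>K\<bar>" by (simp add: h_def abs_mult)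
    also have "\<dots> \<le> (nodal X x)\<^sup>2 * (\<bar>nodal Y x\<bar> / gap) / \<bar>K\<bar>"
      using q by (intro divide_right_mono mult_left_mono) auto
    finally show "\<bar>poly h x\<bar> \<le> 1 / (gap * \<bar>K\<bar>) * (nodal_weight X Y x)"
      by (simp add: mult_ac)
  qed
  also have "\<dots> = m1.weighted_norm X Y / (gap * \<bar>K\<bar>)" unfolding m1.weighted_norm_def by simp
  finally show ?thesis by (simp add: K_def abs_mult)
qed

lemma exterior_weights_vanish:
  assumes p: "\<And>n. n \<ge> 1 \<Longrightarrow> pair n (X n) (Y n)"
  shows "(\<lambda>n. \<Sum>z\<in>Y n. \<bar>\<integral>x. poly (lagrange_poly (X n \<union> Y n) z) x \<partial>\<mu>1\<bar>) \<longlonglongrightarrow> 0"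
proof -
  obtain C \<kappa> where C: "C > 0" and \<kappa>: "\<kappa> > 0" and dec: "\<And>n X Y z. pair n X Y \<Longrightarrow> z \<in> Y \<Longrightarrow>
     m1.weighted_norm X Y \<le> C * exp (- \<kappa> * real n) * (nodal_weight X (Y - {z}) z)"
    using weight_decay by blast
  show ?thesis
  proof (rule Lim_null_comparison)
    show "(\<lambda>n. real n * (C * exp (- \<kappa> * real n) / gap)) \<longlonglongrightarrow> 0"
      using \<kappa> C gap_pos by real_asymp
    show "\<forall>\<^sub>F n in sequentially. norm (\<Sum>z\<in>Y n. \<bar>\<integral>x. poly (lagrange_poly (X n \<union> Y n) z) x \<partial>\<mu>1\<bar>)
        \<le> real n * (C * exp (- \<kappa> * real n) / gap)"
      using eventually_ge_at_top[of 1]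
    proof eventually_elim
      case (elim n)
      note pn = p[OF elim]
      note nd = node_in[OF pn]
      have "(\<Sum>z\<in>Y n. \<bar>\<integral>x. poly (lagrange_poly (X n \<union> Y n) z) x \<partial>\<mu>1\<bar>)
          \<le> real (card (Y n)) * (C * exp (- \<kappa> * real n) / gap)"
      proof (rule sum_bounded_above)
        fix z assume z: "z \<in> Y n"
        define K where "K = nodal_weight (X n) (Y n - {z}) z"
        have "K \<noteq> 0" using nd nodes_disjoint[OF pn] z by (auto simp: K_def poly_root_poly_eq_0)
        then have K: "K > 0" by (auto simp: K_def less_le)
        have "\<bar>\<integral>x. poly (lagrange_poly (X n \<union> Y n) z) x \<partial>\<mu>1\<bar> \<le> m1.weighted_norm (X n) (Y n) / (gap * K)"
          unfolding K_def by (rule weight_abs_le[OF pn z])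
        also have "\<dots> \<le> (C * exp (- \<kappa> * real n) * K) / (gap * K)"
          using dec[OF pn z] K gap_pos unfolding K_def[symmetric] by (intro divide_right_mono) auto
        also have "\<dots> = C * exp (- \<kappa> * real n) / gap" using K by simp
        finally show "\<bar>\<integral>x. poly (lagrange_poly (X n \<union> Y n) z) x \<partial>\<mu>1\<bar> \<le> C * exp (- \<kappa> * real n) / gap" .
      qed
      then show ?case using nd by (simp add: sum_nonneg)
    qed
  qed
qed

lemma lagrange_quadrature_convergence:
  assumes p: "\<And>n. n \<ge> 1 \<Longrightarrow> pair n (X n) (Y n)"
    and cont: "continuous_on {a1..b1} f" "continuous_on {a2..b2} f"
  shows "(\<lambda>n. \<Sum>z\<in>X n \<union> Y n. (\<integral>x. poly (lagrange_poly (X n \<union> Y n) z) x \<partial>\<mu>1) * f z)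
    \<longlonglongrightarrow> (LINT x:{a1..b1}|\<mu>1. f x)"
proof (rule m1.quadrature_convergence[where c=a2 and d=b2])
  fix n :: nat assume n: "n \<ge> 1"
  note nd = node_in[OF p[OF n]] and dis = nodes_disjoint[OF p[OF n]]
  show "finite (X n) \<and> finite (Y n) \<and> X n \<inter> Y n = {}" using nd dis by blast
  show "X n \<subseteq> {a1..b1} \<and> Y n \<subseteq> {a2..b2}" using nd by blast
  show "0 \<le> (\<integral>x. poly (lagrange_poly (X n \<union> Y n) z) x \<partial>\<mu>1)" if "z \<in> X n" for z
    by (rule weight_nonneg[OF p[OF n] that])
  show "(\<Sum>z\<in>X n \<union> Y n. (\<integral>x. poly (lagrange_poly (X n \<union> Y n) z) x \<partial>\<mu>1) * poly q z) = (\<integral>x. poly q x \<partial>\<mu>1)"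
    if "degree q < n" for q
    by (rule m1.lagrange_quadrature_exact) (use nd dis that in \<open>auto simp: card_Un_disjoint\<close>)
qed (use exterior_weights_vanish[OF p] cont in auto)

end

theorem theorem3p3:
  fixes a1 b1 a2 b2 :: real
    and \<mu>1 \<mu>2 :: "real measure"
    and w1 w2 :: "real \<Rightarrow> ennreal"
    and f :: "real \<Rightarrow> real"
  assumes "angelesco_system a1 b1 a2 b2 \<mu>1 \<mu>2"
    and "is_ac_density \<mu>1 w1" and "AE x in lborel. x \<in> {a1..b1} \<longrightarrow> 0 < w1 x"
    and "is_ac_density \<mu>2 w2" and "AE x in lborel. x \<in> {a2..b2} \<longrightarrow> 0 < w2 x"
    and "b1 - a1 = b2 - a2"
    and "a2 - b1 > 0"
    and "continuous_on {a1..b1} f" and "continuous_on {a2..b2} f"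
  shows "(\<lambda>n. \<Sum>j=1..2*n. quad_weight \<mu>1 \<mu>2 \<mu>1 n j * f (node \<mu>1 \<mu>2 n j))
           \<longlonglongrightarrow> (LINT x:{a1..b1}|\<mu>1. f x)
       \<and> (\<lambda>n. \<Sum>j=1..2*n. quad_weight \<mu>1 \<mu>2 \<mu>2 n j * f (node \<mu>1 \<mu>2 n j))
           \<longlonglongrightarrow> (LINT x:{a2..b2}|\<mu>2. f x)"
proof -
  have r1: "reg_measure \<mu>1 a1 b1"
    using assms by (intro reg_measureI[of _ _ _ w1]) (auto simp: angelesco_system_def)
  have r2: "reg_measure \<mu>2 a2 b2"
    using assms by (intro reg_measureI[of _ _ _ w2]) (auto simp: angelesco_system_def)
  have ep: "equal_pair \<mu>1 a1 b1 \<mu>2 a2 b2"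
    using r1 r2 assms by (auto simp: equal_pair_def equal_pair_axioms_def)
  \<comment> \<open>The second rule is the first one for the interchanged measures, with the roles
    of \<open>X\<close> and \<open>Y\<close> exchanged.\<close>
  have ep': "equal_pair \<mu>2 a2 b2 \<mu>1 a1 b1" by (rule equal_pair.swap[OF ep])
  have "\<forall>n. \<exists>X Y. finite X \<and> finite Y \<and> card X = n \<and> card Y = n \<and> X \<subseteq> {a1<..<b1} \<and> Y \<subseteq> {a2<..<b2} \<and>
     diag_mop \<mu>1 \<mu>2 n = root_poly X * root_poly Y \<and>
     orthogonal_upto \<mu>1 (root_poly X * root_poly Y) n \<and> orthogonal_upto \<mu>2 (root_poly X * root_poly Y) n"
    using diag_mop_properties[OF r1 r2] assms(7) by simp
  then obtain X Y where XY: "\<And>n. finite (X n) \<and> finite (Y n) \<and> card (X n) = n \<and> card (Y n) = n \<and>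
      X n \<subseteq> {a1<..<b1} \<and> Y n \<subseteq> {a2<..<b2} \<and> diag_mop \<mu>1 \<mu>2 n = root_poly (X n) * root_poly (Y n) \<and>
      orthogonal_upto \<mu>1 (root_poly (X n) * root_poly (Y n)) n \<and> orthogonal_upto \<mu>2 (root_poly (X n) * root_poly (Y n)) n"
    by metis
  have pr: "equal_pair.pair \<mu>1 a1 b1 \<mu>2 a2 b2 n (X n) (Y n)" if "n \<ge> 1" for n
    using XY[of n] assms(7) that
    by (auto simp: equal_pair.pair_def[OF ep] reg_measure.config_def[OF r1] reg_measure.config_def[OF r2] mult.commute)
  then have pr': "equal_pair.pair \<mu>2 a2 b2 \<mu>1 a1 b1 n (Y n) (X n)" if "n \<ge> 1" for n
    using that by (auto simp: equal_pair.pair_def[OF ep] equal_pair.pair_def[OF ep'])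
  have dis: "X n \<inter> Y n = {}" for n
  proof -
    have "x \<noteq> y" if "x \<in> X n" "y \<in> Y n" for x y
    proof -
      have "x < b1" "a2 < y" using XY[of n] that by auto
      then show ?thesis using assms(7) by linarith
    qed
    then show ?thesis by blast
  qed
  have sums: "(\<Sum>j=1..2*n. quad_weight \<mu>1 \<mu>2 \<mu> n j * f (node \<mu>1 \<mu>2 n j)) =
     (\<Sum>z\<in>X n \<union> Y n. (\<integral>x. poly (lagrange_poly (X n \<union> Y n) z) x \<partial>\<mu>) * f z)" for n \<mu>
    by (rule quadrature_sum_eq) (use XY[of n] dis[of n] in \<open>auto simp: root_poly_union card_Un_disjoint\<close>)
  show ?thesis
    unfolding sums
    using equal_pair.lagrange_quadrature_convergence[OF ep pr assms(8,9)]
      equal_pair.lagrange_quadrature_convergence[OF ep' pr' assms(9,8)]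
    by (simp add: Un_commute)
qed

end
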